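(* Let $\Phi\in\mathbb{C}\langle\!\langle x,y\rangle\!\rangle$ be a Drinfeld associator, and let $\mathfrak g$ and $\mathfrak h$ be Lie algebras with chosen elements $t_{\mathfrak g}\in(S^2\mathfrak g)^{\mathfrak g}$, $t_{\mathfrak h}\in(S^2\mathfrak h)^{\mathfrak h}$. Let $$F:U(\mathfrak g\oplus\mathfrak g\oplus\mathfrak h)\text{-Mod}^\Phi\to U(\mathfrak g\oplus\mathfrak h)\text{-Mod}^\Phi,\qquad F(X)=X,$$ be the functor coming from the morphism of Lie algebras $\mathfrak g\oplus\mathfrak h\to\mathfrak g\oplus\mathfrak g\oplus\mathfrak h$, $(u,v)\mapsto(u,u,v)$. Then $F$ is a monoidal functor, where the coherence map $F(X)\otimes F(Y)\to F(X\otimes Y)$ is the natural transformation defined by the action on $X\otimes Y$ of the element $J\in(U\mathfrak g)^{\otimes4}[\![\hbar]\!]=\bigl(U(\mathfrak g\oplus\mathfrak g)\bigr)^{\otimes2}[\![\hbar]\!]$ defined in the context.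
   Context: **Drinfeld category.** For a Lie algebra $\mathfrak a$ with a chosen $t\in(S^2\mathfrak a)^{\mathfrak a}$ and a Drinfeld associator $\Phi\in\mathbb C\langle\!\langle x,y\rangle\!\rangle$ (normalized so that $\Phi(x,y)=1+\frac1{24}[x,y]+\cdots$), $U\mathfrak a\text{-Mod}^\Phi$ is the braided monoidal category with the same objects and tensor products as $U\mathfrak a\text{-Mod}$, with $\mathrm{Hom}_{U\mathfrak a\text{-Mod}^\Phi}(X,Y)=\mathrm{Hom}_{U\mathfrak a\text{-Mod}}(X,Y)[\![\hbar]\!]$, with associativity constraint $(X\otimes Y)\otimes Z\to X\otimes(Y\otimes Z)$ given by the action of $\Phi(\hbar t^{1,2},\hbar t^{2,3})$, and with braiding $X\otimes Y\to Y\otimes X$ given by the action of $\exp(\hbar t^{1,2}/2)$ followed by the flip. Here $t^{i,j}$ is $t$ acting in the $i$-th and $j$-th tensor factors. Everything is over $\mathbb C$. A direct sum of Lie algebras with chosen elements carries the sum of the chosen elements; in particular $\mathfrak g\oplus\mathfrak g\oplus\mathfrak h$ carries $t_{\mathfrak g}$ in each copy of $\mathfrak g$ plus $t_{\mathfrak h}$. **The element $J$.** With $t=t_{\mathfrak g}$, $$J=(\Phi^{1,3,24})^{-1}\,\Phi^{3,2,4}\,e^{\hbar t^{2,3}/2}\,(\Phi^{2,3,4})^{-1}\,\Phi^{1,2,34}\in(U\mathfrak g)^{\otimes4}[\![\hbar]\!],$$ where $\Phi^{I,K,L}$ is $\Phi(\hbar t^{1,2},\hbar t^{2,3})\in(U\mathfrak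 g)^{\otimes3}[\![\hbar]\!]$ placed in the indicated tensor slots, a multi-index such as $34$ meaning that the coproduct is applied. Equivalently, in $U\mathfrak g\text{-Mod}^\Phi$ the composite morphism $(X_1\otimes Y_1)\otimes(X_2\otimes Y_2)\to(X_1\otimes X_2)\otimes(Y_1\otimes Y_2)$ made of associativity constraints and the braiding of $Y_1$ with $X_2$ equals $(1\otimes s_{Y_1,X_2}\otimes1)\circ(J\cdot)$, where $s$ is the flip. In the identification $(U\mathfrak g)^{\otimes4}=(U(\mathfrak g\oplus\mathfrak g))^{\otimes2}$, slots 1,2 are the first and second copies of $\mathfrak g$ acting on $X$, and slots 3,4 are the first and second copies of $\mathfrak g$ acting on $Y$. **Monoidal functor.** The coherence maps are natural morphisms $F(X)\otimes F(Y)\to F(X\otimes Y)$ for which the two composites $(F(X)\otimes F(Y))\otimes F(Z)\to F(X\otimes(Y\otimes Z))$ (built with the associativity constraints of source and target) agree; the unit object $\mathbb C$ is sent to $\mathbb C$ with the identity as unit coherence. *)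

theory Defs
  imports
    Complex_Main
    "HOL-Library.Poly_Mapping"
    "HOL-Library.Product_Plus"
    "HOL-Library.Numeral_Type"
    "HOL-Computational_Algebra.Formal_Power_Series"
begin

section \<open>Complex vector spaces, algebras and Lie algebras\<close>

class complex_vector = ab_group_add +
  fixes scaleC :: "complex \<Rightarrow> 'a \<Rightarrow> 'a" (infixr \<open>*\<^sub>C\<close> 75)
  assumes scaleC_add_right: "c *\<^sub>C (x + y) = c *\<^sub>C x + c *\<^sub>C y"
    and scaleC_add_left: "(c + d) *\<^sub>C x = c *\<^sub>C x + d *\<^sub>C x"
    and scaleC_scaleC [simp]: "c *\<^sub>C d *\<^sub>C x = (c * d) *\<^sub>C x"
    and scaleC_one [simp]: "1 *\<^sub>C x = x"

global_interpretation complex_vector: vector_space "scaleC :: complex \<Rightarrow> 'a \<Rightarrow> 'a::complex_vector"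
  by unfold_locales (auto simp: scaleC_add_left scaleC_add_right)

global_interpretation complex_vector: vector_space_pair
  "scaleC :: complex \<Rightarrow> 'a \<Rightarrow> 'a::complex_vector"
  "scaleC :: complex \<Rightarrow> 'b \<Rightarrow> 'b::complex_vector"
  by unfold_locales

abbreviation clinear :: "('a::complex_vector \<Rightarrow> 'b::complex_vector) \<Rightarrow> bool"
  where "clinear \<equiv> Vector_Spaces.linear (*\<^sub>C) (*\<^sub>C)"

definition cbilinear :: "('a::complex_vector \<Rightarrow> 'b::complex_vector \<Rightarrow> 'c::complex_vector) \<Rightarrow> bool"
  where "cbilinear B \<longleftrightarrow> (\<forall>a. clinear (B a)) \<and> (\<forall>b. clinear (\<lambda>a. B a b))"

lemma clinearI:
  "(\<And>x y. f (x + y) = f x + f y) \<Longrightarrow> (\<And>c x. f (c *\<^sub>C x) = c *\<^sub>C f x) \<Longrightarrow> clinear f"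
  by unfold_locales (auto simp: scaleC_add_left scaleC_add_right)

lemma clinear_add: "clinear f \<Longrightarrow> f (x + y) = f x + f y"
  by (rule complex_vector.linear_add)

lemma clinear_scale: "clinear f \<Longrightarrow> f (c *\<^sub>C x) = c *\<^sub>C f x"
  by (rule complex_vector.linear_scale)

lemma clinear_0: "clinear f \<Longrightarrow> f 0 = 0"
  by (rule complex_vector.linear_0)

lemma clinear_diff: "clinear f \<Longrightarrow> f (x - y) = f x - f y"
  by (rule complex_vector.linear_diff)

lemma clinear_compose: "clinear f \<Longrightarrow> clinear g \<Longrightarrow> clinear (\<lambda>x. g (f x))"
  by (auto intro!: clinearI simp: clinear_add clinear_scale)

class complex_algebra_1 = complex_vector + ring_1 +
  assumes mult_scaleC_left [simp]: "(c *\<^sub>C x) * y = c *\<^sub>C (x * y)"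
    and mult_scaleC_right [simp]: "x * (c *\<^sub>C y) = c *\<^sub>C (x * y)"

class lie_algebra = complex_vector +
  fixes bracket :: "'a \<Rightarrow> 'a \<Rightarrow> 'a"
  assumes bracket_add_left: "bracket (x + y) z = bracket x z + bracket y z"
    and bracket_add_right: "bracket x (y + z) = bracket x y + bracket x z"
    and bracket_scaleC_left: "bracket (c *\<^sub>C x) y = c *\<^sub>C bracket x y"
    and bracket_scaleC_right: "bracket x (c *\<^sub>C y) = c *\<^sub>C bracket x y"
    and bracket_self [simp]: "bracket x x = 0"
    and bracket_jacobi:
      "bracket x (bracket y z) + bracket y (bracket z x) + bracket z (bracket x y) = 0"

instantiation complex :: complex_algebra_1
begin

definition scaleC_complex :: "complex \<Rightarrow> complex \<Rightarrow> complex"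
  where "scaleC_complex c x = c * x"

instance
  by standard (auto simp: scaleC_complex_def algebra_simps)

end

instantiation prod :: (complex_vector, complex_vector) complex_vector
begin

definition scaleC_prod :: "complex \<Rightarrow> 'a \<times> 'b \<Rightarrow> 'a \<times> 'b"
  where "scaleC_prod c x = (c *\<^sub>C fst x, c *\<^sub>C snd x)"

instance
  by standard (auto simp: scaleC_prod_def scaleC_add_left scaleC_add_right plus_prod_def)

end

instantiation prod :: (lie_algebra, lie_algebra) lie_algebra
begin

definition bracket_prod :: "'a \<times> 'b \<Rightarrow> 'a \<times> 'b \<Rightarrow> 'a \<times> 'b"
  where "bracket_prod x y = (bracket (fst x) (fst y), bracket (snd x) (snd y))"

instance
  by standard (auto simp: bracket_prod_def scaleC_prod_def plus_prod_def zero_prod_def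
      bracket_add_left bracket_add_right bracket_scaleC_left bracket_scaleC_right bracket_jacobi)

end

instantiation poly_mapping :: (type, complex_vector) complex_vector
begin

lift_definition scaleC_poly_mapping :: "complex \<Rightarrow> ('a \<Rightarrow>\<^sub>0 'b) \<Rightarrow> 'a \<Rightarrow>\<^sub>0 'b"
  is "\<lambda>c f k. c *\<^sub>C f k"
  by (erule rev_finite_subset) auto

instance
  by standard (transfer; auto simp: fun_eq_iff scaleC_add_left scaleC_add_right)+

end

lemma lookup_scaleC [simp]: "Poly_Mapping.lookup (c *\<^sub>C p) k = c *\<^sub>C Poly_Mapping.lookup p k"
  by transfer simp

lemma scaleC_single [simp]: "c *\<^sub>C Poly_Mapping.single k d = Poly_Mapping.single k (c *\<^sub>C d)"
  by (rule poly_mapping_eqI) (simp add: lookup_single when_def)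

lemma poly_mapping_eq_sum_single: "p = (\<Sum>k\<in>Poly_Mapping.keys p. Poly_Mapping.single k (Poly_Mapping.lookup p k))"
  by (rule poly_mapping_eqI)
     (auto simp: lookup_sum lookup_single when_def in_keys_iff sum.delta if_distrib cong: if_cong)

lemma poly_mapping_induct [case_names single add]:
  assumes "\<And>k c. P (Poly_Mapping.single k c)"
    and "\<And>p q. P p \<Longrightarrow> P q \<Longrightarrow> P (p + q)"
  shows "P (p :: 'a \<Rightarrow>\<^sub>0 'b::comm_monoid_add)"
proof -
  have "P (\<Sum>k\<in>A. Poly_Mapping.single k (Poly_Mapping.lookup p k))" if "finite A" for A
    using that
    by (induction A) (auto intro: assms simp: assms(1)[of undefined 0, simplified])
  from this[of "Poly_Mapping.keys p"] show ?thesis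
    using poly_mapping_eq_sum_single[of p] by simp
qed

instance poly_mapping :: (monoid_add, complex_algebra_1) complex_algebra_1
proof
  fix c :: complex and p q :: "'a \<Rightarrow>\<^sub>0 'b"
  have single: "c *\<^sub>C Poly_Mapping.single k a * Poly_Mapping.single l b =
      c *\<^sub>C (Poly_Mapping.single k a * Poly_Mapping.single l b)"
    "Poly_Mapping.single k a * c *\<^sub>C Poly_Mapping.single l b =
      c *\<^sub>C (Poly_Mapping.single k a * Poly_Mapping.single l b)" for k l and a b :: 'b
    by (simp_all add: mult_single)
  have "c *\<^sub>C Poly_Mapping.single k a * q = c *\<^sub>C (Poly_Mapping.single k a * q)" for k a
    by (induction q rule: poly_mapping_induct)
       (simp only: single, simp only: distrib_left scaleC_add_right)
  then show "c *\<^sub>C p * q = c *\<^sub>C (p * q)"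
    by (induction p rule: poly_mapping_induct)
       (assumption, simp only: distrib_right scaleC_add_right)
  have "p * c *\<^sub>C Poly_Mapping.single k a = c *\<^sub>C (p * Poly_Mapping.single k a)" for k a
    by (induction p rule: poly_mapping_induct)
       (simp only: single, simp only: distrib_right scaleC_add_right)
  then show "p * c *\<^sub>C q = c *\<^sub>C (p * q)"
    by (induction q rule: poly_mapping_induct)
       (assumption, simp only: distrib_left scaleC_add_right)
qed

definition lin_extend :: "('a \<Rightarrow> 'v::complex_vector) \<Rightarrow> ('a \<Rightarrow>\<^sub>0 complex) \<Rightarrow> 'v"
  where "lin_extend f p = (\<Sum>k\<in>Poly_Mapping.keys p. Poly_Mapping.lookup p k *\<^sub>C f k)"

lemma lin_extend_superset:
  assumes "finite A" "Poly_Mapping.keys p \<subseteq> A"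
  shows "lin_extend f p = (\<Sum>k\<in>A. Poly_Mapping.lookup p k *\<^sub>C f k)"
  unfolding lin_extend_def using assms
  by (intro sum.mono_neutral_left) (auto simp: in_keys_iff)

lemma lin_extend_single [simp]: "lin_extend f (Poly_Mapping.single k c) = c *\<^sub>C f k"
  by (simp add: lin_extend_superset[of "{k}"])

lemma clinear_lin_extend: "clinear (lin_extend f)"
proof (rule clinearI)
  fix p q :: "'a \<Rightarrow>\<^sub>0 complex" and c
  let ?A = "Poly_Mapping.keys p \<union> Poly_Mapping.keys q"
  show "lin_extend f (p + q) = lin_extend f p + lin_extend f q"
    using keys_add[of p q]
    by (simp add: lin_extend_superset[of ?A] lookup_add scaleC_add_left sum.distrib)
  have "Poly_Mapping.keys (c *\<^sub>C p) \<subseteq> Poly_Mapping.keys p"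
    by (auto simp: in_keys_iff)
  then show "lin_extend f (c *\<^sub>C p) = c *\<^sub>C lin_extend f p"
    by (simp add: lin_extend_superset[of "Poly_Mapping.keys p"] complex_vector.scale_sum_right
        scaleC_complex_def)
qed


section \<open>Tensor products\<close>

definition tensor_relators :: "('a::complex_vector \<times> 'b::complex_vector \<Rightarrow>\<^sub>0 complex) set"
  where "tensor_relators =
    (let \<delta> = (\<lambda>a b. Poly_Mapping.single (a, b) 1) in
      {\<delta> (a + a') b - \<delta> a b - \<delta> a' b |a a' b. True} \<union>
      {\<delta> a (b + b') - \<delta> a b - \<delta> a b' |a b b'. True} \<union>
      {\<delta> (c *\<^sub>C a) b - c *\<^sub>C \<delta> a b |c a b. True} \<union>
      {\<delta> a (c *\<^sub>C b) - c *\<^sub>C \<delta> a b |c a b. True})"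

definition tensor_rel ::
    "('a::complex_vector \<times> 'b::complex_vector \<Rightarrow>\<^sub>0 complex) \<Rightarrow> ('a \<times> 'b \<Rightarrow>\<^sub>0 complex) \<Rightarrow> bool"
  where "tensor_rel p q \<longleftrightarrow> p - q \<in> complex_vector.span tensor_relators"

lemma equivp_span_diff: "equivp (\<lambda>p q. p - q \<in> complex_vector.span S)"
proof (rule equivpI)
  show "reflp (\<lambda>p q. p - q \<in> complex_vector.span S)"
    by (auto intro!: reflpI complex_vector.span_zero)
  show "symp (\<lambda>p q. p - q \<in> complex_vector.span S)"
    by (rule sympI) (metis complex_vector.span_neg minus_diff_eq)
  show "transp (\<lambda>p q. p - q \<in> complex_vector.span S)"
    by (rule transpI) (metis complex_vector.span_add diff_add_cancel add_diff_eq)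
qed

quotient_type (overloaded) ('a, 'b) tensor (infixr \<open>\<otimes>\<close> 75) =
  "('a::complex_vector) \<times> ('b::complex_vector) \<Rightarrow>\<^sub>0 complex" / tensor_rel
  using equivp_span_diff[of tensor_relators] by (simp add: tensor_rel_def[abs_def])

lemma span_diff_plus:
  "p - p' \<in> complex_vector.span S \<Longrightarrow> q - q' \<in> complex_vector.span S \<Longrightarrow>
    (p + q) - (p' + q') \<in> complex_vector.span S"
  by (metis complex_vector.span_add add_diff_add)

lemma span_diff_uminus:
  "p - p' \<in> complex_vector.span S \<Longrightarrow> (- p) - (- p') \<in> complex_vector.span S"
  by (metis complex_vector.span_neg minus_diff_minus)

lemma span_diff_scaleC:
  "p - p' \<in> complex_vector.span S \<Longrightarrow> (c *\<^sub>C p) - (c *\<^sub>C p') \<in> complex_vector.span S"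
  by (metis complex_vector.span_scale complex_vector.scale_right_diff_distrib)

instantiation tensor :: (complex_vector, complex_vector) complex_vector
begin

lift_definition zero_tensor :: "'a \<otimes> 'b" is 0 .

lift_definition plus_tensor :: "'a \<otimes> 'b \<Rightarrow> 'a \<otimes> 'b \<Rightarrow> 'a \<otimes> 'b" is "(+)"
  unfolding tensor_rel_def by (rule span_diff_plus)

lift_definition uminus_tensor :: "'a \<otimes> 'b \<Rightarrow> 'a \<otimes> 'b" is uminus
  unfolding tensor_rel_def by (rule span_diff_uminus)

definition minus_tensor :: "'a \<otimes> 'b \<Rightarrow> 'a \<otimes> 'b \<Rightarrow> 'a \<otimes> 'b"
  where "minus_tensor x y = x + (- y)"

lift_definition scaleC_tensor :: "complex \<Rightarrow> 'a \<otimes> 'b \<Rightarrow> 'a \<otimes> 'b" is scaleC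
  unfolding tensor_rel_def by (rule span_diff_scaleC)

lemma tensor_rel_refl_eq: "p = q \<Longrightarrow> tensor_rel p q"
  by (simp add: tensor_rel_def complex_vector.span_zero)

instance
  by standard
    ((unfold minus_tensor_def)?, transfer, rule tensor_rel_refl_eq,
      simp add: scaleC_add_left scaleC_add_right add_ac)+

end

lift_definition tens :: "'a::complex_vector \<Rightarrow> 'b::complex_vector \<Rightarrow> 'a \<otimes> 'b" (infixr \<open>\<otimes>\<close> 75)
  is "\<lambda>a b. Poly_Mapping.single (a, b) 1" .

lemma tens_add_left: "(a + a') \<otimes> b = a \<otimes> b + a' \<otimes> b"
proof (transfer, unfold tensor_rel_def)
  fix a a' :: 'a and b :: 'b
  show "Poly_Mapping.single (a + a', b) 1 - (Poly_Mapping.single (a, b) 1 + Poly_Mapping.single (a', b) 1)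
    \<in> complex_vector.span tensor_relators"
    by (rule complex_vector.span_base)
      (unfold tensor_relators_def Let_def diff_diff_eq [symmetric], blast)
qed

lemma tens_add_right: "a \<otimes> (b + b') = a \<otimes> b + a \<otimes> b'"
proof (transfer, unfold tensor_rel_def)
  fix a :: 'a and b b' :: 'b
  show "Poly_Mapping.single (a, b + b') 1 - (Poly_Mapping.single (a, b) 1 + Poly_Mapping.single (a, b') 1)
    \<in> complex_vector.span tensor_relators"
    by (rule complex_vector.span_base)
      (unfold tensor_relators_def Let_def diff_diff_eq [symmetric], blast)
qed

lemma tens_scaleC_left: "(c *\<^sub>C a) \<otimes> b = c *\<^sub>C (a \<otimes> b)"
proof (transfer, unfold tensor_rel_def)
  fix c and a :: 'a and b :: 'b
  show "Poly_Mapping.single (c *\<^sub>C a, b) 1 - c *\<^sub>C Poly_Mapping.single (a, b) 1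
    \<in> complex_vector.span tensor_relators"
    by (rule complex_vector.span_base) (unfold tensor_relators_def Let_def, blast)
qed

lemma tens_scaleC_right: "a \<otimes> (c *\<^sub>C b) = c *\<^sub>C (a \<otimes> b)"
proof (transfer, unfold tensor_rel_def)
  fix c and a :: 'a and b :: 'b
  show "Poly_Mapping.single (a, c *\<^sub>C b) 1 - c *\<^sub>C Poly_Mapping.single (a, b) 1
    \<in> complex_vector.span tensor_relators"
    by (rule complex_vector.span_base) (unfold tensor_relators_def Let_def, blast)
qed

lemma cbilinear_tens: "cbilinear (\<otimes>)"
  by (auto simp: cbilinear_def tens_add_left tens_add_right tens_scaleC_left tens_scaleC_right
      intro!: clinearI)

lemma tens_zero_left [simp]: "0 \<otimes> b = 0"
  using tens_scaleC_left[of 0 0 b] by simp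

lemma tens_zero_right [simp]: "a \<otimes> 0 = 0"
  using tens_scaleC_right[of a 0 0] by simp

lemma tensor_induct [case_names tens add]:
  assumes "\<And>a b. P (a \<otimes> b)" "\<And>x y. P x \<Longrightarrow> P y \<Longrightarrow> P (x + y)"
  shows "P z"
proof -
  have "P (abs_tensor p)" for p :: "'a \<times> 'b \<Rightarrow>\<^sub>0 complex"
  proof (induction p rule: poly_mapping_induct)
    case (single k c)
    have "abs_tensor (Poly_Mapping.single k c) = c *\<^sub>C (fst k \<otimes> snd k)"
      by (simp add: tens.abs_eq scaleC_tensor.abs_eq scaleC_complex_def)
    also have "\<dots> = (c *\<^sub>C fst k) \<otimes> snd k"
      by (rule tens_scaleC_left [symmetric])
    finally have "abs_tensor (Poly_Mapping.single k c) = (c *\<^sub>C fst k) \<otimes> snd k" .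
    then show ?case by (simp add: assms(1))
  next
    case (add p q)
    then show ?case by (simp add: assms(2) flip: plus_tensor.abs_eq)
  qed
  then show ?thesis by (metis Quotient_tensor Quotient_abs_rep)
qed

text \<open>The linear map induced by a bilinear map; the value does not depend on the chosen
  representative when the argument is bilinear.\<close>

definition tensor_lift ::
    "('a::complex_vector \<Rightarrow> 'b::complex_vector \<Rightarrow> 'c::complex_vector) \<Rightarrow> 'a \<otimes> 'b \<Rightarrow> 'c"
  where "tensor_lift B z = lin_extend (\<lambda>(a, b). B a b) (rep_tensor z)"

lemma tensor_lift_abs:
  assumes "cbilinear B"
  shows "tensor_lift B (abs_tensor p) = lin_extend (\<lambda>(a, b). B a b) p"
proof -
  let ?f = "lin_extend (\<lambda>(a, b). B a b)"
  have lin: "clinear (B a)" "clinear (\<lambda>a. B a b)" for a b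
    using assms by (auto simp: cbilinear_def)
  have rel: "?f r = 0" if "r \<in> tensor_relators" for r
    using that unfolding tensor_relators_def Let_def
    by (auto simp: clinear_diff[OF clinear_lin_extend] clinear_scale[OF clinear_lin_extend]
        clinear_add[OF lin(1)] clinear_add[OF lin(2)] clinear_scale[OF lin(1)]
        clinear_scale[OF lin(2)] scaleC_complex_def simp del: scaleC_single)
  have "?f r = 0" if "r \<in> complex_vector.span tensor_relators" for r
    using complex_vector.linear_eq_0_on_span[OF clinear_lin_extend rel that] .
  moreover have "rep_tensor (abs_tensor p) - p \<in> complex_vector.span tensor_relators"
    using Quotient_rep_abs[OF Quotient_tensor, of p] tensor_rel_refl_eq[of p p]
    by (simp add: tensor_rel_def)
  ultimately have "?f (rep_tensor (abs_tensor p) - p) = 0" by blast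
  then show ?thesis
    by (simp add: tensor_lift_def clinear_diff[OF clinear_lin_extend])
qed

lemma tensor_lift_tens: "cbilinear B \<Longrightarrow> tensor_lift B (a \<otimes> b) = B a b"
  by (simp add: tens.abs_eq tensor_lift_abs)

lemma tensor_lift_add: "cbilinear B \<Longrightarrow> tensor_lift B (x + y) = tensor_lift B x + tensor_lift B y"
  by (induction x rule: tensor.abs_induct, induction y rule: tensor.abs_induct)
     (simp add: tensor_lift_abs plus_tensor.abs_eq clinear_add[OF clinear_lin_extend])

lemma tensor_lift_scaleC: "cbilinear B \<Longrightarrow> tensor_lift B (c *\<^sub>C x) = c *\<^sub>C tensor_lift B x"
  by (induction x rule: tensor.abs_induct)
     (simp add: tensor_lift_abs scaleC_tensor.abs_eq clinear_scale[OF clinear_lin_extend])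

lemma clinear_tensor_lift: "cbilinear B \<Longrightarrow> clinear (tensor_lift B)"
  by (intro clinearI tensor_lift_add tensor_lift_scaleC)

lemma tensor_lift_plus_fun:
  "tensor_lift (\<lambda>a b. B a b + B' a b) z = tensor_lift B z + tensor_lift B' z"
  by (simp add: tensor_lift_def lin_extend_def case_prod_beta scaleC_add_right sum.distrib)

lemma tensor_lift_scaleC_fun:
  "tensor_lift (\<lambda>a b. c *\<^sub>C B a b) z = c *\<^sub>C tensor_lift B z"
  by (simp add: tensor_lift_def lin_extend_def case_prod_beta complex_vector.scale_sum_right mult.commute)

definition tensor_map ::
    "('a::complex_vector \<Rightarrow> 'c::complex_vector) \<Rightarrow> ('b::complex_vector \<Rightarrow> 'd::complex_vector) \<Rightarrow>
      'a \<otimes> 'b \<Rightarrow> 'c \<otimes> 'd"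
  where "tensor_map f g = tensor_lift (\<lambda>a b. f a \<otimes> g b)"

lemma cbilinear_tensor_map: "clinear f \<Longrightarrow> clinear g \<Longrightarrow> cbilinear (\<lambda>a b. f a \<otimes> g b)"
  by (auto simp: cbilinear_def tens_add_left tens_add_right tens_scaleC_left tens_scaleC_right
      clinear_add clinear_scale intro!: clinearI)

lemma tensor_map_tens: "clinear f \<Longrightarrow> clinear g \<Longrightarrow> tensor_map f g (a \<otimes> b) = f a \<otimes> g b"
  by (simp add: tensor_map_def tensor_lift_tens cbilinear_tensor_map)

lemma clinear_tensor_map: "clinear f \<Longrightarrow> clinear g \<Longrightarrow> clinear (tensor_map f g)"
  unfolding tensor_map_def by (intro clinear_tensor_lift cbilinear_tensor_map)

definition tensor_swap :: "'a::complex_vector \<otimes> 'b::complex_vector \<Rightarrow> 'b \<otimes> 'a"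
  where "tensor_swap = tensor_lift (\<lambda>a b. b \<otimes> a)"

definition tensor_assoc ::
    "('a::complex_vector \<otimes> 'b::complex_vector) \<otimes> 'c::complex_vector \<Rightarrow> 'a \<otimes> ('b \<otimes> 'c)"
  where "tensor_assoc = tensor_lift (\<lambda>w c. tensor_lift (\<lambda>a b. a \<otimes> b \<otimes> c) w)"

lemma tens_eq_0_iff: "a \<otimes> b = 0 \<longleftrightarrow> a = 0 \<or> b = 0"
proof (intro iffI)
  assume *: "a \<otimes> b = 0"
  show "a = 0 \<or> b = 0"
  proof (rule ccontr)
    assume "\<not> ?thesis"
    then have "a \<noteq> 0" "b \<noteq> 0" by auto
    then obtain f :: "'a \<Rightarrow> complex" and g :: "'b \<Rightarrow> complex"
      where fg: "clinear f" "f a = 1" "clinear g" "g b = 1"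
      using complex_vector.linear_independent_extend[of "{a}" "\<lambda>_. 1 :: complex"]
        complex_vector.linear_independent_extend[of "{b}" "\<lambda>_. 1 :: complex"]
      by auto
    have "cbilinear (\<lambda>a b. f a * g b)"
      using fg by (auto simp: cbilinear_def clinear_add clinear_scale algebra_simps scaleC_complex_def
          intro!: clinearI)
    then have "tensor_lift (\<lambda>a b. f a * g b) (a \<otimes> b) = 1" "tensor_lift (\<lambda>a b. f a * g b) 0 = 0"
      using fg by (simp_all add: tensor_lift_tens clinear_0[OF clinear_tensor_lift])
    with * show False by simp
  qed
qed auto

instantiation tensor :: (complex_algebra_1, complex_algebra_1) complex_algebra_1
begin

definition one_tensor :: "'a \<otimes> 'b" where "one_tensor = 1 \<otimes> 1"

definition times_tensor :: "'a \<otimes> 'b \<Rightarrow> 'a \<otimes> 'b \<Rightarrow> 'a \<otimes> 'b"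
  where "times_tensor z w =
    tensor_lift (\<lambda>a b. tensor_lift (\<lambda>a' b'. (a * a') \<otimes> (b * b')) w) z"

lemma cbilinear_times_inner: "cbilinear (\<lambda>a' b'. (a * a') \<otimes> (b * b'))" for a :: 'a and b :: 'b
  by (auto simp: cbilinear_def tens_add_left tens_add_right tens_scaleC_left tens_scaleC_right
      algebra_simps intro!: clinearI)

lemma cbilinear_times_outer: "cbilinear (\<lambda>a b. tensor_lift (\<lambda>a' b'. (a * a') \<otimes> (b * b')) w)"
  for w :: "'a \<otimes> 'b"
  by (auto simp: cbilinear_def tens_add_left tens_add_right tens_scaleC_left tens_scaleC_right
      algebra_simps tensor_lift_plus_fun tensor_lift_scaleC_fun intro!: clinearI)

lemma times_tens_tens: "(a \<otimes> b) * (a' \<otimes> b') = (a * a') \<otimes> (b * b')"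
  for a a' :: 'a and b b' :: 'b
  unfolding times_tensor_def tensor_lift_tens[OF cbilinear_times_outer]
  by (rule tensor_lift_tens[OF cbilinear_times_inner])

instance
proof
  fix x y z :: "'a \<otimes> 'b" and c
  show add_left: "(x + y) * z = x * z + y * z" for x y z :: "'a \<otimes> 'b"
    unfolding times_tensor_def by (rule tensor_lift_add[OF cbilinear_times_outer])
  show scale_left: "(c *\<^sub>C x) * y = c *\<^sub>C (x * y)" for x y :: "'a \<otimes> 'b"
    unfolding times_tensor_def by (rule tensor_lift_scaleC[OF cbilinear_times_outer])
  show add_right: "x * (y + z) = x * y + x * z" for x y z :: "'a \<otimes> 'b"
    unfolding times_tensor_def
    by (simp add: tensor_lift_add[OF cbilinear_times_inner] tensor_lift_plus_fun)
  show scale_right: "x * (c *\<^sub>C y) = c *\<^sub>C (x * y)" for x y :: "'a \<otimes> 'b"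
    unfolding times_tensor_def
    by (simp add: tensor_lift_scaleC[OF cbilinear_times_inner] tensor_lift_scaleC_fun)
  have *: "((a \<otimes> b) * (a' \<otimes> b')) * z = (a \<otimes> b) * ((a' \<otimes> b') * z)"
    for a a' :: 'a and b b' :: 'b
    by (induction z rule: tensor_induct) (simp_all add: times_tens_tens mult.assoc add_right)
  have "((a \<otimes> b) * y) * z = (a \<otimes> b) * (y * z)" for a :: 'a and b :: 'b
    by (induction y rule: tensor_induct) (simp_all add: * add_right add_left)
  then show "(x * y) * z = x * (y * z)"
    by (induction x rule: tensor_induct) (simp_all add: add_left)
  show "1 * x = x"
    by (induction x rule: tensor_induct) (simp_all add: one_tensor_def times_tens_tens add_right)
  show "x * 1 = x"
    by (induction x rule: tensor_induct) (simp_all add: one_tensor_def times_tens_tens add_left)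
  show "(0 :: 'a \<otimes> 'b) \<noteq> 1"
    unfolding one_tensor_def by (metis tens_eq_0_iff zero_neq_one)
qed

end


section \<open>Algebras given by generators and relations\<close>

instantiation list :: (type) monoid_add
begin

definition zero_list :: "'a list" where "zero_list = []"
definition plus_list :: "'a list \<Rightarrow> 'a list \<Rightarrow> 'a list" where "plus_list = (@)"

instance
  by standard (auto simp: zero_list_def plus_list_def)

end

text \<open>The free algebra on \<open>'a\<close>: finite linear combinations of words, multiplied by concatenation.\<close>

type_synonym 'a free_algebra = "'a list \<Rightarrow>\<^sub>0 complex"

definition free_gen :: "'a \<Rightarrow> 'a free_algebra"
  where "free_gen a = Poly_Mapping.single [a] 1"

definition free_lift :: "('a \<Rightarrow> 'b::complex_algebra_1) \<Rightarrow> 'a free_algebra \<Rightarrow> 'b"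
  where "free_lift f = lin_extend (\<lambda>w. prod_list (map f w))"

lemma clinear_free_lift: "clinear (free_lift f)"
  by (simp add: free_lift_def clinear_lin_extend)

lemma free_lift_gen [simp]: "free_lift f (free_gen a) = f a"
  by (simp add: free_lift_def free_gen_def)

lemma free_lift_one [simp]: "free_lift f 1 = 1"
proof -
  have "free_lift f (Poly_Mapping.single 0 1) = 1"
    unfolding free_lift_def lin_extend_single by (simp add: zero_list_def)
  then show ?thesis by simp
qed

lemma free_lift_mult [simp]: "free_lift f (p * q) = free_lift f p * free_lift f q"
proof -
  note lift_add = clinear_add[OF clinear_free_lift]
  have "free_lift f (Poly_Mapping.single u c * q) = free_lift f (Poly_Mapping.single u c) * free_lift f q"
    for u c
  proof (induction q rule: poly_mapping_induct)
    case (single k d)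
    then show ?case by (simp add: mult_single free_lift_def plus_list_def)
  next
    case (add p q)
    then show ?case by (simp only: distrib_left lift_add)
  qed
  then show ?thesis
    by (induction p rule: poly_mapping_induct) (simp_all add: distrib_right lift_add)
qed

definition generated_ideal :: "'a::complex_algebra_1 set \<Rightarrow> 'a set"
  where "generated_ideal R = complex_vector.span {p * r * q |p r q. r \<in> R}"

lemma generated_ideal_mult:
  assumes "x \<in> generated_ideal R"
  shows "p * x \<in> generated_ideal R" "x * p \<in> generated_ideal R"
proof -
  let ?S = "{p * r * q |p r q. r \<in> R}"
  have "p * x \<in> complex_vector.span ?S \<and> x * p \<in> complex_vector.span ?S"
    using assms unfolding generated_ideal_def
  proof (induction x rule: complex_vector.span_induct_alt)
    case base
    show ?case by (simp add: complex_vector.span_zero)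
  next
    case (step c x y)
    then obtain a r b where x: "x = a * r * b" "r \<in> R" by blast
    have "p * x = (p * a) * r * b" "x * p = a * r * (b * p)"
      by (simp_all add: x mult.assoc)
    then have "p * x \<in> ?S" "x * p \<in> ?S" using x(2) by blast+
    then have "p * x \<in> complex_vector.span ?S" "x * p \<in> complex_vector.span ?S"
      by (auto intro: complex_vector.span_base)
    with step show ?case
      by (auto simp: distrib_left distrib_right intro!: complex_vector.span_add complex_vector.span_scale)
  qed
  then show "p * x \<in> generated_ideal R" "x * p \<in> generated_ideal R"
    by (simp_all add: generated_ideal_def)
qed

lemma generated_ideal_diff_mult:
  assumes "p - p' \<in> generated_ideal R" "q - q' \<in> generated_ideal R"
  shows "p * q - p' * q' \<in> generated_ideal R"
proof -
  have "p * q - p' * q' = (p - p') * q + p' * (q - q')"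
    by (simp add: algebra_simps)
  then show ?thesis
    using generated_ideal_mult(2)[OF assms(1), of q] generated_ideal_mult(1)[OF assms(2), of p']
    by (simp add: generated_ideal_def complex_vector.span_add)
qed

lemma free_lift_generated_ideal:
  assumes "\<And>r. r \<in> R \<Longrightarrow> free_lift f r = 0" "x \<in> generated_ideal R"
  shows "free_lift f x = 0"
proof -
  have "free_lift f y = 0" if "y \<in> {p * r * q |p r q. r \<in> R}" for y
    using that assms(1) by auto
  then show ?thesis
    using complex_vector.linear_eq_0_on_span[OF clinear_free_lift _ assms(2)[unfolded generated_ideal_def]]
    by blast
qed


subsection \<open>The universal enveloping algebra\<close>

definition uea_relators :: "'g::lie_algebra free_algebra set"
  where "uea_relators =
    {free_gen (a + b) - free_gen a - free_gen b |a b. True} \<union>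
    {free_gen (c *\<^sub>C a) - c *\<^sub>C free_gen a |c a. True} \<union>
    {free_gen a * free_gen b - free_gen b * free_gen a - free_gen (bracket a b) |a b. True}"

definition uea_rel :: "'g::lie_algebra free_algebra \<Rightarrow> 'g free_algebra \<Rightarrow> bool"
  where "uea_rel p q \<longleftrightarrow> p - q \<in> generated_ideal uea_relators"

quotient_type (overloaded) 'g uea = "('g::lie_algebra) free_algebra" / uea_rel
  using equivp_span_diff by (simp add: uea_rel_def[abs_def] generated_ideal_def)

lemma uea_rel_refl_eq: "p = q \<Longrightarrow> uea_rel p q"
  by (simp add: uea_rel_def generated_ideal_def complex_vector.span_zero)

definition lie_hom_into :: "('g::lie_algebra \<Rightarrow> 'a::complex_algebra_1) \<Rightarrow> bool"
  where "lie_hom_into f \<longleftrightarrow> clinear f \<and> (\<forall>a b. f (bracket a b) = f a * f b - f b * f a)"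

lemma free_lift_uea_rel:
  assumes "lie_hom_into f" "uea_rel p q"
  shows "free_lift f p = free_lift f q"
proof -
  have f: "clinear f" "\<And>a b. f (bracket a b) = f a * f b - f b * f a"
    using assms(1) by (auto simp: lie_hom_into_def)
  have "free_lift f r = 0" if "r \<in> uea_relators" for r
    using that by (auto simp: uea_relators_def clinear_diff[OF clinear_free_lift]
        clinear_scale[OF clinear_free_lift] clinear_add[OF f(1)] clinear_scale[OF f(1)] f(2))
  from free_lift_generated_ideal[OF this] assms(2)
  have "free_lift f (p - q) = 0" by (auto simp: uea_rel_def)
  then show ?thesis by (simp add: clinear_diff[OF clinear_free_lift])
qed

instantiation uea :: (lie_algebra) complex_algebra_1
begin

lift_definition zero_uea :: "'a uea" is 0 .
lift_definition one_uea :: "'a uea" is 1 .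

lift_definition plus_uea :: "'a uea \<Rightarrow> 'a uea \<Rightarrow> 'a uea" is "(+)"
  unfolding uea_rel_def generated_ideal_def by (rule span_diff_plus)

lift_definition uminus_uea :: "'a uea \<Rightarrow> 'a uea" is uminus
  unfolding uea_rel_def generated_ideal_def by (rule span_diff_uminus)

definition minus_uea :: "'a uea \<Rightarrow> 'a uea \<Rightarrow> 'a uea"
  where "minus_uea x y = x + (- y)"

lift_definition scaleC_uea :: "complex \<Rightarrow> 'a uea \<Rightarrow> 'a uea" is scaleC
  unfolding uea_rel_def generated_ideal_def by (rule span_diff_scaleC)

lift_definition times_uea :: "'a uea \<Rightarrow> 'a uea \<Rightarrow> 'a uea" is "(*)"
  unfolding uea_rel_def by (rule generated_ideal_diff_mult)

instance
proof
  show "(0 :: 'a uea) \<noteq> 1"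
  proof (transfer, rule notI)
    assume "uea_rel 0 (1 :: 'a free_algebra)"
    moreover have "lie_hom_into (\<lambda>_ :: 'a. 0 :: complex)"
      by (auto simp: lie_hom_into_def intro!: clinearI)
    ultimately have "free_lift (\<lambda>_. 0 :: complex) (0 :: 'a free_algebra) = free_lift (\<lambda>_. 0) (1 :: 'a free_algebra)"
      by (intro free_lift_uea_rel)
    then show False by (simp add: clinear_0[OF clinear_free_lift])
  qed
qed ((unfold minus_uea_def)?, transfer, rule uea_rel_refl_eq,
      simp add: scaleC_add_left scaleC_add_right add_ac mult.assoc distrib_left distrib_right)+

end

lift_definition uea_gen :: "'g::lie_algebra \<Rightarrow> 'g uea" (\<open>\<iota>\<close>) is free_gen .

lemma lie_hom_into_uea_gen: "lie_hom_into \<iota>"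
proof -
  have base: "r \<in> uea_relators \<Longrightarrow> r \<in> generated_ideal uea_relators" for r :: "'a free_algebra"
    unfolding generated_ideal_def
    by (rule complex_vector.span_base) (metis (mono_tags, lifting) mem_Collect_eq mult_1_left mult_1_right)
  have 1: "\<iota> (a + b) = \<iota> a + \<iota> b" for a b :: 'a
    by (transfer, unfold uea_rel_def, rule base)
       (unfold uea_relators_def diff_diff_eq [symmetric], blast)
  have 2: "\<iota> (c *\<^sub>C a) = c *\<^sub>C \<iota> a" for c and a :: 'a
    by (transfer, unfold uea_rel_def, rule base) (unfold uea_relators_def, blast)
  have "\<iota> a * \<iota> b + - (\<iota> b * \<iota> a) = \<iota> (bracket a b)" for a b :: 'a
    by (transfer, unfold uea_rel_def, rule base) (unfold uea_relators_def, simp, blast)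
  then have 3: "\<iota> (bracket a b) = \<iota> a * \<iota> b - \<iota> b * \<iota> a" for a b :: 'a
    by simp
  show ?thesis by (auto simp: lie_hom_into_def 1 2 3 intro!: clinearI)
qed

text \<open>The algebra homomorphism extending a Lie algebra map into an associative algebra; the value
  does not depend on the chosen representative when the map is a Lie homomorphism.\<close>

definition uea_lift :: "('g::lie_algebra \<Rightarrow> 'a::complex_algebra_1) \<Rightarrow> 'g uea \<Rightarrow> 'a"
  where "uea_lift f u = free_lift f (rep_uea u)"

lemma uea_lift_abs: "lie_hom_into f \<Longrightarrow> uea_lift f (abs_uea p) = free_lift f p"
  unfolding uea_lift_def
  by (rule free_lift_uea_rel) (auto intro: Quotient_rep_abs[OF Quotient_uea] uea_rel_refl_eq)

lemma uea_lift_gen: "lie_hom_into f \<Longrightarrow> uea_lift f (\<iota> a) = f a"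
  by (simp add: uea_gen.abs_eq uea_lift_abs)

lemma uea_lift_one: "lie_hom_into f \<Longrightarrow> uea_lift f 1 = 1"
  by (simp add: one_uea.abs_eq uea_lift_abs)

lemma uea_lift_mult: "lie_hom_into f \<Longrightarrow> uea_lift f (u * v) = uea_lift f u * uea_lift f v"
  by (induction u rule: uea.abs_induct, induction v rule: uea.abs_induct)
     (simp add: uea_lift_abs times_uea.abs_eq)

lemma clinear_uea_lift: "lie_hom_into f \<Longrightarrow> clinear (uea_lift f)"
proof (rule clinearI)
  fix u v :: "'a uea" and c
  assume f: "lie_hom_into f"
  show "uea_lift f (u + v) = uea_lift f u + uea_lift f v"
    by (induction u rule: uea.abs_induct, induction v rule: uea.abs_induct)
       (simp add: uea_lift_abs f plus_uea.abs_eq clinear_add[OF clinear_free_lift])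
  show "uea_lift f (c *\<^sub>C u) = c *\<^sub>C uea_lift f u"
    by (induction u rule: uea.abs_induct)
       (simp add: uea_lift_abs f scaleC_uea.abs_eq clinear_scale[OF clinear_free_lift])
qed

definition uea_map :: "('g::lie_algebra \<Rightarrow> 'h::lie_algebra) \<Rightarrow> 'g uea \<Rightarrow> 'h uea"
  where "uea_map \<phi> = uea_lift (\<lambda>a. \<iota> (\<phi> a))"

definition coproduct :: "'g::lie_algebra uea \<Rightarrow> 'g uea \<otimes> 'g uea" (\<open>\<Delta>\<close>)
  where "coproduct = uea_lift (\<lambda>a. \<iota> a \<otimes> 1 + 1 \<otimes> \<iota> a)"

definition counit :: "'g::lie_algebra uea \<Rightarrow> complex"
  where "counit = uea_lift (\<lambda>_. 0)"

lemma tens_diff_left: "(a - a') \<otimes> b = a \<otimes> b - a' \<otimes> b"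
  by (rule clinear_diff[of "\<lambda>a. a \<otimes> b"])
     (intro clinearI tens_add_left tens_scaleC_left)

lemma tens_diff_right: "a \<otimes> (b - b') = a \<otimes> b - a \<otimes> b'"
  by (rule clinear_diff) (intro clinearI tens_add_right tens_scaleC_right)

lemma lie_hom_into_coproduct: "lie_hom_into (\<lambda>a. \<iota> a \<otimes> 1 + 1 \<otimes> \<iota> a)"
proof -
  have lin: "clinear \<iota>" and br: "\<And>a b. \<iota> (bracket a b) = \<iota> a * \<iota> b - \<iota> b * \<iota> a"
    using lie_hom_into_uea_gen by (auto simp: lie_hom_into_def)
  have "clinear (\<lambda>a. \<iota> a \<otimes> (1 :: 'a uea) + (1 :: 'a uea) \<otimes> \<iota> a)"
    by (rule clinearI)
       (simp_all add: clinear_add[OF lin] clinear_scale[OF lin] tens_add_left tens_add_right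
        tens_scaleC_left tens_scaleC_right scaleC_add_right)
  then show ?thesis
    by (simp add: lie_hom_into_def br tens_diff_left tens_diff_right distrib_left distrib_right
        times_tens_tens)
qed

lemma lie_hom_into_counit: "lie_hom_into (\<lambda>_. 0 :: complex)"
  by (auto simp: lie_hom_into_def intro!: clinearI)

lemma lie_hom_into_uea_map:
  fixes \<phi> :: "'g::lie_algebra \<Rightarrow> 'h::lie_algebra"
  assumes "clinear \<phi>" "\<And>a b. \<phi> (bracket a b) = bracket (\<phi> a) (\<phi> b)"
  shows "lie_hom_into (\<lambda>a. \<iota> (\<phi> a))"
proof -
  have lin: "clinear (\<iota> :: 'h \<Rightarrow> 'h uea)"
    and br: "\<And>a b :: 'h. \<iota> (bracket a b) = \<iota> a * \<iota> b - \<iota> b * \<iota> a"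
    using lie_hom_into_uea_gen[where 'a = 'h] by (auto simp: lie_hom_into_def)
  have "clinear (\<lambda>a. \<iota> (\<phi> a))"
    by (rule clinear_compose[OF assms(1) lin])
  then show ?thesis
    by (simp add: lie_hom_into_def assms(2) br)
qed


subsection \<open>The algebra of infinitesimal braids\<close>

text \<open>\<open>'n kohno\<close> is the universal enveloping algebra of the Drinfeld--Kohno Lie algebra on strands
  indexed by \<open>'n\<close>.  Below the index types are \<open>3\<close> and \<open>4\<close>, where the numerals \<open>1, 2, 3\<close> respectively
  \<open>1, 2, 3, 4\<close> denote the distinct elements (the last one being equal to \<open>0\<close>).\<close>

definition kohno_relators :: "('n \<times> 'n) free_algebra set"
  where "kohno_relators =
    (let t = (\<lambda>i j. free_gen (i, j)); comm = (\<lambda>a b. a * b - b * a) in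
      {t i i |i. True} \<union>
      {t i j - t j i |i j. True} \<union>
      {comm (t i j) (t k l) |i j k l. distinct [i, j, k, l]} \<union>
      {comm (t i j) (t i k + t j k) |i j k. distinct [i, j, k]})"

definition kohno_rel :: "('n \<times> 'n) free_algebra \<Rightarrow> ('n \<times> 'n) free_algebra \<Rightarrow> bool"
  where "kohno_rel p q \<longleftrightarrow> p - q \<in> generated_ideal kohno_relators"

quotient_type 'n kohno = "('n \<times> 'n) free_algebra" / kohno_rel
  using equivp_span_diff by (simp add: kohno_rel_def[abs_def] generated_ideal_def)

lemma kohno_rel_refl_eq: "p = q \<Longrightarrow> kohno_rel p q"
  by (simp add: kohno_rel_def generated_ideal_def complex_vector.span_zero)

instantiation kohno :: (type) complex_algebra_1
begin

lift_definition zero_kohno :: "'a kohno" is 0 .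
lift_definition one_kohno :: "'a kohno" is 1 .

lift_definition plus_kohno :: "'a kohno \<Rightarrow> 'a kohno \<Rightarrow> 'a kohno" is "(+)"
  unfolding kohno_rel_def generated_ideal_def by (rule span_diff_plus)

lift_definition uminus_kohno :: "'a kohno \<Rightarrow> 'a kohno" is uminus
  unfolding kohno_rel_def generated_ideal_def by (rule span_diff_uminus)

definition minus_kohno :: "'a kohno \<Rightarrow> 'a kohno \<Rightarrow> 'a kohno"
  where "minus_kohno x y = x + (- y)"

lift_definition scaleC_kohno :: "complex \<Rightarrow> 'a kohno \<Rightarrow> 'a kohno" is scaleC
  unfolding kohno_rel_def generated_ideal_def by (rule span_diff_scaleC)

lift_definition times_kohno :: "'a kohno \<Rightarrow> 'a kohno \<Rightarrow> 'a kohno" is "(*)"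
  unfolding kohno_rel_def by (rule generated_ideal_diff_mult)

instance
proof
  show "(0 :: 'a kohno) \<noteq> 1"
  proof (transfer, rule notI)
    let ?e = "free_lift (\<lambda>_. 0 :: complex) :: ('a \<times> 'a) free_algebra \<Rightarrow> complex"
    assume "kohno_rel 0 (1 :: ('a \<times> 'a) free_algebra)"
    moreover have "?e r = 0" if "r \<in> kohno_relators" for r
      using that by (auto simp: kohno_relators_def Let_def clinear_diff[OF clinear_free_lift])
    ultimately have "?e (0 - 1) = 0"
      by - (rule free_lift_generated_ideal[of kohno_relators], simp_all only: kohno_rel_def)
    then show False
      by (simp only: clinear_diff[OF clinear_free_lift] clinear_0[OF clinear_free_lift]) simp
  qed
qed ((unfold minus_kohno_def)?, transfer, rule kohno_rel_refl_eq,
      simp add: scaleC_add_left scaleC_add_right add_ac mult.assoc distrib_left distrib_right)+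

end

lift_definition kohno_gen :: "'n \<Rightarrow> 'n \<Rightarrow> 'n kohno" is "\<lambda>i j. free_gen (i, j)" .


section \<open>Drinfeld associators\<close>

datatype letter = X_letter | Y_letter

type_synonym nc_series = "letter list \<Rightarrow> complex"

text \<open>The series \<open>\<Phi>(\<hbar>a, \<hbar>b)\<close> over an arbitrary algebra.\<close>

definition nc_eval :: "nc_series \<Rightarrow> 'a::complex_algebra_1 \<Rightarrow> 'a \<Rightarrow> 'a fps"
  where "nc_eval \<Phi> a b = Abs_fps (\<lambda>n. \<Sum>w | length w = n.
    \<Phi> w *\<^sub>C prod_list (map (\<lambda>l. case l of X_letter \<Rightarrow> a | Y_letter \<Rightarrow> b) w))"

text \<open>The series \<open>exp(\<hbar>a)\<close>.\<close>

definition hexp :: "'a::complex_algebra_1 \<Rightarrow> 'a fps"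
  where "hexp a = Abs_fps (\<lambda>n. (1 / fact n) *\<^sub>C a ^ n)"

definition two_sided_inverse :: "'a::ring_1 \<Rightarrow> 'a"
  where "two_sided_inverse p = (THE q. p * q = 1 \<and> q * p = 1)"

text \<open>Homogeneous components of degree \<open>n\<close> are weighted by \<open>\<hbar> ^ n\<close>, so each identity below says that the
  corresponding identity without \<open>\<hbar>\<close> holds in the degree completion of the graded algebra in question:
  the tensor square of the free algebra for \<open>group_like\<close> (expressing that the coproduct with
  primitive \<open>x\<close> and \<open>y\<close> maps \<open>\<Phi>\<close> to \<open>\<Phi> \<otimes> \<Phi>\<close>), and the algebras of infinitesimal braids on four and
  three strands for the pentagon and the hexagons.\<close>

definition group_like :: "nc_series \<Rightarrow> bool"
  where "group_like \<Phi> \<longleftrightarrow> \<Phi> [] = 1 \<and>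
    (let x = free_gen X_letter; y = free_gen Y_letter in
      nc_eval \<Phi> (x \<otimes> 1 + 1 \<otimes> x) (y \<otimes> 1 + 1 \<otimes> y) =
        nc_eval \<Phi> (x \<otimes> 1) (y \<otimes> 1) * nc_eval \<Phi> (1 \<otimes> x) (1 \<otimes> y))"

definition pentagon :: "nc_series \<Rightarrow> bool"
  where "pentagon \<Phi> \<longleftrightarrow> (let t = kohno_gen :: 4 \<Rightarrow> 4 \<Rightarrow> 4 kohno in
    nc_eval \<Phi> (t 1 2) (t 2 3 + t 2 4) * nc_eval \<Phi> (t 1 3 + t 2 3) (t 3 4) =
    nc_eval \<Phi> (t 2 3) (t 3 4) * nc_eval \<Phi> (t 1 2 + t 1 3) (t 2 4 + t 3 4) * nc_eval \<Phi> (t 1 2) (t 2 3))"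

text \<open>The two hexagons are the braided-category axioms for the associativity constraint
  \<open>(X \<otimes> Y) \<otimes> Z \<rightarrow> X \<otimes> (Y \<otimes> Z)\<close> given by \<open>\<Phi>(\<hbar>t\<^sub>1\<^sub>2, \<hbar>t\<^sub>2\<^sub>3)\<close> and the braiding \<open>exp(\<hbar>t\<^sub>1\<^sub>2/2)\<close>.\<close>

definition hexagons :: "nc_series \<Rightarrow> bool"
  where "hexagons \<Phi> \<longleftrightarrow> (let t = kohno_gen :: 3 \<Rightarrow> 3 \<Rightarrow> 3 kohno; R = (\<lambda>a. hexp ((1/2) *\<^sub>C a)) in
    R (t 1 3 + t 2 3) =
      nc_eval \<Phi> (t 3 1) (t 1 2) * R (t 1 3) * two_sided_inverse (nc_eval \<Phi> (t 1 3) (t 3 2)) *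
        R (t 2 3) * nc_eval \<Phi> (t 1 2) (t 2 3) \<and>
    R (t 1 2 + t 1 3) =
      two_sided_inverse (nc_eval \<Phi> (t 2 3) (t 3 1)) * R (t 1 3) * nc_eval \<Phi> (t 2 1) (t 1 3) *
        R (t 1 2) * two_sided_inverse (nc_eval \<Phi> (t 1 2) (t 2 3)))"

definition drinfeld_associator :: "nc_series \<Rightarrow> bool"
  where "drinfeld_associator \<Phi> \<longleftrightarrow>
    group_like \<Phi> \<and> pentagon \<Phi> \<and> hexagons \<Phi> \<and>
    \<Phi> [X_letter] = 0 \<and> \<Phi> [Y_letter] = 0 \<and>
    \<Phi> [X_letter, X_letter] = 0 \<and> \<Phi> [Y_letter, Y_letter] = 0 \<and>
    \<Phi> [X_letter, Y_letter] = 1 / 24 \<and> \<Phi> [Y_letter, X_letter] = - 1 / 24"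


section \<open>Modules over the enveloping algebra\<close>

text \<open>A module is given by its action map; the underlying space is the whole type \<open>'x\<close>.\<close>

type_synonym ('g, 'x) action = "'g uea \<Rightarrow> 'x \<Rightarrow> 'x"

definition uea_module :: "('g::lie_algebra, 'x::complex_vector) action \<Rightarrow> bool"
  where "uea_module \<rho> \<longleftrightarrow> cbilinear \<rho> \<and> \<rho> 1 = id \<and> (\<forall>u v. \<rho> (u * v) = \<rho> u \<circ> \<rho> v)"

definition uea_module_hom ::
    "('g::lie_algebra, 'x::complex_vector) action \<Rightarrow> ('g, 'y::complex_vector) action \<Rightarrow> ('x \<Rightarrow> 'y) \<Rightarrow> bool"
  where "uea_module_hom \<rho> \<sigma> f \<longleftrightarrow> clinear f \<and> (\<forall>u x. f (\<rho> u x) = \<sigma> u (f x))"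

definition tensor_action ::
    "('u::complex_algebra_1 \<Rightarrow> 'x::complex_vector \<Rightarrow> 'x) \<Rightarrow>
     ('v::complex_algebra_1 \<Rightarrow> 'y::complex_vector \<Rightarrow> 'y) \<Rightarrow> 'u \<otimes> 'v \<Rightarrow> 'x \<otimes> 'y \<Rightarrow> 'x \<otimes> 'y"
  where "tensor_action \<rho> \<sigma> z w = tensor_lift (\<lambda>u v. tensor_map (\<rho> u) (\<sigma> v) w) z"

definition tensor_module ::
    "('g::lie_algebra, 'x::complex_vector) action \<Rightarrow> ('g, 'y::complex_vector) action \<Rightarrow>
      ('g, 'x \<otimes> 'y) action"
  where "tensor_module \<rho> \<sigma> u = tensor_action \<rho> \<sigma> (\<Delta> u)"

definition unit_module :: "('g::lie_algebra, complex) action"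
  where "unit_module u z = counit u * z"


section \<open>The Drinfeld category\<close>

text \<open>An object is a type together with an action on it, so statements about all objects are polymorphic
  in the underlying types.  A morphism is a power series whose coefficient at \<open>n\<close> is the coefficient of
  \<open>\<hbar> ^ n\<close>.\<close>

definition drinfeld_hom ::
    "('g::lie_algebra, 'x::complex_vector) action \<Rightarrow> ('g, 'y::complex_vector) action \<Rightarrow>
      ('x \<Rightarrow> 'y) fps \<Rightarrow> bool"
  where "drinfeld_hom \<rho> \<sigma> f \<longleftrightarrow> (\<forall>n. uea_module_hom \<rho> \<sigma> (fps_nth f n))"

definition hconst :: "('x \<Rightarrow> 'y::complex_vector) \<Rightarrow> ('x \<Rightarrow> 'y) fps"
  where "hconst f = Abs_fps (\<lambda>n x. if n = 0 then f x else 0)"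

abbreviation hid :: "('x::complex_vector \<Rightarrow> 'x) fps"
  where "hid \<equiv> hconst (\<lambda>x. x)"

definition hcomp :: "('y \<Rightarrow> 'z::complex_vector) fps \<Rightarrow> ('x \<Rightarrow> 'y) fps \<Rightarrow> ('x \<Rightarrow> 'z) fps"
    (infixr \<open>\<circ>\<^sub>h\<close> 55)
  where "g \<circ>\<^sub>h f = Abs_fps (\<lambda>n x. \<Sum>i\<le>n. fps_nth g i (fps_nth f (n - i) x))"

definition htensor ::
    "('x::complex_vector \<Rightarrow> 'x'::complex_vector) fps \<Rightarrow> ('y::complex_vector \<Rightarrow> 'y'::complex_vector) fps \<Rightarrow>
      ('x \<otimes> 'y \<Rightarrow> 'x' \<otimes> 'y') fps"
  where "htensor f g = Abs_fps (\<lambda>n w. \<Sum>i\<le>n. tensor_map (fps_nth f i) (fps_nth g (n - i)) w)"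

definition fps_image :: "('a \<Rightarrow> 'b) \<Rightarrow> 'a fps \<Rightarrow> 'b fps"
  where "fps_image f p = Abs_fps (\<lambda>n. f (fps_nth p n))"

text \<open>\<open>insert_pair p q t\<close> is \<open>t\<close> with its two factors put into the places described by the embeddings
  \<open>p\<close> and \<open>q\<close>, e.g. \<open>t\<^sup>1\<^sup>2\<close>; \<open>insert_triple\<close> does the same for three factors.\<close>

definition insert_pair ::
    "('g::lie_algebra uea \<Rightarrow> 'a::complex_algebra_1) \<Rightarrow> ('g uea \<Rightarrow> 'a) \<Rightarrow> 'g \<otimes> 'g \<Rightarrow> 'a"
  where "insert_pair p q = tensor_lift (\<lambda>a b. p (\<iota> a) * q (\<iota> b))"

definition insert_triple ::
    "('u::complex_algebra_1 \<Rightarrow> 'a::complex_algebra_1) \<Rightarrow> ('u \<Rightarrow> 'a) \<Rightarrow> ('u \<Rightarrow> 'a) \<Rightarrow> 'u \<otimes> 'u \<otimes> 'u \<Rightarrow> 'a"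
  where "insert_triple p q r = tensor_lift (\<lambda>u. tensor_lift (\<lambda>v w. p u * q v * r w))"

definition associator_element :: "nc_series \<Rightarrow> 'g::lie_algebra \<otimes> 'g \<Rightarrow> ('g uea \<otimes> 'g uea \<otimes> 'g uea) fps"
  where "associator_element \<Phi> t =
    (let s1 = (\<lambda>u. u \<otimes> 1 \<otimes> 1); s2 = (\<lambda>u. 1 \<otimes> u \<otimes> 1); s3 = (\<lambda>u. 1 \<otimes> 1 \<otimes> u) in
      nc_eval \<Phi> (insert_pair s1 s2 t) (insert_pair s2 s3 t))"

definition associativity ::
    "nc_series \<Rightarrow> 'g::lie_algebra \<otimes> 'g \<Rightarrow> ('g, 'x::complex_vector) action \<Rightarrow>
      ('g, 'y::complex_vector) action \<Rightarrow> ('g, 'z::complex_vector) action \<Rightarrow>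
      (('x \<otimes> 'y) \<otimes> 'z \<Rightarrow> 'x \<otimes> ('y \<otimes> 'z)) fps"
  where "associativity \<Phi> t \<rho> \<sigma> \<tau> =
    fps_image (tensor_action \<rho> (tensor_action \<sigma> \<tau>)) (associator_element \<Phi> t) \<circ>\<^sub>h hconst tensor_assoc"

definition left_unitor :: "(complex \<otimes> 'x::complex_vector \<Rightarrow> 'x) fps"
  where "left_unitor = hconst (tensor_lift (\<lambda>c x. c *\<^sub>C x))"

definition right_unitor :: "('x::complex_vector \<otimes> complex \<Rightarrow> 'x) fps"
  where "right_unitor = hconst (tensor_lift (\<lambda>x c. c *\<^sub>C x))"

text \<open>Elements of \<open>(S\<^sup>2 \<gg>)\<^sup>\<gg>\<close>, the symmetric square being the symmetric tensors in \<open>\<gg> \<otimes> \<gg>\<close>.\<close>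

definition invariant_symmetric :: "'g::lie_algebra \<otimes> 'g \<Rightarrow> bool"
  where "invariant_symmetric t \<longleftrightarrow> tensor_swap t = t \<and>
    (\<forall>x. tensor_map (bracket x) id t + tensor_map id (bracket x) t = 0)"

definition sum_tensor ::
    "'g::lie_algebra \<otimes> 'g \<Rightarrow> 'h::lie_algebra \<otimes> 'h \<Rightarrow> ('g \<times> 'h) \<otimes> ('g \<times> 'h)"
  where "sum_tensor t t' =
    tensor_map (\<lambda>a. (a, 0)) (\<lambda>a. (a, 0)) t + tensor_map (\<lambda>b. (0, b)) (\<lambda>b. (0, b)) t'"


section \<open>The functor and its coherence maps\<close>

definition diag_hom :: "'g::lie_algebra \<times> 'h::lie_algebra \<Rightarrow> 'g \<times> 'g \<times> 'h"
  where "diag_hom = (\<lambda>(u, v). (u, u, v))"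

definition F_obj ::
    "('g::lie_algebra \<times> 'g \<times> 'h::lie_algebra, 'x::complex_vector) action \<Rightarrow> ('g \<times> 'h, 'x) action"
  where "F_obj \<rho> u = \<rho> (uea_map diag_hom u)"

definition F_mor :: "('x \<Rightarrow> 'y) fps \<Rightarrow> ('x \<Rightarrow> 'y) fps"
  where "F_mor f = f"

definition J_element ::
    "nc_series \<Rightarrow> 'g::lie_algebra \<otimes> 'g \<Rightarrow> ('g uea \<otimes> 'g uea \<otimes> 'g uea \<otimes> 'g uea) fps"
  where "J_element \<Phi> t =
    (let s1 = (\<lambda>u. u \<otimes> 1 \<otimes> 1 \<otimes> 1); s2 = (\<lambda>u. 1 \<otimes> u \<otimes> 1 \<otimes> 1);
         s3 = (\<lambda>u. 1 \<otimes> 1 \<otimes> u \<otimes> 1); s4 = (\<lambda>u. 1 \<otimes> 1 \<otimes> 1 \<otimes> u);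
         s24 = (\<lambda>u. tensor_lift (\<lambda>v w. s2 v * s4 w) (\<Delta> u));
         s34 = (\<lambda>u. tensor_lift (\<lambda>v w. s3 v * s4 w) (\<Delta> u));
         \<Phi>at = (\<lambda>p q r. fps_image (insert_triple p q r) (associator_element \<Phi> t))
     in two_sided_inverse (\<Phi>at s1 s3 s24) * \<Phi>at s3 s2 s4 *
        hexp ((1/2) *\<^sub>C insert_pair s2 s3 t) *
        two_sided_inverse (\<Phi>at s2 s3 s4) * \<Phi>at s1 s2 s34)"

text \<open>The identification \<open>(U\<gg>)\<^sup>\<otimes>\<^sup>4 = (U(\<gg> \<oplus> \<gg>))\<^sup>\<otimes>\<^sup>2\<close>: slots 1, 2 (respectively 3, 4)
  are the two copies of \<open>\<gg>\<close> acting on the first (respectively second) factor.\<close>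

definition group_slots ::
    "'g::lie_algebra uea \<otimes> 'g uea \<otimes> 'g uea \<otimes> 'g uea \<Rightarrow> ('g \<times> 'g) uea \<otimes> ('g \<times> 'g) uea"
  where "group_slots =
    (let i = uea_map (\<lambda>a. (a, 0)); j = uea_map (\<lambda>a. (0, a)) in
      tensor_lift (\<lambda>u1. tensor_lift (\<lambda>u2. tensor_lift (\<lambda>u3 u4. (i u1 * j u2) \<otimes> (i u3 * j u4)))))"

definition J_mor ::
    "nc_series \<Rightarrow> 'g \<otimes> 'g \<Rightarrow> ('g::lie_algebra \<times> 'g \<times> 'h::lie_algebra, 'x::complex_vector) action \<Rightarrow>
      ('g \<times> 'g \<times> 'h, 'y::complex_vector) action \<Rightarrow> ('x \<otimes> 'y \<Rightarrow> 'x \<otimes> 'y) fps"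
  where "J_mor \<Phi> t \<rho> \<sigma> =
    (let res = uea_map (\<lambda>(a, b). (a, b, 0)) in
      fps_image (\<lambda>z. tensor_action (\<lambda>u. \<rho> (res u)) (\<lambda>u. \<sigma> (res u)) (group_slots z)) (J_element \<Phi> t))"

end

(*
  An associator in Kohno's algebra of infinitesimal braids can be evaluated on any family of pairwise
  commuting copies of the Lie algebra inside an associative algebra, and sums of copies over disjoint
  sets of strands again satisfy the defining relations.  This gives the pentagon and the hexagons for
  blocks of strands.  The compatibility of J with associativity then becomes the statement that two
  morphisms ((12)(34))(56) -> (1(35))(2(46)) agree: after reassociating source and target to
  right-nested words they are products of the crossings (2,3), (4,5) and (2,5), in orders that differ
  by exchanging the first two.  The part of the associator coming from the third Lie algebra splits off
  because the associator is group-like, and it commutes with everything else.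
*)
theory Submission
  imports Defs
begin

text \<open>Braidings are used without their flips: the permutation is recorded only in the labels
  of the strands, so all words live in one algebra and every identity is an equation between power
  series over it. Naturality of the constraints then takes the form of commutation. A series built
  from the strands in \<open>A\<close> commutes with \<open>E S\<close> whenever \<open>S\<close>
  contains \<open>A\<close> or misses it, hence with every associator or braiding whose blocks each
  contain or miss \<open>A\<close>; invariance of the chosen tensor is what settles the case A
  \<subseteq> S. On modules, coherence maps and associativity constraints are actions of algebra
  elements, apart from \<open>tensor_assoc\<close>, which intertwines the two bracketings; so the
  associativity statement becomes one equation in the third tensor power of the enveloping algebra.
  The unit axioms have a different source: erasing a tensor factor leaves empty blocks, so that
  associators receive an argument 0. That \<Phi>(0,b) = \<Phi>(a,0) = 1 follows from group-likeness,
  which gives f(2\<hbar>) = f(\<hbar>)^2 for the series in one letter, and from the vanishing of the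
  linear coefficients.\<close>

section \<open>Bilinear maps and linear maps out of tensor products\<close>

lemma clinear_sum: "clinear f \<Longrightarrow> f (sum g S) = (\<Sum>i\<in>S. f (g i))"
  by (rule complex_vector.linear_sum)

lemma cbilinearI:
  assumes "\<And>x y b. B (x + y) b = B x b + B y b" "\<And>c x b. B (c *\<^sub>C x) b = c *\<^sub>C B x b"
    and "\<And>a x y. B a (x + y) = B a x + B a y" "\<And>c a x. B a (c *\<^sub>C x) = c *\<^sub>C B a x"
  shows "cbilinear B"
  using assms by (auto simp: cbilinear_def intro!: clinearI)

lemma cbilinear_left: "cbilinear B \<Longrightarrow> clinear (\<lambda>a. B a b)"
  and cbilinear_right: "cbilinear B \<Longrightarrow> clinear (B a)"
  by (auto simp: cbilinear_def)

lemma cbilinear_add_left: "cbilinear B \<Longrightarrow> B (x + y) b = B x b + B y b"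
  and cbilinear_add_right: "cbilinear B \<Longrightarrow> B a (z + w) = B a z + B a w"
  and cbilinear_scale_left: "cbilinear B \<Longrightarrow> B (c *\<^sub>C x) b = c *\<^sub>C B x b"
  and cbilinear_scale_right: "cbilinear B \<Longrightarrow> B a (c *\<^sub>C z) = c *\<^sub>C B a z"
  by (auto simp: cbilinear_def clinear_add clinear_scale
      dest: clinear_add[of "\<lambda>a. B a b" x y] clinear_scale[of "\<lambda>a. B a b" c x])

lemma cbilinear_compose: "cbilinear B \<Longrightarrow> clinear f \<Longrightarrow> clinear g \<Longrightarrow> cbilinear (\<lambda>a b. B (f a) (g b))"
  by (intro cbilinearI)
    (simp_all add: clinear_add clinear_scale cbilinear_add_left cbilinear_add_right
      cbilinear_scale_left cbilinear_scale_right)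

lemma clinear_cbilinear: "cbilinear B \<Longrightarrow> clinear f \<Longrightarrow> cbilinear (\<lambda>a b. f (B a b))"
  by (intro cbilinearI)
    (simp_all add: clinear_add clinear_scale cbilinear_add_left cbilinear_add_right
      cbilinear_scale_left cbilinear_scale_right)

lemma cbilinear_mult: "cbilinear ((*) :: 'a::complex_algebra_1 \<Rightarrow> 'a \<Rightarrow> 'a)"
  by (intro cbilinearI) (simp_all add: algebra_simps)

lemma cbilinear_scaleC: "cbilinear ((*\<^sub>C) :: complex \<Rightarrow> 'a::complex_vector \<Rightarrow> 'a)"
  by (intro cbilinearI) (simp_all add: scaleC_add_left scaleC_add_right scaleC_complex_def mult.commute)

lemma tensor_lift_tensor_map:
  assumes "cbilinear B" "clinear f" "clinear g"
  shows "tensor_lift B (tensor_map f g z) = tensor_lift (\<lambda>a b. B (f a) (g b)) z"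
  by (induction z rule: tensor_induct)
    (simp_all add: assms tensor_map_tens tensor_lift_tens tensor_lift_add
      clinear_add[OF clinear_tensor_map] cbilinear_compose)

lemma clinear_tensor_lift_commute:
  assumes "clinear f" "cbilinear B"
  shows "f (tensor_lift B z) = tensor_lift (\<lambda>a b. f (B a b)) z"
  by (induction z rule: tensor_induct)
    (simp_all add: assms tensor_lift_tens tensor_lift_add clinear_add clinear_cbilinear)

lemma clinear_eq_tensorI:
  assumes "clinear f" "clinear g" "\<And>a b. f (a \<otimes> b) = g (a \<otimes> b)"
  shows "f z = g z"
  by (induction z rule: tensor_induct) (simp_all add: assms clinear_add)

subsection \<open>Homomorphisms of algebras\<close>

definition alg_hom :: "('a::complex_algebra_1 \<Rightarrow> 'b::complex_algebra_1) \<Rightarrow> bool"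
  where "alg_hom f \<longleftrightarrow> clinear f \<and> f 1 = 1 \<and> (\<forall>x y. f (x * y) = f x * f y)"

lemma alg_homI:
  "clinear f \<Longrightarrow> f 1 = 1 \<Longrightarrow> (\<And>x y. f (x * y) = f x * f y) \<Longrightarrow> alg_hom f"
  by (simp add: alg_hom_def)

lemma alg_hom_clinear: "alg_hom f \<Longrightarrow> clinear f"
  and alg_hom_one: "alg_hom f \<Longrightarrow> f 1 = 1"
  and alg_hom_mult: "alg_hom f \<Longrightarrow> f (x * y) = f x * f y"
  and alg_hom_add: "alg_hom f \<Longrightarrow> f (x + y) = f x + f y"
  and alg_hom_diff: "alg_hom f \<Longrightarrow> f (x - y) = f x - f y"
  and alg_hom_scale: "alg_hom f \<Longrightarrow> f (c *\<^sub>C x) = c *\<^sub>C f x"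
  and alg_hom_0: "alg_hom f \<Longrightarrow> f 0 = 0"
  and alg_hom_sum: "alg_hom f \<Longrightarrow> f (sum g S) = (\<Sum>i\<in>S. f (g i))"
  by (auto simp: alg_hom_def clinear_add clinear_diff clinear_scale clinear_0 clinear_sum)

lemmas alg_hom_simps = alg_hom_one alg_hom_mult alg_hom_add alg_hom_diff alg_hom_scale alg_hom_0

lemma alg_hom_compose: "alg_hom f \<Longrightarrow> alg_hom g \<Longrightarrow> alg_hom (\<lambda>x. g (f x))"
  by (simp add: alg_hom_def clinear_compose)

lemma alg_hom_id: "alg_hom (\<lambda>x. x)"
  by (auto simp: alg_hom_def intro: clinearI)

lemma alg_hom_power: "alg_hom f \<Longrightarrow> f (x ^ n) = f x ^ n"
  by (induction n) (simp_all add: alg_hom_one alg_hom_mult)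

lemma alg_hom_prod_list: "alg_hom f \<Longrightarrow> f (prod_list (map h w)) = prod_list (map (\<lambda>l. f (h l)) w)"
  by (induction w) (simp_all add: alg_hom_one alg_hom_mult)

text \<open>The universal property of the tensor product of algebras: homomorphisms with commuting
  images combine into one. Placements into several tensor slots are obtained from it by
  iteration.\<close>

lemma alg_hom_tensor_lift_mult:
  fixes f :: "'u::complex_algebra_1 \<Rightarrow> 'a::complex_algebra_1" and g :: "'v::complex_algebra_1 \<Rightarrow> 'a"
  assumes f: "alg_hom f" and g: "alg_hom g" and comm: "\<And>u v. f u * g v = g v * f u"
  shows "alg_hom (tensor_lift (\<lambda>u v. f u * g v))" (is "alg_hom ?h")
    and "tensor_lift (\<lambda>u v. f u * g v) (u \<otimes> v) = f u * g v"
proof -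
  have B: "cbilinear (\<lambda>u v. f u * g v)"
    by (rule cbilinear_compose[OF cbilinear_mult]) (use f g in \<open>simp_all add: alg_hom_clinear\<close>)
  have tens: "?h (u \<otimes> v) = f u * g v" for u v
    by (rule tensor_lift_tens[OF B])
  then show "?h (u \<otimes> v) = f u * g v" .
  have *: "(f a * g b) * (f a' * g b') = (f a * f a') * (g b * g b')" for a b a' b'
    by (metis comm mult.assoc)
  have "?h ((a \<otimes> b) * y) = ?h (a \<otimes> b) * ?h y" for a b y
    by (induction y rule: tensor_induct)
      (simp_all add: times_tens_tens tens alg_hom_mult[OF f] alg_hom_mult[OF g] *
        distrib_left tensor_lift_add[OF B])
  then have "?h (x * y) = ?h x * ?h y" for x y
    by (induction x rule: tensor_induct) (simp_all add: distrib_right tensor_lift_add[OF B])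
  then show "alg_hom ?h"
    by (intro alg_homI clinear_tensor_lift[OF B])
      (simp_all add: one_tensor_def tens alg_hom_one[OF f] alg_hom_one[OF g])
qed

lemma alg_hom_tens_left: "alg_hom (\<lambda>u. u \<otimes> 1)"
  by (intro alg_homI clinearI)
    (simp_all add: tens_add_left tens_scaleC_left one_tensor_def times_tens_tens)

lemma alg_hom_tens_right: "alg_hom (\<lambda>v. 1 \<otimes> v)"
  by (intro alg_homI clinearI)
    (simp_all add: tens_add_right tens_scaleC_right one_tensor_def times_tens_tens)

text \<open>Puts \<open>tensor_map\<close> into the shape to which the universal property of the
  tensor product of algebras applies.\<close>

lemma tensor_map_conv_mult:
  fixes f :: "'u::complex_algebra_1 \<Rightarrow> 'a::complex_algebra_1" and g :: "'v::complex_algebra_1 \<Rightarrow> 'b::complex_algebra_1"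
  shows "tensor_map f g = tensor_lift (\<lambda>u v. (f u \<otimes> 1) * (1 \<otimes> g v))"
  by (simp add: tensor_map_def times_tens_tens)

lemma alg_hom_tensor_map:
  assumes "alg_hom f" "alg_hom g"
  shows "alg_hom (tensor_map f g)"
  unfolding tensor_map_conv_mult
  by (rule alg_hom_tensor_lift_mult)
    (auto simp: times_tens_tens intro: alg_hom_compose assms alg_hom_tens_left alg_hom_tens_right)

lemma cbilinear_assoc_inner: "cbilinear (\<lambda>a b. a \<otimes> b \<otimes> c)"
  by (intro cbilinearI) (simp_all add: tens_add_left tens_add_right tens_scaleC_left tens_scaleC_right)

lemma cbilinear_assoc_outer: "cbilinear (\<lambda>w c. tensor_lift (\<lambda>a b. a \<otimes> b \<otimes> c) w)"
  by (intro cbilinearI)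
    (simp_all add: tensor_lift_add[OF cbilinear_assoc_inner] tensor_lift_scaleC[OF cbilinear_assoc_inner]
      tens_add_right tens_scaleC_right tensor_lift_plus_fun tensor_lift_scaleC_fun)

lemma clinear_tensor_assoc: "clinear tensor_assoc"
  unfolding tensor_assoc_def by (rule clinear_tensor_lift[OF cbilinear_assoc_outer])

lemma tensor_assoc_tens: "tensor_assoc ((a \<otimes> b) \<otimes> c) = a \<otimes> b \<otimes> c"
  unfolding tensor_assoc_def
  by (simp add: tensor_lift_tens[OF cbilinear_assoc_outer] tensor_lift_tens[OF cbilinear_assoc_inner])

lemma tensor_assoc_mult: "tensor_assoc (x * y) = tensor_assoc x * tensor_assoc y"
proof -
  note lin = clinear_add[OF clinear_tensor_assoc]
  \<comment> \<open>\<open>tensor_induct\<close> splits only the outermost tensor product, so the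
    reduction to pure tensors proceeds one level at a time, first in the right factor and then in
    the left one.\<close>
  have 1: "tensor_assoc (((a \<otimes> b) \<otimes> c) * ((a' \<otimes> b') \<otimes> c')) = tensor_assoc ((a \<otimes> b) \<otimes> c) * tensor_assoc ((a' \<otimes> b') \<otimes> c')"
    for a a' :: 'a and b b' :: 'b and c c' :: 'c
    by (simp add: tensor_assoc_tens times_tens_tens)
  have 2: "tensor_assoc (((a \<otimes> b) \<otimes> c) * (w \<otimes> c')) = tensor_assoc ((a \<otimes> b) \<otimes> c) * tensor_assoc (w \<otimes> c')"
    for a :: 'a and b :: 'b and c c' :: 'c and w
    by (induction w rule: tensor_induct) (simp_all add: 1 lin tens_add_left distrib_left)
  have 3: "tensor_assoc (((a \<otimes> b) \<otimes> c) * y) = tensor_assoc ((a \<otimes> b) \<otimes> c) * tensor_assoc y"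
    for a :: 'a and b :: 'b and c :: 'c
    by (induction y rule: tensor_induct) (simp_all add: 2 lin distrib_left)
  have 4: "tensor_assoc ((w \<otimes> c) * y) = tensor_assoc (w \<otimes> c) * tensor_assoc y" for w :: "'a \<otimes> 'b" and c :: 'c
    by (induction w rule: tensor_induct) (simp_all add: 3 lin tens_add_left distrib_right)
  show ?thesis
    by (induction x rule: tensor_induct) (simp_all add: 4 lin distrib_right)
qed

lemma alg_hom_tensor_assoc: "alg_hom tensor_assoc"
  by (intro alg_homI clinear_tensor_assoc tensor_assoc_mult)
    (simp add: one_tensor_def tensor_assoc_tens)

section \<open>Generation of free and enveloping algebras\<close>

lemma free_algebra_induct [case_names gen one add mult scale]:
  assumes "\<And>a. Q (free_gen a)" "Q 1" "\<And>p q. Q p \<Longrightarrow> Q q \<Longrightarrow> Q (p + q)"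
    "\<And>p q. Q p \<Longrightarrow> Q q \<Longrightarrow> Q (p * q)" "\<And>c p. Q p \<Longrightarrow> Q (c *\<^sub>C p)"
  shows "Q (p :: 'a free_algebra)"
proof (induction p rule: poly_mapping_induct)
  case (single w c)
  have w: "Q (Poly_Mapping.single w 1)"
  proof (induction w)
    case Nil
    have "Poly_Mapping.single ([] :: 'a list) (1 :: complex) = 1"
      by (metis zero_list_def single_one)
    then show ?case using assms(2) by simp
  next
    case (Cons a w)
    have "Poly_Mapping.single (a # w) (1 :: complex) = free_gen a * Poly_Mapping.single w 1"
      by (simp add: free_gen_def mult_single plus_list_def)
    then show ?case using assms(1,4) Cons by simp
  qed
  have "Poly_Mapping.single w c = c *\<^sub>C Poly_Mapping.single w 1"
    by (simp add: scaleC_complex_def)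
  then show ?case using assms(5)[OF w] by simp
next
  case (add p q)
  then show ?case by (rule assms(3))
qed

lemma uea_induct [case_names gen one add mult scale]:
  assumes "\<And>a. Q (\<iota> a)" "Q 1" "\<And>u v. Q u \<Longrightarrow> Q v \<Longrightarrow> Q (u + v)"
    "\<And>u v. Q u \<Longrightarrow> Q v \<Longrightarrow> Q (u * v)" "\<And>c u. Q u \<Longrightarrow> Q (c *\<^sub>C u)"
  shows "Q u"
proof -
  have "Q (abs_uea p)" for p
    by (induction p rule: free_algebra_induct)
      (auto intro: assms simp flip: uea_gen.abs_eq one_uea.abs_eq plus_uea.abs_eq times_uea.abs_eq
        scaleC_uea.abs_eq)
  then show ?thesis by (induction u rule: uea.abs_induct)
qed

lemma alg_hom_eq_ueaI:
  assumes "alg_hom f" "alg_hom g" "\<And>a. f (\<iota> a) = g (\<iota> a)"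
  shows "f u = g u"
  by (induction u rule: uea_induct) (simp_all add: assms alg_hom_simps[OF assms(1)] alg_hom_simps[OF assms(2)])

lemma alg_hom_uea_lift: "lie_hom_into f \<Longrightarrow> alg_hom (uea_lift f)"
  by (simp add: alg_hom_def clinear_uea_lift uea_lift_one uea_lift_mult)

lemma alg_hom_free_lift: "alg_hom (free_lift f)"
  by (simp add: alg_hom_def clinear_free_lift)

lemma clinear_iota: "clinear \<iota>"
  and iota_bracket: "\<iota> (bracket a b) = \<iota> a * \<iota> b - \<iota> b * \<iota> a"
  using lie_hom_into_uea_gen by (auto simp: lie_hom_into_def)

lemmas iota_add = clinear_add[OF clinear_iota]
  and iota_scaleC = clinear_scale[OF clinear_iota]
  and iota_0 = clinear_0[OF clinear_iota]

definition lie_hom :: "('g::lie_algebra \<Rightarrow> 'h::lie_algebra) \<Rightarrow> bool"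
  where "lie_hom \<phi> \<longleftrightarrow> clinear \<phi> \<and> (\<forall>a b. \<phi> (bracket a b) = bracket (\<phi> a) (\<phi> b))"

lemma alg_hom_uea_map: "lie_hom \<phi> \<Longrightarrow> alg_hom (uea_map \<phi>)"
  and uea_map_iota: "lie_hom \<phi> \<Longrightarrow> uea_map \<phi> (\<iota> a) = \<iota> (\<phi> a)"
  unfolding uea_map_def lie_hom_def
  by (simp_all add: alg_hom_uea_lift uea_lift_gen lie_hom_into_uea_map)

lemma alg_hom_coproduct: "alg_hom \<Delta>"
  and coproduct_iota: "\<Delta> (\<iota> a) = \<iota> a \<otimes> 1 + 1 \<otimes> \<iota> a"
  unfolding coproduct_def
  by (simp_all add: alg_hom_uea_lift uea_lift_gen lie_hom_into_coproduct)

lemma alg_hom_counit: "alg_hom counit"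
  and counit_iota: "counit (\<iota> a) = 0"
  unfolding counit_def by (simp_all add: alg_hom_uea_lift uea_lift_gen lie_hom_into_counit)

subsection \<open>Power series over an algebra\<close>

lemma fps_image_nth [simp]: "fps_nth (fps_image f p) n = f (fps_nth p n)"
  by (simp add: fps_image_def)

lemma fps_image_fps_image: "fps_image g (fps_image f p) = fps_image (\<lambda>x. g (f x)) p"
  by (simp add: fps_image_def)

lemma fps_image_mult: "alg_hom f \<Longrightarrow> fps_image f (p * q) = fps_image f p * fps_image f q"
  by (rule fps_ext) (simp add: fps_mult_nth alg_hom_sum alg_hom_mult)

lemma fps_image_one: "alg_hom f \<Longrightarrow> fps_image f 1 = 1"
  by (rule fps_ext) (simp add: alg_hom_one alg_hom_0)

lemma fps_image_nc_eval: "alg_hom f \<Longrightarrow> fps_image f (nc_eval \<Phi> a b) = nc_eval \<Phi> (f a) (f b)"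
  by (rule fps_ext)
    (auto simp: nc_eval_def alg_hom_sum alg_hom_scale alg_hom_prod_list split: letter.split
      intro!: sum.cong arg_cong[of _ _ "\<lambda>x. _ *\<^sub>C prod_list x"])

lemma fps_image_hexp: "alg_hom f \<Longrightarrow> fps_image f (hexp a) = hexp (f a)"
  by (rule fps_ext) (simp add: hexp_def alg_hom_scale alg_hom_power)

lemma nc_eval_nth_0: "fps_nth (nc_eval \<Phi> a b) 0 = \<Phi> [] *\<^sub>C 1"
  by (simp add: nc_eval_def)

lemma hexp_0: "hexp 0 = 1"
  by (rule fps_ext) (simp add: hexp_def power_0_left)

section \<open>Inverses and commutation of power series\<close>

lemma two_sided_inverse_eqI:
  assumes "p * q = 1" "q * p = (1 :: 'a::ring_1)"
  shows "two_sided_inverse p = q"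
  unfolding two_sided_inverse_def
proof (rule the_equality)
  fix q' assume q': "p * q' = 1 \<and> q' * p = 1"
  have "q' = q * p * q'" by (simp add: assms)
  also have "\<dots> = q" using q' by (simp add: mult.assoc)
  finally show "q' = q" .
qed (use assms in simp)

text \<open>Over a noncommutative ring the recursion on coefficients yields a left inverse l and a
  right inverse r separately; l = l (p r) = (l p) r = r identifies them.\<close>

lemma two_sided_inverse:
  fixes p :: "'a::ring_1 fps"
  assumes "fps_nth p 0 = 1"
  shows "p * two_sided_inverse p = 1" "two_sided_inverse p * p = 1"
proof -
  have r: "p * fps_right_inverse p 1 = 1" and l: "fps_left_inverse p 1 * p = 1"
    using assms by (auto intro: fps_right_inverse fps_left_inverse)
  have "fps_left_inverse p 1 = fps_left_inverse p 1 * (p * fps_right_inverse p 1)"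
    by (simp only: r mult_1_right)
  also have "\<dots> = fps_right_inverse p 1"
    by (simp only: l mult_1_left flip: mult.assoc)
  finally have lr: "fps_left_inverse p 1 = fps_right_inverse p 1" .
  with r l have "two_sided_inverse p = fps_right_inverse p 1"
    by (intro two_sided_inverse_eqI) (simp_all only: lr)
  with r l lr
  show "p * two_sided_inverse p = 1" "two_sided_inverse p * p = 1" by (simp_all only:)
qed

lemma fps_image_inverse:
  assumes f: "alg_hom f" and p: "fps_nth p 0 = 1"
  shows "fps_image f (two_sided_inverse p) = two_sided_inverse (fps_image f p)"
  by (rule two_sided_inverse_eqI[symmetric])
    (simp_all add: two_sided_inverse[OF p] fps_image_one[OF f] flip: fps_image_mult[OF f])

lemma inverse_commute:
  assumes "p * i = 1" "i * p = (1 :: 'a::ring_1)" "x * p = p * x"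
  shows "x * i = i * x"
proof -
  have "x * i = (i * p) * (x * i)" by (simp add: assms)
  also have "\<dots> = i * (x * p) * i" by (simp only: mult.assoc assms(3))
  also have "\<dots> = i * x * (p * i)" by (simp only: mult.assoc)
  finally show ?thesis by (simp add: assms)
qed

lemma commute_add: "x * a = a * x \<Longrightarrow> x * b = b * x \<Longrightarrow> x * (a + b) = (a + b) * (x :: 'a::ring_1)"
  by (simp add: algebra_simps)

lemma commute_mult: "x * a = a * x \<Longrightarrow> x * b = b * x \<Longrightarrow> x * (a * b) = (a * b) * (x :: 'a::ring_1)"
  by (metis mult.assoc)

lemma commute_scaleC: "x * a = a * x \<Longrightarrow> x * (c *\<^sub>C a) = (c *\<^sub>C a) * (x :: 'a::complex_algebra_1)"
  by simp

lemma commute_sum: "(\<And>i. i \<in> I \<Longrightarrow> x * f i = f i * x) \<Longrightarrow> x * sum f I = sum f I * (x :: 'a::ring_1)"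
  by (simp add: sum_distrib_left sum_distrib_right)

lemma commute_power: "x * a = a * x \<Longrightarrow> x * a ^ n = a ^ n * (x :: 'a::ring_1)"
  by (rule power_commuting_commutes[symmetric]) simp

lemma commute_nc_eval_nth:
  assumes "x * a = a * x" "x * b = b * (x :: 'a::complex_algebra_1)"
  shows "x * fps_nth (nc_eval \<Phi> a b) n = fps_nth (nc_eval \<Phi> a b) n * x"
proof -
  have "x * prod_list (map (\<lambda>l. case l of X_letter \<Rightarrow> a | Y_letter \<Rightarrow> b) w) =
    prod_list (map (\<lambda>l. case l of X_letter \<Rightarrow> a | Y_letter \<Rightarrow> b) w) * x" for w
    by (induction w) (auto split: letter.split intro!: commute_mult assms)
  then show ?thesis
    unfolding nc_eval_def by (auto intro!: commute_sum commute_scaleC)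
qed

text \<open>Stated for a constant against a series because \<open>nc_eval\<close> and
  \<open>hexp\<close> take their arguments in the algebra, while they are to be moved past whole
  series.\<close>

definition commutes_const :: "'a::complex_algebra_1 \<Rightarrow> 'a fps \<Rightarrow> bool"
  where "commutes_const y p \<longleftrightarrow> (\<forall>n. y * fps_nth p n = fps_nth p n * y)"

lemma commutes_const_iff: "commutes_const y p \<longleftrightarrow> fps_const y * p = p * fps_const y"
  by (simp add: commutes_const_def fps_eq_iff)

lemma commutes_const_nc_eval:
  "y * a = a * y \<Longrightarrow> y * b = b * y \<Longrightarrow> commutes_const y (nc_eval \<Phi> a b)"
  by (simp add: commutes_const_def commute_nc_eval_nth)

lemma commutes_const_hexp: "y * a = a * y \<Longrightarrow> commutes_const y (hexp a)"
  by (simp add: commutes_const_def hexp_def commute_power)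

lemma commutes_const_mult: "commutes_const y p \<Longrightarrow> commutes_const y q \<Longrightarrow> commutes_const y (p * q)"
  by (simp add: commutes_const_iff commute_mult)

lemma commutes_const_inverse:
  "fps_nth p 0 = 1 \<Longrightarrow> commutes_const y p \<Longrightarrow> commutes_const y (two_sided_inverse p)"
  unfolding commutes_const_iff by (rule inverse_commute[where p = p]) (simp_all add: two_sided_inverse)

lemma commute_fpsI:
  assumes "\<And>n. commutes_const (fps_nth p n) q"
  shows "p * q = q * p"
proof (rule fps_ext)
  fix n
  have "fps_nth (p * q) n = (\<Sum>i=0..n. fps_nth q (n - i) * fps_nth p i)"
    using assms by (simp add: fps_mult_nth commutes_const_def)
  also have "\<dots> = (\<Sum>i=0..n. fps_nth q i * fps_nth p (n - i))"
    by (subst sum.atLeastAtMost_rev) (auto intro!: sum.cong)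
  finally show "fps_nth (p * q) n = fps_nth (q * p) n" by (simp add: fps_mult_nth)
qed

lemma commute_nc_eval:
  assumes "commutes_const a p" "commutes_const b p"
  shows "p * nc_eval \<Phi> a b = nc_eval \<Phi> a b * p"
proof (rule commute_fpsI[symmetric])
  fix n
  have "fps_nth p m * fps_nth (nc_eval \<Phi> a b) n = fps_nth (nc_eval \<Phi> a b) n * fps_nth p m" for m
    using assms by (intro commute_nc_eval_nth) (metis commutes_const_def)+
  then show "commutes_const (fps_nth (nc_eval \<Phi> a b) n) p"
    unfolding commutes_const_def by metis
qed

lemma commute_hexp:
  assumes "commutes_const a p"
  shows "p * hexp a = hexp a * p"
proof (rule commute_fpsI[symmetric])
  fix n
  have "fps_nth p m * fps_nth (hexp a) n = fps_nth (hexp a) n * fps_nth p m" for m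
    unfolding hexp_def fps_nth_Abs_fps
    using assms by (intro commute_scaleC commute_power) (metis commutes_const_def)
  then show "commutes_const (fps_nth (hexp a) n) p"
    unfolding commutes_const_def by metis
qed

lemma commute_free_lift:
  assumes "\<And>k. y * f k = f k * y"
  shows "y * free_lift f p = free_lift f p * y"
  by (induction p rule: free_algebra_induct)
    (simp_all add: assms alg_hom_simps[OF alg_hom_free_lift] commute_add commute_mult)

subsection \<open>Group-likeness, pentagon and hexagons in arbitrary algebras\<close>

text \<open>Group-likeness is an identity in the tensor square of the free algebra. The commutation
  hypotheses make x \<otimes> 1, y \<otimes> 1 \<mapsto> a, b and 1 \<otimes> x, 1 \<otimes> y
  \<mapsto> a', b' a homomorphism, which carries it to the claim.\<close>

lemma nc_eval_split:
  fixes a b a' b' :: "'a::complex_algebra_1"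
  assumes gl: "group_like \<Phi>"
    and comm: "a * a' = a' * a" "a * b' = b' * a" "b * a' = a' * b" "b * b' = b' * b"
  shows "nc_eval \<Phi> (a + a') (b + b') = nc_eval \<Phi> a b * nc_eval \<Phi> a' b'"
proof -
  let ?f = "free_lift (\<lambda>l. case l of X_letter \<Rightarrow> a | Y_letter \<Rightarrow> b)"
  let ?g = "free_lift (\<lambda>l. case l of X_letter \<Rightarrow> a' | Y_letter \<Rightarrow> b')"
  let ?h = "tensor_lift (\<lambda>u v. ?f u * ?g v)"
  let ?x = "free_gen X_letter" and ?y = "free_gen Y_letter"
  have "?f u * (case l of X_letter \<Rightarrow> a' | Y_letter \<Rightarrow> b') = (case l of X_letter \<Rightarrow> a' | Y_letter \<Rightarrow> b') * ?f u"
    for u l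
    by (rule commute_free_lift[symmetric]) (auto simp: comm split: letter.split)
  then have "?f u * ?g v = ?g v * ?f u" for u v
    by (rule commute_free_lift)
  note h = alg_hom_tensor_lift_mult[OF alg_hom_free_lift alg_hom_free_lift this]
  have "fps_image ?h (nc_eval \<Phi> (?x \<otimes> 1 + 1 \<otimes> ?x) (?y \<otimes> 1 + 1 \<otimes> ?y)) =
    fps_image ?h (nc_eval \<Phi> (?x \<otimes> 1) (?y \<otimes> 1) * nc_eval \<Phi> (1 \<otimes> ?x) (1 \<otimes> ?y))"
    using gl by (simp add: group_like_def Let_def)
  then show ?thesis
    by (simp add: fps_image_nc_eval[OF h(1)] fps_image_mult[OF h(1)] alg_hom_add[OF h(1)] h(2))
qed

definition kohno_system :: "('n \<Rightarrow> 'n \<Rightarrow> 'a::complex_algebra_1) \<Rightarrow> bool"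
  where "kohno_system t \<longleftrightarrow>
    (\<forall>i. t i i = 0) \<and> (\<forall>i j. t i j = t j i) \<and>
    (\<forall>i j k l. distinct [i, j, k, l] \<longrightarrow> t i j * t k l = t k l * t i j) \<and>
    (\<forall>i j k. distinct [i, j, k] \<longrightarrow> t i j * (t i k + t j k) = (t i k + t j k) * t i j)"

text \<open>The universal property of the presentation. Through it the pentagon and the hexagons,
  postulated in the universal algebra, hold for every family that satisfies the relations.\<close>

lemma kohno_hom:
  fixes t :: "'n \<Rightarrow> 'n \<Rightarrow> 'a::complex_algebra_1"
  assumes "kohno_system t"
  obtains f where "alg_hom f" "\<And>i j. f (kohno_gen i j) = t i j"
proof -
  let ?F = "free_lift (\<lambda>(i, j). t i j)"
  define f where "f x = ?F (rep_kohno x)" for x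
  note F = alg_hom_free_lift[of "\<lambda>(i, j). t i j"]
  have "?F r = 0" if "r \<in> kohno_relators" for r
    using that assms unfolding kohno_relators_def kohno_system_def Let_def
    by (auto simp: alg_hom_simps[OF F])
  then have rel: "?F p = ?F q" if "kohno_rel p q" for p q
    using free_lift_generated_ideal[of kohno_relators "\<lambda>(i, j). t i j" "p - q"] that
    by (simp add: kohno_rel_def alg_hom_diff[OF F])
  have f: "f (abs_kohno p) = ?F p" for p
    unfolding f_def by (rule rel) (auto intro: Quotient_rep_abs[OF Quotient_kohno] kohno_rel_refl_eq)
  show thesis
  proof (rule that)
    show "f (kohno_gen i j) = t i j" for i j
      by (simp add: kohno_gen.abs_eq f)
    show "alg_hom f"
    proof (intro alg_homI clinearI)
      show "f 1 = 1" by (simp add: one_kohno.abs_eq f)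
      show "f (x * y) = f x * f y" "f (x + y) = f x + f y" for x y
        by (induction x rule: kohno.abs_induct, induction y rule: kohno.abs_induct,
          simp add: times_kohno.abs_eq plus_kohno.abs_eq f alg_hom_add[OF F])+
      show "f (c *\<^sub>C x) = c *\<^sub>C f x" for c x
        by (induction x rule: kohno.abs_induct) (simp add: scaleC_kohno.abs_eq f alg_hom_scale[OF F])
    qed
  qed
qed

lemma pentagon_eval:
  fixes t :: "4 \<Rightarrow> 4 \<Rightarrow> 'a::complex_algebra_1"
  assumes "pentagon \<Phi>" "kohno_system t"
  shows "nc_eval \<Phi> (t 1 2) (t 2 3 + t 2 4) * nc_eval \<Phi> (t 1 3 + t 2 3) (t 3 4) =
    nc_eval \<Phi> (t 2 3) (t 3 4) * nc_eval \<Phi> (t 1 2 + t 1 3) (t 2 4 + t 3 4) * nc_eval \<Phi> (t 1 2) (t 2 3)"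
proof -
  obtain f where f: "alg_hom f" "\<And>i j. f (kohno_gen i j) = t i j"
    using kohno_hom[OF assms(2)] by blast
  show ?thesis
    using arg_cong[OF assms(1)[unfolded pentagon_def Let_def], of "fps_image f"]
    by (simp add: fps_image_mult[OF f(1)] fps_image_nc_eval[OF f(1)] f(2) alg_hom_add[OF f(1)])
qed

lemma hexagons_eval:
  fixes t :: "3 \<Rightarrow> 3 \<Rightarrow> 'a::complex_algebra_1"
  assumes "hexagons \<Phi>" "\<Phi> [] = 1" "kohno_system t"
  shows "hexp ((1/2) *\<^sub>C (t 1 3 + t 2 3)) =
      nc_eval \<Phi> (t 3 1) (t 1 2) * hexp ((1/2) *\<^sub>C t 1 3) * two_sided_inverse (nc_eval \<Phi> (t 1 3) (t 3 2)) *
        hexp ((1/2) *\<^sub>C t 2 3) * nc_eval \<Phi> (t 1 2) (t 2 3)" (is ?thesis1)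
    and "hexp ((1/2) *\<^sub>C (t 1 2 + t 1 3)) =
      two_sided_inverse (nc_eval \<Phi> (t 2 3) (t 3 1)) * hexp ((1/2) *\<^sub>C t 1 3) * nc_eval \<Phi> (t 2 1) (t 1 3) *
        hexp ((1/2) *\<^sub>C t 1 2) * two_sided_inverse (nc_eval \<Phi> (t 1 2) (t 2 3))" (is ?thesis2)
proof -
  obtain f where f: "alg_hom f" "\<And>i j. f (kohno_gen i j) = t i j"
    using kohno_hom[OF assms(3)] by blast
  note hex = assms(1)[unfolded hexagons_def Let_def]
  note simps = fps_image_mult[OF f(1)] fps_image_nc_eval[OF f(1)] f(2) alg_hom_add[OF f(1)]
    fps_image_hexp[OF f(1)] fps_image_inverse[OF f(1)] nc_eval_nth_0 assms(2) alg_hom_scale[OF f(1)]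
  show ?thesis1
    using arg_cong[OF conjunct1[OF hex], of "fps_image f"] by (simp add: simps scaleC_add_right)
  show ?thesis2
    using arg_cong[OF conjunct2[OF hex], of "fps_image f"] by (simp add: simps scaleC_add_right)
qed

section \<open>Associators with one argument zero\<close>

text \<open>The hypothesis says \<open>f(2\<hbar>) = f(\<hbar>)\<^sup>2\<close>, whence inductively \<open>2\<^sup>n c\<^sub>n = 2 c\<^sub>n\<close>.\<close>

lemma square_root_series_trivial:
  fixes c :: "nat \<Rightarrow> complex"
  assumes "c 0 = 1" "c 1 = 0" and sq: "\<And>n. 2 ^ n * c n = (\<Sum>i\<le>n. c i * c (n - i))"
  shows "n > 0 \<Longrightarrow> c n = 0"
proof (induction n rule: less_induct)
  case (less n)
  show ?case
  proof (cases "n = 1")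
    case False
    then have n: "n \<ge> 2" using less.prems by simp
    \<comment> \<open>By the induction hypothesis only the two end terms survive.\<close>
    have "(\<Sum>i\<le>n. c i * c (n - i)) = (\<Sum>i\<in>{0, n}. c i * c (n - i))"
      using less by (intro sum.mono_neutral_right) auto
    also have "\<dots> = 2 * c n" using n assms(1) by simp
    finally have "(2 ^ n - 2) * c n = 0" using sq[of n] by (simp add: algebra_simps)
    \<comment> \<open>For n = 1 the factor 2^n - 2 vanishes and the equation says nothing, which is
      why \<open>c 1 = 0\<close> is assumed.\<close>
    moreover have "(2 :: complex) ^ n \<noteq> 2"
    proof
      assume "(2 :: complex) ^ n = 2"
      then have "(2 :: nat) ^ n = 2" by (metis of_nat_eq_iff of_nat_numeral of_nat_power)
      moreover have "(2 :: nat) ^ 2 \<le> 2 ^ n" using n by (intro power_increasing) auto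
      ultimately show False by simp
    qed
    ultimately show ?thesis by simp
  qed (use assms in simp)
qed

text \<open>A word containing any other letter has a factor 0, so only \<open>replicate n z\<close>
  contributes.\<close>

lemma power_word_coeff:
  fixes z :: letter
  shows "(\<Sum>w | length w = n. \<Phi> w *\<^sub>C prod_list (map (\<lambda>l. if l = z then a else 0) w)) =
    \<Phi> (replicate n z) *\<^sub>C (a :: 'a::complex_algebra_1) ^ n"
proof -
  have "finite (UNIV :: letter set)"
  proof -
    have "(UNIV :: letter set) = {X_letter, Y_letter}" by (auto intro: letter.exhaust)
    then show ?thesis by (metis finite.emptyI finite.insertI)
  qed
  then have fin: "finite {w :: letter list. length w = n}"
    using finite_lists_length_eq[of "UNIV :: letter set" n] by simp
  have zero: "prod_list (map (\<lambda>l. if l = z then a else 0) w) = 0" if "w \<noteq> replicate (length w) z" for w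
    using that by (induction w) auto
  have rep: "prod_list (map (\<lambda>l. if l = z then a else 0) (replicate n z)) = a ^ n"
    by (induction n) auto
  have "(\<Sum>w | length w = n. \<Phi> w *\<^sub>C prod_list (map (\<lambda>l. if l = z then a else 0) w)) =
    (\<Sum>w\<in>{replicate n z}. \<Phi> w *\<^sub>C prod_list (map (\<lambda>l. if l = z then a else 0) w))"
    using fin zero by (intro sum.mono_neutral_right) auto
  then show ?thesis by (simp add: rep)
qed

lemma nc_eval_zero_left_nth: "fps_nth (nc_eval \<Phi> 0 b) n = \<Phi> (replicate n Y_letter) *\<^sub>C b ^ n"
proof -
  have "(\<lambda>l. case l of X_letter \<Rightarrow> 0 | Y_letter \<Rightarrow> b) = (\<lambda>l. if l = Y_letter then b else 0)"
    by (auto split: letter.split)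
  then show ?thesis using power_word_coeff[of \<Phi> Y_letter b n] by (simp add: nc_eval_def)
qed

lemma nc_eval_zero_right_nth: "fps_nth (nc_eval \<Phi> a 0) n = \<Phi> (replicate n X_letter) *\<^sub>C a ^ n"
proof -
  have "(\<lambda>l. case l of X_letter \<Rightarrow> a | Y_letter \<Rightarrow> 0) = (\<lambda>l. if l = X_letter then a else 0)"
    by (auto split: letter.split)
  then show ?thesis using power_word_coeff[of \<Phi> X_letter a n] by (simp add: nc_eval_def)
qed

text \<open>With one argument 0 only the powers of a single letter remain, and their coefficients
  form a series to which \<open>square_root_series_trivial\<close> applies. The unit axioms rest on
  this.\<close>

lemma nc_eval_zero:
  assumes "drinfeld_associator \<Phi>"
  shows "nc_eval \<Phi> 0 b = 1" "nc_eval \<Phi> a 0 = 1"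
proof -
  have gl: "group_like \<Phi>" and nil: "\<Phi> [] = 1" and lin: "\<Phi> [X_letter] = 0" "\<Phi> [Y_letter] = 0"
    using assms by (auto simp: drinfeld_associator_def group_like_def)
  have two: "(1 :: complex) + 1 = 2" by simp
  have Y: "\<Phi> (replicate n Y_letter) = 0" if "n > 0" for n
  proof (rule square_root_series_trivial[OF _ _ _ that])
    show "2 ^ n * \<Phi> (replicate n Y_letter) =
      (\<Sum>i\<le>n. \<Phi> (replicate i Y_letter) * \<Phi> (replicate (n - i) Y_letter))" for n
      \<comment> \<open>Splitting 2 = 1 + 1 in the complex numbers produces the factor 2^n on the
        left.\<close>
      using arg_cong[OF nc_eval_split[OF gl, of "0 :: complex" 0 1 1], of "\<lambda>p. fps_nth p n"]
      by (simp add: nc_eval_zero_left_nth fps_mult_nth scaleC_complex_def atLeast0AtMost mult.commute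
          del: fps_nth_power_0)
  qed (use nil lin in simp_all)
  have X: "\<Phi> (replicate n X_letter) = 0" if "n > 0" for n
  proof (rule square_root_series_trivial[OF _ _ _ that])
    show "2 ^ n * \<Phi> (replicate n X_letter) =
      (\<Sum>i\<le>n. \<Phi> (replicate i X_letter) * \<Phi> (replicate (n - i) X_letter))" for n
      using arg_cong[OF nc_eval_split[OF gl, of "1 :: complex" 1 0 0], of "\<lambda>p. fps_nth p n"]
      by (simp add: nc_eval_zero_right_nth fps_mult_nth scaleC_complex_def atLeast0AtMost mult.commute)
  qed (use nil lin in simp_all)
  show "nc_eval \<Phi> 0 b = 1"
    by (rule fps_ext) (auto simp: nc_eval_zero_left_nth nil Y)
  show "nc_eval \<Phi> a 0 = 1"
    by (rule fps_ext) (auto simp: nc_eval_zero_right_nth nil X)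
qed

lemma exhaust_three:
  fixes x :: 3
  shows "x = 1 \<or> x = 2 \<or> x = 3"
proof (induction x)
  case (of_int z)
  then have "z = 0 \<or> z = 1 \<or> z = 2" by fastforce
  then show ?case by auto
qed

lemma exhaust_four:
  fixes x :: 4
  shows "x = 1 \<or> x = 2 \<or> x = 3 \<or> x = 4"
proof (induction x)
  case (of_int z)
  then have "z = 0 \<or> z = 1 \<or> z = 2 \<or> z = 3" by fastforce
  then show ?case by auto
qed

subsection \<open>Infinitesimal braids from commuting copies of a Lie algebra\<close>

text \<open>Unlike \<open>insert_pair\<close>, the embeddings are defined on the Lie algebra only;
  sums of copies, which are Lie maps given on elements, can thus be inserted directly.\<close>

definition pairing ::
    "('g::complex_vector \<Rightarrow> 'a::complex_algebra_1) \<Rightarrow> ('g \<Rightarrow> 'a) \<Rightarrow> 'g \<otimes> 'g \<Rightarrow> 'a"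
  where "pairing e f = tensor_lift (\<lambda>a b. e a * f b)"

lemma insert_pair_pairing: "insert_pair p q t = pairing (\<lambda>a. p (\<iota> a)) (\<lambda>a. q (\<iota> a)) t"
  by (simp add: insert_pair_def pairing_def)

lemma pairing_add_left: "pairing (\<lambda>a. e a + e' a) f t = pairing e f t + pairing e' f t"
  and pairing_add_right: "pairing e (\<lambda>a. f a + f' a) t = pairing e f t + pairing e f' t"
  by (simp_all add: pairing_def distrib_left distrib_right tensor_lift_plus_fun)

lemma cbilinear_pairing:
  fixes e f :: "'g::complex_vector \<Rightarrow> 'a::complex_algebra_1"
  shows "clinear e \<Longrightarrow> clinear f \<Longrightarrow> cbilinear (\<lambda>a b. e a * f b)"
  by (rule cbilinear_compose[OF cbilinear_mult])

lemma clinear_pairing: "clinear e \<Longrightarrow> clinear f \<Longrightarrow> clinear (pairing e f)"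
  unfolding pairing_def by (intro clinear_tensor_lift cbilinear_pairing)

lemma pairing_tens: "clinear e \<Longrightarrow> clinear f \<Longrightarrow> pairing e f (a \<otimes> b) = e a * f b"
  unfolding pairing_def by (intro tensor_lift_tens cbilinear_pairing)

lemma alg_hom_pairing:
  assumes "alg_hom h" "clinear e" "clinear f"
  shows "h (pairing e f t) = pairing (\<lambda>a. h (e a)) (\<lambda>a. h (f a)) t"
  unfolding pairing_def
  by (simp add: clinear_tensor_lift_commute[OF alg_hom_clinear[OF assms(1)] cbilinear_pairing[OF assms(2,3)]]
      alg_hom_mult[OF assms(1)])

lemma pairing_commute:
  assumes "\<And>a. y * e a = e a * y" "\<And>a. y * f a = f a * y"
  shows "y * pairing e f t = pairing e f t * y"
  unfolding pairing_def tensor_lift_def lin_extend_def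
  by (intro commute_sum) (auto intro!: commute_scaleC commute_mult assms split: prod.split)

lemma pairing_swap:
  assumes lin: "clinear e" "clinear f" and comm: "\<And>a b. e a * f b = f b * e a" and t: "tensor_swap t = t"
  shows "pairing e f t = pairing f e t"
proof -
  have swap: "cbilinear (\<lambda>a b. b \<otimes> a)"
    by (intro cbilinearI) (simp_all add: tens_add_left tens_add_right tens_scaleC_left tens_scaleC_right)
  have "pairing f e (tensor_swap z) = pairing e f z" for z
    by (rule clinear_eq_tensorI)
      (auto simp: tensor_swap_def tensor_lift_tens[OF swap] pairing_tens lin comm
        intro!: clinear_pairing lin clinear_compose[OF clinear_tensor_lift[OF swap]])
  from this[of t] show ?thesis by (simp add: t)
qed

lemma clinear_bracket: "clinear (bracket x)"
  by (intro clinearI bracket_add_right bracket_scaleC_right)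

lemma clinear_id: "clinear id"
  by (intro clinearI) simp_all

text \<open>The commutator with the diagonal element \<open>e c + f c\<close> is the pairing of the
  adjoint action of \<open>c\<close> on the tensor, and invariance makes that zero.\<close>

lemma pairing_invariant:
  assumes e: "lie_hom_into e" and f: "lie_hom_into f" and comm: "\<And>a b. e a * f b = f b * e a"
    and t: "invariant_symmetric t"
  shows "(e c + f c) * pairing e f t = pairing e f t * (e c + f c)"
proof -
  have lin: "clinear e" "clinear f"
    and br: "\<And>a b. e (bracket a b) = e a * e b - e b * e a" "\<And>a b. f (bracket a b) = f a * f b - f b * f a"
    using e f by (auto simp: lie_hom_into_def)
  note linp = clinear_pairing[OF lin]
  note linb = clinear_tensor_map[OF clinear_bracket[of c] clinear_id]
    clinear_tensor_map[OF clinear_id clinear_bracket[of c]]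
  \<comment> \<open>The commutator formula is linear in the tensor and is proved for all tensors,
    since pure tensors need not be invariant; invariance enters only after specialising to
    \<open>t\<close>.\<close>
  have "(e c + f c) * pairing e f z - pairing e f z * (e c + f c) =
      pairing e f (tensor_map (bracket c) id z + tensor_map id (bracket c) z)" for z
  proof (induction z rule: tensor_induct)
    case (tens a b)
    have *: "f c * (e a * f b) = e a * (f c * f b)" "e a * f b * e c = e a * e c * f b" for a b
      by (metis comm mult.assoc)+
    have "pairing e f (tensor_map (bracket c) id (a \<otimes> b) + tensor_map id (bracket c) (a \<otimes> b)) =
        (e c * e a - e a * e c) * f b + e a * (f c * f b - f b * f c)"
      by (simp only: tensor_map_tens clinear_bracket clinear_id clinear_add[OF linp] pairing_tens lin br id_apply)
    then show ?case
      by (simp only: pairing_tens lin distrib_left distrib_right left_diff_distrib right_diff_distrib *)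
        (simp add: mult.assoc)
  next
    case (add x y)
    have *: "pairing e f (tensor_map (bracket c) id (x + y) + tensor_map id (bracket c) (x + y)) =
        pairing e f (tensor_map (bracket c) id x + tensor_map id (bracket c) x) +
        pairing e f (tensor_map (bracket c) id y + tensor_map id (bracket c) y)"
      by (simp only: clinear_add[OF linp] clinear_add[OF linb(1)] clinear_add[OF linb(2)] ac_simps)
    show ?case
      unfolding * unfolding add.IH[symmetric] unfolding clinear_add[OF linp]
      by (simp add: algebra_simps)
  qed
  from this[of t] show ?thesis
    using t by (simp add: invariant_symmetric_def clinear_0[OF linp])
qed

text \<open>A set of strands carries the sum of its copies of the Lie algebra.  \<open>P I K L\<close> is the associativity
  constraint \<open>\<Phi>\<^bsup>I,K,L\<^esup>\<close>, \<open>R I K\<close> the braiding, \<open>B K L M\<close> the braiding in a word that starts with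
  \<open>K (L M)\<close>, and \<open>J I K L M\<close> the interchange \<open>(IK)(LM) \<rightarrow> (IL)(KM)\<close>.\<close>

locale slots =
  fixes e :: "'i \<Rightarrow> 'g::lie_algebra \<Rightarrow> 'a::complex_algebra_1"
    and t :: "'g \<otimes> 'g" and \<Phi> :: nc_series
  assumes lie: "lie_hom_into (e i)"
    and comm: "i \<noteq> j \<Longrightarrow> e i a * e j b = e j b * e i a"
    and inv: "invariant_symmetric t"
    and associator: "drinfeld_associator \<Phi>"
begin

definition E :: "'i set \<Rightarrow> 'g \<Rightarrow> 'a"
  where "E I a = (\<Sum>i\<in>I. e i a)"

definition T :: "'i set \<Rightarrow> 'i set \<Rightarrow> 'a"
  where "T I K = pairing (E I) (E K) t"

definition P :: "'i set \<Rightarrow> 'i set \<Rightarrow> 'i set \<Rightarrow> 'a fps"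
  where "P I K L = nc_eval \<Phi> (T I K) (T K L)"

definition R :: "'i set \<Rightarrow> 'i set \<Rightarrow> 'a fps"
  where "R I K = hexp ((1/2) *\<^sub>C T I K)"

definition B :: "'i set \<Rightarrow> 'i set \<Rightarrow> 'i set \<Rightarrow> 'a fps"
  where "B K L M = P L K M * R K L * two_sided_inverse (P K L M)"

definition J :: "'i set \<Rightarrow> 'i set \<Rightarrow> 'i set \<Rightarrow> 'i set \<Rightarrow> 'a fps"
  where "J I K L M = two_sided_inverse (P I L (K \<union> M)) * B K L M * P I K (L \<union> M)"

lemma assoc_nil: "\<Phi> [] = 1"
  using associator by (simp add: drinfeld_associator_def group_like_def)

lemma P_inverse: "P I K L * two_sided_inverse (P I K L) = 1" "two_sided_inverse (P I K L) * P I K L = 1"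
  by (rule two_sided_inverse, simp add: P_def nc_eval_nth_0 assoc_nil)+

lemma P_nth_0: "fps_nth (P I K L) 0 = 1"
  by (simp add: P_def nc_eval_nth_0 assoc_nil)

lemma E_Un: "finite I \<Longrightarrow> finite K \<Longrightarrow> I \<inter> K = {} \<Longrightarrow> E (I \<union> K) = (\<lambda>a. E I a + E K a)"
  by (simp add: E_def fun_eq_iff sum.union_disjoint)

lemma E_commute: "I \<inter> K = {} \<Longrightarrow> E I a * E K b = E K b * E I a"
  unfolding E_def by (intro commute_sum, rule commute_sum[symmetric], rule comm[symmetric]) auto

lemma E_lie: "finite I \<Longrightarrow> lie_hom_into (E I)"
proof (induction I rule: finite_induct)
  case empty
  show ?case by (auto simp: E_def[abs_def] lie_hom_into_def intro!: clinearI)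
next
  case (insert i I)
  have lin: "clinear (e i)" "clinear (E I)"
    and br: "\<And>a b. e i (bracket a b) = e i a * e i b - e i b * e i a"
      "\<And>a b. E I (bracket a b) = E I a * E I b - E I b * E I a"
    using lie[of i] insert.IH by (auto simp: lie_hom_into_def)
  have c: "e i a * E I b = E I b * e i a" for a b
    using E_commute[of "{i}" I a b] insert.hyps by (simp add: E_def)
  have E: "E (insert i I) = (\<lambda>a. e i a + E I a)"
    using insert.hyps by (simp add: E_def fun_eq_iff)
  show ?case
    unfolding E lie_hom_into_def
    by (auto intro!: clinearI simp: clinear_add[OF lin(1)] clinear_add[OF lin(2)] clinear_scale[OF lin(1)]
        clinear_scale[OF lin(2)] scaleC_add_right br algebra_simps c)
qed

lemma E_clinear: "finite I \<Longrightarrow> clinear (E I)"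
  using E_lie by (auto simp: lie_hom_into_def)

lemma T_Un_left: "finite I \<Longrightarrow> finite K \<Longrightarrow> I \<inter> K = {} \<Longrightarrow> T (I \<union> K) L = T I L + T K L"
  and T_Un_right: "finite I \<Longrightarrow> finite K \<Longrightarrow> I \<inter> K = {} \<Longrightarrow> T L (I \<union> K) = T L I + T L K"
  by (simp_all add: T_def E_Un pairing_add_left pairing_add_right)

lemma T_sym: "finite I \<Longrightarrow> finite K \<Longrightarrow> I \<inter> K = {} \<Longrightarrow> T I K = T K I"
  unfolding T_def using inv
  by (intro pairing_swap E_clinear E_commute) (auto simp: invariant_symmetric_def)

text \<open>If \<open>S\<close> contains both blocks, split it into I \<union> K, which acts
  diagonally so that invariance applies, and the remaining strands, which commute with everything on
  I \<union> K. Both the infinitesimal braid relations and locality come from here.\<close>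

lemma E_T_commute:
  assumes "finite S" "I \<inter> K = {}" "I \<union> K \<subseteq> S \<or> (I \<union> K) \<inter> S = {}"
  shows "E S a * T I K = T I K * E S a"
proof -
  have disj: "E U a * T I K = T I K * E U a" if "(I \<union> K) \<inter> U = {}" for U
    unfolding T_def using that by (intro pairing_commute E_commute) auto
  show ?thesis
  proof (cases "I \<union> K \<subseteq> S")
    case True
    then have fin: "finite I" "finite K" "finite (I \<union> K)" "finite (S - (I \<union> K))"
      using assms(1) by (auto intro: finite_subset)
    have S: "S = (I \<union> K) \<union> (S - (I \<union> K))" using True by auto
    have "E S a = (E I a + E K a) + E (S - (I \<union> K)) a"
      by (subst S, subst E_Un) (use fin assms(2) in \<open>auto simp: E_Un\<close>)
    moreover have "(E I a + E K a) * T I K = T I K * (E I a + E K a)"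
      unfolding T_def by (intro pairing_invariant E_lie fin E_commute inv assms(2))
    moreover have "E (S - (I \<union> K)) a * T I K = T I K * E (S - (I \<union> K)) a"
      by (rule disj) auto
    ultimately show ?thesis
      by (simp only: distrib_left distrib_right)
  next
    case False
    then show ?thesis using assms(3) by (intro disj) auto
  qed
qed

text \<open>By additivity the sum in the four-term relation is T (S i \<union> S j) (S k): its first
  leg contains both strands of T (S i) (S j) and its second leg misses them. The diagonal is set to
  0 because the relations demand t i i = 0, whereas \<open>T I I\<close> would be a Casimir
  element.\<close>

lemma kohno_system_T:
  assumes fin: "\<And>i. finite (S i)" and disj: "\<And>i j. i \<noteq> j \<Longrightarrow> S i \<inter> S j = {}"
  shows "kohno_system (\<lambda>i j. if i = j then 0 else T (S i) (S j))"
proof -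
  have 1: "T (S i) (S j) * T (S k) (S l) = T (S k) (S l) * T (S i) (S j)" if "distinct [i, j, k, l]" for i j k l
    unfolding T_def[of "S k"]
    by (intro pairing_commute E_T_commute[symmetric] fin disj)
      (use that disj[of i j] disj[of i k] disj[of j k] disj[of i l] disj[of j l] in auto)
  have 2: "T (S i) (S j) * (T (S i) (S k) + T (S j) (S k)) = (T (S i) (S k) + T (S j) (S k)) * T (S i) (S j)"
    if "distinct [i, j, k]" for i j k
  proof -
    have "T (S i) (S k) + T (S j) (S k) = T (S i \<union> S j) (S k)"
      using that by (simp add: T_Un_left fin disj)
    also have "T (S i) (S j) * T (S i \<union> S j) (S k) = T (S i \<union> S j) (S k) * T (S i) (S j)"
      unfolding T_def[of "S i \<union> S j"]
      by (intro pairing_commute E_T_commute[symmetric] fin finite_UnI)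
        (use that disj[of i j] disj[of i k] disj[of j k] in auto)
    finally show ?thesis by (simp add: \<open>T (S i) (S k) + T (S j) (S k) = _\<close>)
  qed
  show ?thesis
    unfolding kohno_system_def using 1 2 by (auto simp: T_sym fin disj)
qed

section \<open>Pentagon and hexagons for blocks of strands\<close>

lemma pentagon_P:
  assumes fin: "finite I" "finite K" "finite L" "finite M"
    and disj: "I \<inter> K = {}" "I \<inter> L = {}" "I \<inter> M = {}" "K \<inter> L = {}" "K \<inter> M = {}" "L \<inter> M = {}"
  shows "P I K (L \<union> M) * P (I \<union> K) L M = P K L M * P I (K \<union> L) M * P I K L"
proof -
  define S :: "4 \<Rightarrow> 'i set" where "S i = (if i = 1 then I else if i = 2 then K else if i = 3 then L else M)" for i
  have neq: "(1::4) \<noteq> 2" "(1::4) \<noteq> 3" "(1::4) \<noteq> 4" "(2::4) \<noteq> 3" "(2::4) \<noteq> 4" "(3::4) \<noteq> 4" by simp_all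
  have cases: "i = 1 \<or> i = 2 \<or> i = 3 \<or> i = 4" for i :: 4 
    using exhaust_four by blast
  have S: "S 1 = I" "S 2 = K" "S 3 = L" "S 4 = M" using neq by (simp_all add: S_def)
  have "S i \<inter> S j = {}" if "i \<noteq> j" for i j
    using that cases[of i] cases[of j] disj by (elim disjE) (simp_all add: S Int_commute)
  moreover have "finite (S i)" for i
    using fin by (simp add: S_def)
  ultimately have "kohno_system (\<lambda>i j. if i = j then 0 else T (S i) (S j))"
    by (intro kohno_system_T)
  with associator have "nc_eval \<Phi> (T I K) (T K L + T K M) * nc_eval \<Phi> (T I L + T K L) (T L M) =
    nc_eval \<Phi> (T K L) (T L M) * nc_eval \<Phi> (T I K + T I L) (T K M + T L M) * nc_eval \<Phi> (T I K) (T K L)"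
    using neq by (auto simp: drinfeld_associator_def S dest!: pentagon_eval)
  then show ?thesis
    by (simp add: P_def T_Un_left T_Un_right fin disj)
qed

lemma hexagons_P:
  assumes fin: "finite I" "finite K" "finite L"
    and disj: "I \<inter> K = {}" "I \<inter> L = {}" "K \<inter> L = {}"
  shows "R (I \<union> K) L = P L I K * R I L * two_sided_inverse (P I L K) * R K L * P I K L"
    and "R I (K \<union> L) = two_sided_inverse (P K L I) * R I L * P K I L * R I K * two_sided_inverse (P I K L)"
proof -
  define S :: "3 \<Rightarrow> 'i set" where "S i = (if i = 1 then I else if i = 2 then K else L)" for i
  have neq: "(1::3) \<noteq> 2" "(1::3) \<noteq> 3" "(2::3) \<noteq> 3" by simp_all
  have cases: "i = 1 \<or> i = 2 \<or> i = 3" for i :: 3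
    using exhaust_three by blast
  have S: "S 1 = I" "S 2 = K" "S 3 = L" using neq by (simp_all add: S_def)
  have "S i \<inter> S j = {}" if "i \<noteq> j" for i j
    using that cases[of i] cases[of j] disj by (elim disjE) (simp_all add: S Int_commute)
  moreover have "finite (S i)" for i
    using fin by (simp add: S_def)
  ultimately have "kohno_system (\<lambda>i j. if i = j then 0 else T (S i) (S j))"
    by (intro kohno_system_T)
  moreover have "hexagons \<Phi>" using associator by (simp add: drinfeld_associator_def)
  ultimately have hex: "hexagons \<Phi>" "kohno_system (\<lambda>i j. if i = j then 0 else T (S i) (S j))"
    by blast+
  show "R (I \<union> K) L = P L I K * R I L * two_sided_inverse (P I L K) * R K L * P I K L"
    "R I (K \<union> L) = two_sided_inverse (P K L I) * R I L * P K I L * R I K * two_sided_inverse (P I K L)"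
    using hexagons_eval[OF hex(1) assoc_nil hex(2)] neq fin disj by (simp_all add: S R_def P_def T_Un_left T_Un_right T_sym Int_commute)
qed

subsection \<open>Locality\<close>

text \<open>Expresses that \<open>p\<close> acts inside the block \<open>A\<close>: it is
  equivariant for every block that contains \<open>A\<close> and independent of every block that
  misses it. This is the substitute for being a morphism of one tensor factor.\<close>

definition supported :: "'i set \<Rightarrow> 'a fps \<Rightarrow> bool"
  where "supported A p \<longleftrightarrow>
    (\<forall>S a. finite S \<longrightarrow> A \<subseteq> S \<or> A \<inter> S = {} \<longrightarrow> commutes_const (E S a) p)"

lemma supported_P: "I \<inter> K = {} \<Longrightarrow> K \<inter> L = {} \<Longrightarrow> I \<union> K \<union> L \<subseteq> A \<Longrightarrow> supported A (P I K L)"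
  unfolding supported_def P_def
  by (intro allI impI commutes_const_nc_eval E_T_commute) auto

lemma supported_R: "I \<inter> K = {} \<Longrightarrow> I \<union> K \<subseteq> A \<Longrightarrow> supported A (R I K)"
  unfolding supported_def R_def
  by (intro allI impI commutes_const_hexp commute_scaleC E_T_commute) auto

lemma supported_mult: "supported A p \<Longrightarrow> supported A q \<Longrightarrow> supported A (p * q)"
  by (simp add: supported_def commutes_const_mult)

lemma supported_inverse_P: "supported A (P I K L) \<Longrightarrow> supported A (two_sided_inverse (P I K L))"
  by (simp add: supported_def commutes_const_inverse P_nth_0)

lemma supported_B: "K \<inter> L = {} \<Longrightarrow> K \<inter> M = {} \<Longrightarrow> L \<inter> M = {} \<Longrightarrow> K \<union> L \<union> M \<subseteq> A \<Longrightarrow> supported A (B K L M)"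
  unfolding B_def by (intro supported_mult supported_inverse_P supported_P supported_R) auto

lemma supported_J:
  "I \<inter> K = {} \<Longrightarrow> I \<inter> L = {} \<Longrightarrow> I \<inter> M = {} \<Longrightarrow> K \<inter> L = {} \<Longrightarrow> K \<inter> M = {} \<Longrightarrow> L \<inter> M = {} \<Longrightarrow>
    I \<union> K \<union> L \<union> M \<subseteq> A \<Longrightarrow> supported A (J I K L M)"
  unfolding J_def by (intro supported_mult supported_inverse_P supported_P supported_B) auto

lemma supportedD:
  "supported A p \<Longrightarrow> finite S \<Longrightarrow> A \<subseteq> S \<or> A \<inter> S = {} \<Longrightarrow> E S a * fps_nth p n = fps_nth p n * E S a"
  unfolding supported_def commutes_const_def by blast

lemma supported_T:
  assumes "supported A p" "finite I" "finite K" "A \<subseteq> I \<or> A \<inter> I = {}" "A \<subseteq> K \<or> A \<inter> K = {}"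
  shows "commutes_const (T I K) p"
  unfolding commutes_const_def T_def
  by (intro allI pairing_commute[symmetric] supportedD[OF assms(1), symmetric] assms)

text \<open>Naturality of the associativity constraint with respect to a morphism inside one of its
  blocks, and its independence of strands elsewhere. The next lemmas say the same for the
  braiding.\<close>

lemma supported_commute_P:
  assumes "supported A p" "finite I" "finite K" "finite L"
    "A \<subseteq> I \<or> A \<inter> I = {}" "A \<subseteq> K \<or> A \<inter> K = {}" "A \<subseteq> L \<or> A \<inter> L = {}"
  shows "p * P I K L = P I K L * p"
  unfolding P_def by (intro commute_nc_eval supported_T[OF assms(1)] assms)

lemma commutes_const_scaleC: "commutes_const y p \<Longrightarrow> commutes_const (c *\<^sub>C y) p"
  by (simp add: commutes_const_def)

lemma supported_commute_R:
  assumes "supported A p" "finite I" "finite K" "A \<subseteq> I \<or> A \<inter> I = {}" "A \<subseteq> K \<or> A \<inter> K = {}"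
  shows "p * R I K = R I K * p"
  unfolding R_def by (intro commute_hexp commutes_const_scaleC supported_T[OF assms(1)] assms)

lemma supported_commute_B:
  assumes "supported A p" "finite K" "finite L" "finite M"
    "A \<subseteq> K \<or> A \<inter> K = {}" "A \<subseteq> L \<or> A \<inter> L = {}" "A \<subseteq> M \<or> A \<inter> M = {}"
  shows "p * B K L M = B K L M * p"
  unfolding B_def
  by (intro commute_mult supported_commute_P[OF assms(1)] supported_commute_R[OF assms(1)]
      inverse_commute[OF P_inverse] assms)

end

subsection \<open>The interchange is monoidal\<close>

lemma commute_left: "x * a = a * (x :: 'a::ring_1) \<Longrightarrow> x * (a * z) = a * (x * z)"
  by (simp flip: mult.assoc)

context slots
begin

lemma P_cancel [simp]:
  "P I K L * (two_sided_inverse (P I K L) * x) = x" "two_sided_inverse (P I K L) * (P I K L * x) = x"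
  by (simp_all add: P_inverse flip: mult.assoc)

text \<open>Two ways of computing the reassociation \<open>((IK)(LM))N \<rightarrow> I(K(L(MN)))\<close>.\<close>

lemma five_strands:
  assumes fin: "finite I" "finite K" "finite L" "finite M" "finite N"
    and disj: "I \<inter> K = {}" "I \<inter> L = {}" "I \<inter> M = {}" "I \<inter> N = {}" "K \<inter> L = {}" "K \<inter> M = {}"
      "K \<inter> N = {}" "L \<inter> M = {}" "L \<inter> N = {}" "M \<inter> N = {}"
  shows "P I K (L \<union> M \<union> N) * (P L M N * P (I \<union> K) (L \<union> M) N) =
    P K L (M \<union> N) * (P (K \<union> L) M N * (P I (K \<union> L \<union> M) N *
      (two_sided_inverse (P K L M) * P I K (L \<union> M))))"
    (is "?a * (?b * ?c) = ?r * (?s * (?\<alpha> * (?i * ?j)))")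
proof -
  let ?q = "P K (L \<union> M) N" and ?k = "P K L M"
  \<comment> \<open>The pentagons for I, K, LM, N and for K, L, M, N share the edge
    \<open>?q\<close>; facts 3 and 4 are the naturality squares that glue them together.\<close>
  have 1: "?a * ?c = ?q * ?\<alpha> * ?j"
    using pentagon_P[of I K "L \<union> M" N] fin disj by (simp add: Un_assoc Int_Un_distrib Int_Un_distrib2)
  have 2: "?r * ?s = ?b * ?q * ?k"
    using pentagon_P[of K L M N] fin disj by simp
  have 3: "?b * ?a = ?a * ?b"
    by (rule supported_commute_P[where A = "L \<union> M \<union> N"]) (use fin disj in \<open>auto intro!: supported_P\<close>)
  have 4: "?k * ?\<alpha> = ?\<alpha> * ?k"
    by (rule supported_commute_P[where A = "K \<union> L \<union> M"]) (use fin disj in \<open>auto intro!: supported_P\<close>)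
  have "?r * (?s * (?\<alpha> * (?i * ?j))) = ?r * ?s * (?\<alpha> * (?i * ?j))" by (simp only: mult.assoc)
  also have "\<dots> = ?b * ?q * (?k * ?\<alpha>) * (?i * ?j)" by (simp only: 2 mult.assoc)
  also have "\<dots> = ?b * (?q * ?\<alpha> * ?j)" unfolding 4 by (simp add: mult.assoc)
  also have "\<dots> = ?b * ?a * ?c" by (simp only: 1[symmetric]) (simp only: mult.assoc)
  also have "\<dots> = ?a * (?b * ?c)" by (simp only: 3 mult.assoc)
  finally show ?thesis by simp
qed

text \<open>Between right-nested words the interchange inside the left factor of ((IK)(LM))N is just
  the crossing of K and L. Both reassociations are expanded by \<open>five_strands\<close>; what is
  left is to move \<open>R K L\<close> past two associators that see K and L as parts of a single
  block.\<close>

lemma J_whisker_right: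
  assumes fin: "finite I" "finite K" "finite L" "finite M" "finite N"
    and disj: "I \<inter> K = {}" "I \<inter> L = {}" "I \<inter> M = {}" "I \<inter> N = {}" "K \<inter> L = {}" "K \<inter> M = {}"
      "K \<inter> N = {}" "L \<inter> M = {}" "L \<inter> N = {}" "M \<inter> N = {}"
  shows "P I L (K \<union> M \<union> N) * (P K M N * (P (I \<union> L) (K \<union> M) N * J I K L M)) =
    B K L (M \<union> N) * (P I K (L \<union> M \<union> N) * (P L M N * P (I \<union> K) (L \<union> M) N))"
proof -
  let ?s = "P (K \<union> L) M N" and ?\<alpha> = "P I (K \<union> L \<union> M) N"
  have s: "R K L * ?s = ?s * R K L" and \<alpha>: "R K L * ?\<alpha> = ?\<alpha> * R K L"
    by (rule supported_commute_P[where A = "K \<union> L"]; use fin disj in \<open>auto intro!: supported_R\<close>)+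
  have disj': "L \<inter> K = {}" using disj by auto
  \<comment> \<open>The same expansion with K and L exchanged; \<open>?s\<close> and
    \<open>?\<alpha>\<close> depend only on K \<union> L, so they are shared with the expansion for
    the original order.\<close>
  have "P I L (K \<union> M \<union> N) * (P K M N * P (I \<union> L) (K \<union> M) N) =
      P L K (M \<union> N) * (?s * (?\<alpha> * (two_sided_inverse (P L K M) * P I L (K \<union> M))))"
    using five_strands[of I L K M N] fin disj disj' by (simp add: Un_commute)
  then have "P I L (K \<union> M \<union> N) * (P K M N * (P (I \<union> L) (K \<union> M) N * J I K L M)) =
      P L K (M \<union> N) * (?s * (?\<alpha> * (two_sided_inverse (P L K M) * P I L (K \<union> M)))) * J I K L M"
    by (simp only: mult.assoc[symmetric])
  also have "\<dots> = P L K (M \<union> N) * (?s * (?\<alpha> * R K L)) * (two_sided_inverse (P K L M) * P I K (L \<union> M))"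
    by (simp add: J_def B_def mult.assoc)
  also have "?s * (?\<alpha> * R K L) = R K L * ?s * ?\<alpha>"
    by (simp only: s \<alpha>[symmetric] mult.assoc[symmetric])
  also have "P L K (M \<union> N) * (R K L * ?s * ?\<alpha>) * (two_sided_inverse (P K L M) * P I K (L \<union> M)) =
      B K L (M \<union> N) * (P K L (M \<union> N) * (?s * (?\<alpha> * (two_sided_inverse (P K L M) * P I K (L \<union> M)))))"
    by (simp add: B_def mult.assoc)
  also have "\<dots> = B K L (M \<union> N) * (P I K (L \<union> M \<union> N) * (P L M N * P (I \<union> K) (L \<union> M) N))"
    by (simp only: five_strands[OF fin disj])
  finally show ?thesis .
qed

text \<open>The hexagons, as decompositions of the braiding of a word of length two past a strand.\<close>

lemma braid_two_past_one:
  assumes fin: "finite I" "finite K" "finite L" "finite M"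
    and disj: "I \<inter> K = {}" "I \<inter> L = {}" "I \<inter> M = {}" "K \<inter> L = {}" "K \<inter> M = {}" "L \<inter> M = {}"
  shows "P I K M * B (I \<union> K) L M = B I L (K \<union> M) * (B K L M * P I K (L \<union> M))"
proof -
  have disj': "L \<inter> I = {}" "L \<inter> K = {}" "K \<inter> I = {}" using disj by auto
  \<comment> \<open>One pentagon for each of the orders L I K, I L K and I K L that occur while L
    moves to the left, with M staying last. Each crossing then passes through the associator that
    treats its two strands as one block.\<close>
  have p1: "P L I (K \<union> M) * P (I \<union> L) K M = P I K M * P L (I \<union> K) M * P L I K"
    using pentagon_P[of L I K M] fin disj disj' by (simp add: Un_commute)
  have p2: "P I L (K \<union> M) * P (I \<union> L) K M = P L K M * P I (K \<union> L) M * P I L K"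
    using pentagon_P[of I L K M] fin disj disj' by (simp add: Un_commute)
  have p3: "P I K (L \<union> M) * P (I \<union> K) L M = P K L M * P I (K \<union> L) M * P I K L"
    using pentagon_P[of I K L M] fin disj by simp
  have c1: "R I L * P (I \<union> L) K M = P (I \<union> L) K M * R I L"
    by (rule supported_commute_P[where A = "I \<union> L"]) (use fin disj in \<open>auto intro!: supported_R\<close>)
  have c2: "R K L * P I (K \<union> L) M = P I (K \<union> L) M * R K L"
    by (rule supported_commute_P[where A = "K \<union> L"]) (use fin disj in \<open>auto intro!: supported_R\<close>)
  have h: "R (I \<union> K) L = P L I K * R I L * two_sided_inverse (P I L K) * R K L * P I K L"
    using hexagons_P(1)[of I K L] fin disj by simp
  have p2': "P (I \<union> L) K M * two_sided_inverse (P I L K) =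
      two_sided_inverse (P I L (K \<union> M)) * (P L K M * P I (K \<union> L) M)"
  proof -
    have "P (I \<union> L) K M * two_sided_inverse (P I L K) =
        two_sided_inverse (P I L (K \<union> M)) * (P I L (K \<union> M) * P (I \<union> L) K M) * two_sided_inverse (P I L K)"
      by (simp add: mult.assoc)
    then show ?thesis by (simp only: p2) (simp add: mult.assoc P_inverse)
  qed
  have p3': "P I (K \<union> L) M * P I K L * two_sided_inverse (P (I \<union> K) L M) =
      two_sided_inverse (P K L M) * P I K (L \<union> M)"
  proof -
    have "two_sided_inverse (P K L M) * P I K (L \<union> M) =
        two_sided_inverse (P K L M) * (P I K (L \<union> M) * P (I \<union> K) L M) * two_sided_inverse (P (I \<union> K) L M)"
      by (simp add: mult.assoc P_inverse)
    then show ?thesis by (simp only: p3) (simp add: mult.assoc)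
  qed
  have "P I K M * B (I \<union> K) L M =
      (P I K M * P L (I \<union> K) M * P L I K) * R I L * two_sided_inverse (P I L K) * R K L * P I K L *
        two_sided_inverse (P (I \<union> K) L M)"
    by (simp add: B_def h mult.assoc)
  also have "\<dots> = P L I (K \<union> M) * (P (I \<union> L) K M * R I L) * two_sided_inverse (P I L K) * R K L * P I K L *
        two_sided_inverse (P (I \<union> K) L M)"
    by (simp only: p1[symmetric]) (simp only: mult.assoc)
  also have "\<dots> = P L I (K \<union> M) * R I L * (P (I \<union> L) K M * two_sided_inverse (P I L K)) * R K L * P I K L *
        two_sided_inverse (P (I \<union> K) L M)"
    by (simp only: c1[symmetric] mult.assoc)
  also have "\<dots> = B I L (K \<union> M) * P L K M * (P I (K \<union> L) M * R K L) * P I K L *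
        two_sided_inverse (P (I \<union> K) L M)"
    by (simp only: p2' B_def mult.assoc)
  also have "\<dots> = B I L (K \<union> M) * P L K M * R K L * (P I (K \<union> L) M * P I K L *
        two_sided_inverse (P (I \<union> K) L M))"
    by (simp only: c2[symmetric] mult.assoc)
  also have "\<dots> = B I L (K \<union> M) * (B K L M * P I K (L \<union> M))"
    by (simp only: p3') (simp only: B_def mult.assoc)
  finally show ?thesis .
qed

text \<open>Rests on the second hexagon: I crosses K and then L. As before there is one pentagon per
  intermediate order, here K L I, K I L and I K L, and each crossing is moved past one associator by
  locality.\<close>

lemma braid_one_past_two:
  assumes fin: "finite I" "finite K" "finite L" "finite M"
    and disj: "I \<inter> K = {}" "I \<inter> L = {}" "I \<inter> M = {}" "K \<inter> L = {}" "K \<inter> M = {}" "L \<inter> M = {}"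
  shows "P K L (I \<union> M) * B I (K \<union> L) M = B I L M * (B I K (L \<union> M) * P K L M)"
proof -
  have disj': "L \<inter> I = {}" "L \<inter> K = {}" "K \<inter> I = {}" using disj by auto
  have p1: "P K L (I \<union> M) * P (K \<union> L) I M = P L I M * P K (I \<union> L) M * P K L I"
    using pentagon_P[of K L I M] fin disj disj' by (simp add: Un_commute)
  have p2: "P K I (L \<union> M) * P (I \<union> K) L M = P I L M * P K (I \<union> L) M * P K I L"
    using pentagon_P[of K I L M] fin disj disj' by (simp add: Un_commute)
  have p3: "P I K (L \<union> M) * P (I \<union> K) L M = P K L M * P I (K \<union> L) M * P I K L"
    using pentagon_P[of I K L M] fin disj by simp
  have c1: "R I L * P K (I \<union> L) M = P K (I \<union> L) M * R I L"
    by (rule supported_commute_P[where A = "I \<union> L"]) (use fin disj in \<open>auto intro!: supported_R\<close>)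
  have c2: "R I K * P (I \<union> K) L M = P (I \<union> K) L M * R I K"
    by (rule supported_commute_P[where A = "I \<union> K"]) (use fin disj in \<open>auto intro!: supported_R\<close>)
  have h: "R I (K \<union> L) = two_sided_inverse (P K L I) * R I L * P K I L * R I K * two_sided_inverse (P I K L)"
    using hexagons_P(2)[of I K L] fin disj by simp
  have p1': "P K L (I \<union> M) * P (K \<union> L) I M * two_sided_inverse (P K L I) = P L I M * P K (I \<union> L) M"
    by (simp only: p1) (simp add: mult.assoc P_inverse)
  have p2': "P K (I \<union> L) M * P K I L = two_sided_inverse (P I L M) * (P K I (L \<union> M) * P (I \<union> K) L M)"
    by (simp only: p2) (simp add: mult.assoc)
  have p3': "P (I \<union> K) L M * two_sided_inverse (P I K L) * two_sided_inverse (P I (K \<union> L) M) =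
      two_sided_inverse (P I K (L \<union> M)) * P K L M"
  proof -
    have "P (I \<union> K) L M * two_sided_inverse (P I K L) * two_sided_inverse (P I (K \<union> L) M) =
      two_sided_inverse (P I K (L \<union> M)) * (P I K (L \<union> M) * P (I \<union> K) L M) * two_sided_inverse (P I K L) *
        two_sided_inverse (P I (K \<union> L) M)"
      by (simp add: mult.assoc)
    then show ?thesis by (simp only: p3) (simp add: mult.assoc P_inverse)
  qed
  have "P K L (I \<union> M) * B I (K \<union> L) M =
      (P K L (I \<union> M) * P (K \<union> L) I M * two_sided_inverse (P K L I)) * R I L * P K I L * R I K *
        two_sided_inverse (P I K L) * two_sided_inverse (P I (K \<union> L) M)"
    by (simp add: B_def h mult.assoc)
  also have "\<dots> = P L I M * (P K (I \<union> L) M * R I L) * P K I L * R I K *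
        two_sided_inverse (P I K L) * two_sided_inverse (P I (K \<union> L) M)"
    by (simp only: p1') (simp only: mult.assoc)
  also have "\<dots> = P L I M * R I L * (P K (I \<union> L) M * P K I L) * R I K *
        two_sided_inverse (P I K L) * two_sided_inverse (P I (K \<union> L) M)"
    by (simp only: c1[symmetric] mult.assoc)
  also have "\<dots> = B I L M * P K I (L \<union> M) * (P (I \<union> K) L M * R I K) *
        two_sided_inverse (P I K L) * two_sided_inverse (P I (K \<union> L) M)"
    by (simp only: p2' B_def mult.assoc)
  also have "\<dots> = B I L M * P K I (L \<union> M) * R I K * (P (I \<union> K) L M *
        two_sided_inverse (P I K L) * two_sided_inverse (P I (K \<union> L) M))"
    by (simp only: c2[symmetric] mult.assoc)
  also have "\<dots> = B I L M * (B I K (L \<union> M) * P K L M)"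
    by (simp only: p3') (simp only: B_def mult.assoc)
  finally show ?thesis .
qed

end

text \<open>Both sides are compared after reassociating the target to \<open>1(3(5(2(46))))\<close>; there they become
  products of the crossings \<open>2,3\<close>, \<open>4,5\<close> and \<open>2,5\<close>, in orders that differ by commuting the first two.\<close>

lemma (in slots) J_hexagon:
  assumes fin: "finite s1" "finite s2" "finite s3" "finite s4" "finite s5" "finite s6"
    and "s1 \<inter> s2 = {}" "s1 \<inter> s3 = {}" "s1 \<inter> s4 = {}" "s1 \<inter> s5 = {}" "s1 \<inter> s6 = {}" "s2 \<inter> s3 = {}"
      "s2 \<inter> s4 = {}" "s2 \<inter> s5 = {}" "s2 \<inter> s6 = {}" "s3 \<inter> s4 = {}" "s3 \<inter> s5 = {}" "s3 \<inter> s6 = {}"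
      "s4 \<inter> s5 = {}" "s4 \<inter> s6 = {}" "s5 \<inter> s6 = {}"
  shows "P s1 s3 s5 * P s2 s4 s6 * (J (s1 \<union> s3) (s2 \<union> s4) s5 s6 * J s1 s2 s3 s4) =
    J s1 s2 (s3 \<union> s5) (s4 \<union> s6) * (J s3 s4 s5 s6 * P (s1 \<union> s2) (s3 \<union> s4) (s5 \<union> s6))"
proof -
  have disj: "s1 \<inter> s2 = {}" "s1 \<inter> s3 = {}" "s1 \<inter> s4 = {}" "s1 \<inter> s5 = {}" "s1 \<inter> s6 = {}" "s2 \<inter> s3 = {}"
      "s2 \<inter> s4 = {}" "s2 \<inter> s5 = {}" "s2 \<inter> s6 = {}" "s3 \<inter> s4 = {}" "s3 \<inter> s5 = {}" "s3 \<inter> s6 = {}"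
      "s4 \<inter> s5 = {}" "s4 \<inter> s6 = {}" "s5 \<inter> s6 = {}" by fact+
  then have disj': "s2 \<inter> s1 = {}" "s3 \<inter> s1 = {}" "s4 \<inter> s1 = {}" "s5 \<inter> s1 = {}" "s6 \<inter> s1 = {}" "s3 \<inter> s2 = {}"
      "s4 \<inter> s2 = {}" "s5 \<inter> s2 = {}" "s6 \<inter> s2 = {}" "s4 \<inter> s3 = {}" "s5 \<inter> s3 = {}" "s6 \<inter> s3 = {}"
      "s5 \<inter> s4 = {}" "s6 \<inter> s4 = {}" "s6 \<inter> s5 = {}" by (auto simp: Int_commute)
  note d = disj disj' fin
  let ?M = "P s3 s5 (s2 \<union> s4 \<union> s6) * P s1 (s3 \<union> s5) (s2 \<union> s4 \<union> s6)"
  let ?c25 = "B s2 s5 (s4 \<union> s6)" and ?c23 = "B s2 s3 (s4 \<union> s5 \<union> s6)" and ?c45 = "B s4 s5 s6"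
  let ?p1 = "P s1 s3 (s2 \<union> s4 \<union> s5 \<union> s6)" and ?n1 = "P s1 s2 (s3 \<union> s4 \<union> s5 \<union> s6)"
  \<comment> \<open>\<open>?N\<close> reassociates the source ((12)(34))(56) to 1(2(3(4(56)))), and
    \<open>?N'\<close> the intermediate word ((13)(24))(56) to 1(3(2(4(56)))).\<close>
  let ?N = "?n1 * (P s3 s4 (s5 \<union> s6) * P (s1 \<union> s2) (s3 \<union> s4) (s5 \<union> s6))"
  let ?N' = "?p1 * (P s2 s4 (s5 \<union> s6) * P (s1 \<union> s3) (s2 \<union> s4) (s5 \<union> s6))"
  note Un = Un_assoc Un_commute Un_left_commute

  have M: "?M * P s1 s3 s5 = ?p1 * P (s1 \<union> s3) s5 (s2 \<union> s4 \<union> s6)"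
    using pentagon_P[of s1 s3 s5 "s2 \<union> s4 \<union> s6"] d by (simp add: Un Int_Un_distrib)
  have c1: "P s2 s4 s6 * P (s1 \<union> s3) s5 (s2 \<union> s4 \<union> s6) = P (s1 \<union> s3) s5 (s2 \<union> s4 \<union> s6) * P s2 s4 s6"
    by (rule supported_commute_P[where A = "s2 \<union> s4 \<union> s6"]) (use d in \<open>auto intro!: supported_P\<close>)
  have c2: "B x y z * P s1 s3 (s2 \<union> s4 \<union> s5 \<union> s6) = ?p1 * B x y z"
    if "x \<inter> y = {}" "x \<inter> z = {}" "y \<inter> z = {}" "x \<union> y \<union> z \<subseteq> s2 \<union> s4 \<union> s5 \<union> s6" for x y z
    by (rule supported_commute_P[where A = "s2 \<union> s4 \<union> s5 \<union> s6"])
      (use d that in \<open>auto intro!: supported_B\<close>)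
  \<comment> \<open>The block 24 passes 5 as a word of length two: 4 crosses 5 before 2
    does.\<close>
  have left: "?M * (P s1 s3 s5 * (P s2 s4 s6 * J (s1 \<union> s3) (s2 \<union> s4) s5 s6)) = ?c25 * (?c45 * ?N')"
  proof -
    have "?M * (P s1 s3 s5 * (P s2 s4 s6 * J (s1 \<union> s3) (s2 \<union> s4) s5 s6)) =
        (?M * P s1 s3 s5) * P s2 s4 s6 * J (s1 \<union> s3) (s2 \<union> s4) s5 s6"
      by (simp only: mult.assoc)
    also have "\<dots> = ?p1 * (P (s1 \<union> s3) s5 (s2 \<union> s4 \<union> s6) * P s2 s4 s6) * J (s1 \<union> s3) (s2 \<union> s4) s5 s6"
      by (simp only: M) (simp only: mult.assoc)
    also have "\<dots> = ?p1 * (P s2 s4 s6 * B (s2 \<union> s4) s5 s6 * P (s1 \<union> s3) (s2 \<union> s4) (s5 \<union> s6))"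
      by (simp only: c1[symmetric]) (simp add: J_def mult.assoc Un_assoc)
    also have "P s2 s4 s6 * B (s2 \<union> s4) s5 s6 = ?c25 * (?c45 * P s2 s4 (s5 \<union> s6))"
      using braid_two_past_one[of s2 s4 s5 s6] d by simp
    also have "?p1 * (?c25 * (?c45 * P s2 s4 (s5 \<union> s6)) * P (s1 \<union> s3) (s2 \<union> s4) (s5 \<union> s6)) =
        ?c25 * (?c45 * ?N')"
    proof -
      have "?p1 * ?c25 = ?c25 * ?p1" "?p1 * ?c45 = ?c45 * ?p1"
        by (rule c2[symmetric]; use d in auto)+
      note this[THEN commute_left]
      then show ?thesis by (simp only: mult.assoc)
    qed
    finally show ?thesis .
  qed
  have J1: "?N' * J s1 s2 s3 s4 = ?c23 * ?N"
    using J_whisker_right[of s1 s2 s3 s4 "s5 \<union> s6"] d by (simp add: Un mult.assoc Int_Un_distrib)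
  have c3: "P s3 s5 (s4 \<union> s6) * ?n1 = ?n1 * P s3 s5 (s4 \<union> s6)" "?c45 * ?n1 = ?n1 * ?c45"
    by (rule supported_commute_P[where A = "s3 \<union> s4 \<union> s5 \<union> s6"];
      use d in \<open>auto intro!: supported_P supported_B\<close>)+
  \<comment> \<open>Here the strand 2 passes the block 35, crossing 3 before 5.\<close>
  have right: "?M * J s1 s2 (s3 \<union> s5) (s4 \<union> s6) = ?c25 * (?c23 * (?n1 * P s3 s5 (s4 \<union> s6)))"
  proof -
    have "?M * J s1 s2 (s3 \<union> s5) (s4 \<union> s6) =
        P s3 s5 (s2 \<union> s4 \<union> s6) * B s2 (s3 \<union> s5) (s4 \<union> s6) * ?n1"
      by (simp add: J_def mult.assoc Un)
    also have "P s3 s5 (s2 \<union> s4 \<union> s6) * B s2 (s3 \<union> s5) (s4 \<union> s6) = ?c25 * (?c23 * P s3 s5 (s4 \<union> s6))"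
      using braid_one_past_two[of s2 s3 s5 "s4 \<union> s6"] d by (simp add: Un Int_Un_distrib)
    finally show ?thesis by (simp only: mult.assoc c3)
  qed
  have J2: "?n1 * P s3 s5 (s4 \<union> s6) * (J s3 s4 s5 s6 * P (s1 \<union> s2) (s3 \<union> s4) (s5 \<union> s6)) = ?c45 * ?N"
  proof -
    have "?n1 * P s3 s5 (s4 \<union> s6) * (J s3 s4 s5 s6 * P (s1 \<union> s2) (s3 \<union> s4) (s5 \<union> s6)) =
      ?n1 * ?c45 * (P s3 s4 (s5 \<union> s6) * P (s1 \<union> s2) (s3 \<union> s4) (s5 \<union> s6))"
      by (simp add: J_def mult.assoc)
    then show ?thesis by (simp only: c3(2)[symmetric] mult.assoc)
  qed
  \<comment> \<open>The crossing of 2 and 3 sees the block 4, 5, 6 behind it as a whole, and the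
    crossing of 4 and 5 takes place inside that block.\<close>
  have c4: "?c45 * ?c23 = ?c23 * ?c45"
    by (rule supported_commute_B[where A = "s4 \<union> s5 \<union> s6"]) (use d in \<open>auto intro!: supported_B\<close>)

  have "?M * (P s1 s3 s5 * P s2 s4 s6 * (J (s1 \<union> s3) (s2 \<union> s4) s5 s6 * J s1 s2 s3 s4)) =
      ?M * (P s1 s3 s5 * (P s2 s4 s6 * J (s1 \<union> s3) (s2 \<union> s4) s5 s6)) * J s1 s2 s3 s4"
    by (simp only: mult.assoc)
  also have "\<dots> = ?c25 * (?c45 * (?N' * J s1 s2 s3 s4))"
    by (simp only: left; simp only: mult.assoc)
  also have "\<dots> = ?c25 * ((?c45 * ?c23) * ?N)"
    by (simp only: J1; simp only: mult.assoc)
  also have "\<dots> = ?c25 * (?c23 * (?c45 * ?N))"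
    by (simp only: c4; simp only: mult.assoc)
  also have "\<dots> = ?c25 * (?c23 * (?n1 * P s3 s5 (s4 \<union> s6))) * (J s3 s4 s5 s6 * P (s1 \<union> s2) (s3 \<union> s4) (s5 \<union> s6))"
    by (simp only: J2[symmetric]; simp only: mult.assoc)
  also have "\<dots> = ?M * (J s1 s2 (s3 \<union> s5) (s4 \<union> s6) * (J s3 s4 s5 s6 * P (s1 \<union> s2) (s3 \<union> s4) (s5 \<union> s6)))"
    by (simp only: right[symmetric]; simp only: mult.assoc)
  finally have eq: "?M * (P s1 s3 s5 * P s2 s4 s6 * (J (s1 \<union> s3) (s2 \<union> s4) s5 s6 * J s1 s2 s3 s4)) =
    ?M * (J s1 s2 (s3 \<union> s5) (s4 \<union> s6) * (J s3 s4 s5 s6 * P (s1 \<union> s2) (s3 \<union> s4) (s5 \<union> s6)))" .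
  have cancel: "two_sided_inverse (P s1 (s3 \<union> s5) (s2 \<union> s4 \<union> s6)) *
      (two_sided_inverse (P s3 s5 (s2 \<union> s4 \<union> s6)) * (?M * x)) = x" for x
    by (simp add: mult.assoc)
  show ?thesis
    by (subst (1 2) cancel[symmetric]) (simp only: eq)
qed

subsection \<open>The element \<open>J\<close> under homomorphisms\<close>

lemma tensor_lift_commute:
  fixes y :: "'a::complex_algebra_1"
  assumes "\<And>u v. y * f u v = f u v * y"
  shows "y * tensor_lift f z = tensor_lift f z * y"
  unfolding tensor_lift_def lin_extend_def
  by (intro commute_sum) (auto intro!: commute_scaleC assms split: prod.split)

lemma clinear_mult_left: "clinear (\<lambda>x. y * (x :: 'a::complex_algebra_1))"
  by (intro clinearI) (simp_all add: distrib_left)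

lemma tensor_lift_mult_left:
  fixes y :: "'a::complex_algebra_1"
  assumes "alg_hom f" "alg_hom g"
  shows "tensor_lift (\<lambda>u v. y * (f u * g v)) z = y * tensor_lift (\<lambda>u v. f u * g v) z"
  by (rule clinear_tensor_lift_commute[OF clinear_mult_left, symmetric])
    (intro cbilinear_compose[OF cbilinear_mult] alg_hom_clinear assms)

text \<open>The nested \<open>tensor_lift\<close> is rewritten as an iterated product of two
  commuting homomorphisms, so the two-factor universal property applies twice.\<close>

lemma triple_hom:
  fixes p :: "'u::complex_algebra_1 \<Rightarrow> 'a::complex_algebra_1" and q :: "'v::complex_algebra_1 \<Rightarrow> 'a"
    and r :: "'w::complex_algebra_1 \<Rightarrow> 'a"
  assumes hom: "alg_hom p" "alg_hom q" "alg_hom r"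
    and comm: "\<And>u v. p u * q v = q v * p u" "\<And>u w. p u * r w = r w * p u" "\<And>v w. q v * r w = r w * q v"
  shows "alg_hom (tensor_lift (\<lambda>u. tensor_lift (\<lambda>v w. p u * q v * r w)))" (is "alg_hom ?h")
    and "tensor_lift (\<lambda>u. tensor_lift (\<lambda>v w. p u * q v * r w)) (u \<otimes> v \<otimes> w) = p u * q v * r w"
proof -
  let ?g = "tensor_lift (\<lambda>v w. q v * r w)"
  have "tensor_lift (\<lambda>v w. p u * q v * r w) = (\<lambda>z. p u * ?g z)" for u
    by (rule ext) (simp add: mult.assoc tensor_lift_mult_left[OF hom(2,3)])
  then have eq: "?h = tensor_lift (\<lambda>u z. p u * ?g z)" by simp
  note g = alg_hom_tensor_lift_mult[OF hom(2,3) comm(3)]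
  have "p u * ?g z = ?g z * p u" for u z
    by (intro tensor_lift_commute commute_mult comm)
  note h = alg_hom_tensor_lift_mult[OF hom(1) g(1) this]
  show "alg_hom ?h" unfolding eq by (rule h(1))
  show "?h (u \<otimes> v \<otimes> w) = p u * q v * r w" unfolding eq by (simp add: h(2) g(2) mult.assoc)
qed

lemma quadruple_hom:
  fixes o' :: "'t::complex_algebra_1 \<Rightarrow> 'a::complex_algebra_1" and p :: "'u::complex_algebra_1 \<Rightarrow> 'a"
    and q :: "'v::complex_algebra_1 \<Rightarrow> 'a" and r :: "'w::complex_algebra_1 \<Rightarrow> 'a"
  assumes hom: "alg_hom o'" "alg_hom p" "alg_hom q" "alg_hom r"
    and comm: "\<And>s u. o' s * p u = p u * o' s" "\<And>s v. o' s * q v = q v * o' s" "\<And>s w. o' s * r w = r w * o' s"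
      "\<And>u v. p u * q v = q v * p u" "\<And>u w. p u * r w = r w * p u" "\<And>v w. q v * r w = r w * q v"
  shows "alg_hom (tensor_lift (\<lambda>s. tensor_lift (\<lambda>u. tensor_lift (\<lambda>v w. o' s * p u * q v * r w))))"
      (is "alg_hom ?h")
    and "tensor_lift (\<lambda>s. tensor_lift (\<lambda>u. tensor_lift (\<lambda>v w. o' s * p u * q v * r w))) (s \<otimes> u \<otimes> v \<otimes> w) =
      o' s * p u * q v * r w"
proof -
  let ?k = "tensor_lift (\<lambda>v w. q v * r w)"
  let ?g = "tensor_lift (\<lambda>u z. p u * ?k z)"
  note k = alg_hom_tensor_lift_mult[OF hom(3,4) comm(6)]
  have "p u * ?k z = ?k z * p u" for u z
    by (intro tensor_lift_commute commute_mult comm)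
  note g = alg_hom_tensor_lift_mult[OF hom(2) k(1) this]
  have "tensor_lift (\<lambda>v w. o' s * p u * q v * r w) = (\<lambda>z. o' s * (p u * ?k z))" for s u
    by (rule ext) (simp only: mult.assoc[of "o' s * p u"] tensor_lift_mult_left[OF hom(3,4)], simp only: mult.assoc)
  moreover have "tensor_lift (\<lambda>u z. o' s * (p u * ?k z)) = (\<lambda>z. o' s * ?g z)" for s
    by (rule ext) (simp add: tensor_lift_mult_left[OF hom(2) k(1)])
  ultimately have eq: "?h = tensor_lift (\<lambda>s z. o' s * ?g z)" by simp
  have "o' s * ?g z = ?g z * o' s" for s z
    by (intro tensor_lift_commute commute_mult comm)
  note h = alg_hom_tensor_lift_mult[OF hom(1) g(1) this]
  show "alg_hom ?h" unfolding eq by (rule h(1))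
  show "?h (s \<otimes> u \<otimes> v \<otimes> w) = o' s * p u * q v * r w"
    unfolding eq by (simp add: h(2) g(2) k(2) mult.assoc)
qed

lemma alg_hom_places3:
  "alg_hom (\<lambda>u. u \<otimes> 1 \<otimes> 1)" "alg_hom (\<lambda>u. 1 \<otimes> u \<otimes> 1)" "alg_hom (\<lambda>u. 1 \<otimes> 1 \<otimes> u)"
  using alg_hom_tens_left[where ?'b = "'b \<otimes> 'c"]
    alg_hom_compose[OF alg_hom_tens_left alg_hom_tens_right] alg_hom_compose[OF alg_hom_tens_right alg_hom_tens_right]
  by (simp_all add: one_tensor_def)

lemma alg_hom_places4:
  "alg_hom (\<lambda>u. u \<otimes> 1 \<otimes> 1 \<otimes> 1)" "alg_hom (\<lambda>u. 1 \<otimes> u \<otimes> 1 \<otimes> 1)" "alg_hom (\<lambda>u. 1 \<otimes> 1 \<otimes> u \<otimes> 1)"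
  "alg_hom (\<lambda>u. 1 \<otimes> 1 \<otimes> 1 \<otimes> u)"
  using alg_hom_tens_left[where ?'b = "'b \<otimes> 'c \<otimes> 'd"]
    alg_hom_compose[OF alg_hom_places3(1) alg_hom_tens_right]
    alg_hom_compose[OF alg_hom_places3(2) alg_hom_tens_right]
    alg_hom_compose[OF alg_hom_places3(3) alg_hom_tens_right]
  by (simp_all add: one_tensor_def)

lemma alg_hom_iota_clinear: "alg_hom f \<Longrightarrow> clinear (\<lambda>a. f (\<iota> a))"
  by (rule clinear_compose[OF clinear_iota alg_hom_clinear])

lemma fps_image_associator_element:
  assumes H: "alg_hom H"
  shows "fps_image H (associator_element \<Phi> t) =
    nc_eval \<Phi> (pairing (\<lambda>a. H (\<iota> a \<otimes> 1 \<otimes> 1)) (\<lambda>a. H (1 \<otimes> \<iota> a \<otimes> 1)) t)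
      (pairing (\<lambda>a. H (1 \<otimes> \<iota> a \<otimes> 1)) (\<lambda>a. H (1 \<otimes> 1 \<otimes> \<iota> a)) t)"
  by (simp add: associator_element_def fps_image_nc_eval[OF H] insert_pair_pairing
      alg_hom_pairing[OF H] alg_hom_iota_clinear[OF alg_hom_places3(1)]
      alg_hom_iota_clinear[OF alg_hom_places3(2)] alg_hom_iota_clinear[OF alg_hom_places3(3)])

lemma insert_triple_associator_element:
  assumes "alg_hom p" "alg_hom q" "alg_hom r"
    and "\<And>u v. p u * q v = q v * p u" "\<And>u w. p u * r w = r w * p u" "\<And>v w. q v * r w = r w * q v"
  shows "fps_image (insert_triple p q r) (associator_element \<Phi> t) =
    nc_eval \<Phi> (pairing (\<lambda>a. p (\<iota> a)) (\<lambda>a. q (\<iota> a)) t) (pairing (\<lambda>a. q (\<iota> a)) (\<lambda>a. r (\<iota> a)) t)"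
proof -
  note h = triple_hom[OF assms, folded insert_triple_def]
  show ?thesis
    by (simp add: fps_image_associator_element[OF h(1)] h(2) alg_hom_one assms(1-3))
qed

text \<open>The embedding of \<open>U\<gg>\<close> into two slots at once, as in the multi-index \<open>34\<close>.\<close>

lemma double_place:
  fixes p q :: "'g::lie_algebra uea \<Rightarrow> 'a::complex_algebra_1"
  assumes p: "alg_hom p" and q: "alg_hom q" and comm: "\<And>u v. p u * q v = q v * p u"
  shows "alg_hom (\<lambda>u. tensor_lift (\<lambda>v w. p v * q w) (\<Delta> u))"
    and "tensor_lift (\<lambda>v w. p v * q w) (\<Delta> (\<iota> a)) = p (\<iota> a) + q (\<iota> a)"
proof -
  note h = alg_hom_tensor_lift_mult[OF p q comm]
  show "alg_hom (\<lambda>u. tensor_lift (\<lambda>v w. p v * q w) (\<Delta> u))"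
    by (rule alg_hom_compose[OF alg_hom_coproduct h(1)])
  show "tensor_lift (\<lambda>v w. p v * q w) (\<Delta> (\<iota> a)) = p (\<iota> a) + q (\<iota> a)"
    by (simp add: coproduct_iota alg_hom_add[OF h(1)] h(2) alg_hom_one[OF p] alg_hom_one[OF q])
qed

text \<open>A multi-index becomes a block: the coproduct placed in slots 2 and 4 is sent on
  generators to E K + E M = E (K \<union> M). Hence every evaluation of the element is an instance
  of \<open>J\<close>.\<close>

lemma (in slots) fps_image_J_element:
  assumes \<psi>: "alg_hom \<psi>"
    and E: "\<And>a. \<psi> (\<iota> a \<otimes> 1 \<otimes> 1 \<otimes> 1) = E I a" "\<And>a. \<psi> (1 \<otimes> \<iota> a \<otimes> 1 \<otimes> 1) = E K a"
      "\<And>a. \<psi> (1 \<otimes> 1 \<otimes> \<iota> a \<otimes> 1) = E L a" "\<And>a. \<psi> (1 \<otimes> 1 \<otimes> 1 \<otimes> \<iota> a) = E M a"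
    and fin: "finite I" "finite K" "finite L" "finite M"
    and disj: "K \<inter> M = {}" "L \<inter> M = {}"
  shows "fps_image \<psi> (J_element \<Phi> t) = J I K L M"
proof -
  let ?s1 = "\<lambda>u :: 'g uea. u \<otimes> (1 :: 'g uea) \<otimes> (1 :: 'g uea) \<otimes> (1 :: 'g uea)"
  let ?s2 = "\<lambda>u :: 'g uea. (1 :: 'g uea) \<otimes> u \<otimes> (1 :: 'g uea) \<otimes> (1 :: 'g uea)"
  let ?s3 = "\<lambda>u :: 'g uea. (1 :: 'g uea) \<otimes> (1 :: 'g uea) \<otimes> u \<otimes> (1 :: 'g uea)"
  let ?s4 = "\<lambda>u :: 'g uea. (1 :: 'g uea) \<otimes> (1 :: 'g uea) \<otimes> (1 :: 'g uea) \<otimes> u"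
  let ?s24 = "\<lambda>u. tensor_lift (\<lambda>v w. ?s2 v * ?s4 w) (\<Delta> u)"
  let ?s34 = "\<lambda>u. tensor_lift (\<lambda>v w. ?s3 v * ?s4 w) (\<Delta> u)"
  have c: "?s1 u * ?s2 v = ?s2 v * ?s1 u" "?s1 u * ?s3 v = ?s3 v * ?s1 u" "?s1 u * ?s4 v = ?s4 v * ?s1 u"
    "?s2 u * ?s3 v = ?s3 v * ?s2 u" "?s2 u * ?s4 v = ?s4 v * ?s2 u" "?s3 u * ?s4 v = ?s4 v * ?s3 u" for u v
    by (simp_all add: times_tens_tens)
  note d24 = double_place[OF alg_hom_places4(2,4) c(5)] and d34 = double_place[OF alg_hom_places4(3,4) c(6)]
  have c24: "?s1 u * ?s24 v = ?s24 v * ?s1 u" "?s3 u * ?s24 v = ?s24 v * ?s3 u" for u v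
    by (intro tensor_lift_commute commute_mult c c(4)[symmetric])+
  have c34: "?s1 u * ?s34 v = ?s34 v * ?s1 u" "?s2 u * ?s34 v = ?s34 v * ?s2 u" for u v
    by (intro tensor_lift_commute commute_mult c)+
  note ins = insert_triple_associator_element
  note phi = ins[OF alg_hom_places4(1) alg_hom_places4(3) d24(1) c(2) c24]
    ins[OF alg_hom_places4(3) alg_hom_places4(2) alg_hom_places4(4) c(4)[symmetric] c(6) c(5)]
    ins[OF alg_hom_places4(2) alg_hom_places4(3) alg_hom_places4(4) c(4) c(5) c(6)]
    ins[OF alg_hom_places4(1) alg_hom_places4(2) d34(1) c(1) c34]
  note lin = alg_hom_iota_clinear[OF alg_hom_places4(1)] alg_hom_iota_clinear[OF alg_hom_places4(2)]
    alg_hom_iota_clinear[OF alg_hom_places4(3)] alg_hom_iota_clinear[OF alg_hom_places4(4)]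
  have lin2: "clinear (\<lambda>a. ?s2 (\<iota> a) + ?s4 (\<iota> a))" "clinear (\<lambda>a. ?s3 (\<iota> a) + ?s4 (\<iota> a))"
    using lin by (auto intro!: clinearI simp: clinear_add clinear_scale iota_add iota_scaleC
        tens_add_left tens_add_right tens_scaleC_left tens_scaleC_right scaleC_add_right)
  show ?thesis
    unfolding J_element_def Let_def phi d24(2) d34(2) J_def B_def P_def R_def T_def
    by (simp add: fps_image_mult[OF \<psi>] fps_image_nc_eval[OF \<psi>] fps_image_hexp[OF \<psi>]
        fps_image_inverse[OF \<psi>] nc_eval_nth_0 assoc_nil alg_hom_scale[OF \<psi>] insert_pair_pairing
        alg_hom_pairing[OF \<psi>] lin lin2 E alg_hom_add[OF \<psi>] E_Un fin disj mult.assoc)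
qed

subsection \<open>Several copies of \<open>\<gg> \<oplus> \<gg> \<oplus> \<hh>\<close>\<close>

lemma clinear_fst: "clinear fst" and clinear_snd: "clinear snd"
  by (auto intro!: clinearI simp: scaleC_prod_def)

lemma clinear_Pair: "clinear f \<Longrightarrow> clinear g \<Longrightarrow> clinear (\<lambda>x. (f x, g x))"
  by (auto intro!: clinearI simp: scaleC_prod_def clinear_add clinear_scale)

lemma clinear_ident: "clinear (\<lambda>x. x)" and clinear_zero: "clinear (\<lambda>x. 0)"
  by (auto intro!: clinearI)

lemma bracket_zero [simp]: "bracket 0 x = 0" "bracket x 0 = (0 :: 'g::lie_algebra)"
  using bracket_scaleC_left[of 0 0 x] bracket_scaleC_right[of x 0 0] by simp_all

lemma lie_hom_inclusions:
  "lie_hom (\<lambda>a. (a, 0))" "lie_hom (\<lambda>b. (0, b))"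
  by (simp_all add: lie_hom_def bracket_prod_def clinear_Pair clinear_ident clinear_zero)

lemma lie_hom_compose: "lie_hom f \<Longrightarrow> lie_hom g \<Longrightarrow> lie_hom (\<lambda>x. g (f x))"
  by (simp add: lie_hom_def clinear_compose)

lemma lie_hom_into_compose: "lie_hom f \<Longrightarrow> lie_hom_into g \<Longrightarrow> lie_hom_into (\<lambda>x. g (f x))"
  by (simp add: lie_hom_def lie_hom_into_def clinear_compose)

text \<open>The sum tensor has no mixed component, so no cross terms between the two summands
  appear.\<close>

lemma pairing_sum_tensor:
  fixes S S' :: "'g::lie_algebra \<times> 'h::lie_algebra \<Rightarrow> 'a::complex_algebra_1"
  assumes "clinear S" "clinear S'"
  shows "pairing S S' (sum_tensor t t') =
    pairing (\<lambda>a. S (a, 0)) (\<lambda>a. S' (a, 0)) t + pairing (\<lambda>b. S (0, b)) (\<lambda>b. S' (0, b)) t'"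
  unfolding sum_tensor_def clinear_add[OF clinear_pairing[OF assms]]
  unfolding pairing_def
  by (simp add: tensor_lift_tensor_map cbilinear_pairing assms clinear_Pair clinear_ident clinear_zero)

text \<open>The index runs over tensor factors, \<open>S k\<close> being the Lie algebra acting in
  factor \<open>k\<close>. Each factor carries two strands, \<open>(k, True)\<close> and
  \<open>(k, False)\<close> for the two summands \<gg>, together with a part from \<hh> that is kept
  apart as \<open>hpart\<close>.\<close>

locale copies =
  fixes S :: "'k \<Rightarrow> 'g::lie_algebra \<times> 'g \<times> 'h::lie_algebra \<Rightarrow> 'a::complex_algebra_1"
    and t :: "'g \<otimes> 'g" and t' :: "'h \<otimes> 'h" and \<Phi> :: nc_series
  assumes lie_S: "lie_hom_into (S k)"
    and comm_S: "k \<noteq> l \<Longrightarrow> S k x * S l y = S l y * S k x"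
    and invariant: "invariant_symmetric t"
    and drinfeld: "drinfeld_associator \<Phi>"
begin

definition strand :: "'k \<times> bool \<Rightarrow> 'g \<Rightarrow> 'a"
  where "strand i a = S (fst i) (if snd i then (a, 0, 0) else (0, a, 0))"

lemma S_commute_orthogonal: "bracket x y = 0 \<Longrightarrow> S k x * S l y = S l y * S k x"
proof (cases "k = l")
  case True
  assume "bracket x y = 0"
  moreover have "S l (bracket x y) = S l x * S l y - S l y * S l x" "clinear (S l)"
    using lie_S[of l] unfolding lie_hom_into_def by blast+
  ultimately show ?thesis by (simp add: True clinear_0)
qed (rule comm_S)

lemma S_clinear: "clinear (S k)"
  using lie_S[of k] by (simp add: lie_hom_into_def)

sublocale slots strand t \<Phi>
proof
  show "lie_hom_into (strand i)" for i
  proof (cases "snd i")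
    case True
    then have "strand i = (\<lambda>a. S (fst i) (a, 0))"
      by (simp add: fun_eq_iff strand_def zero_prod_def)
    then show ?thesis using lie_hom_into_compose[OF lie_hom_inclusions(1) lie_S] by simp
  next
    case False
    then have "strand i = (\<lambda>a. S (fst i) (0, a, 0))"
      by (simp add: fun_eq_iff strand_def)
    then show ?thesis
      using lie_hom_into_compose[OF lie_hom_compose[OF lie_hom_inclusions(1) lie_hom_inclusions(2)] lie_S] by simp
  qed
  show "strand i a * strand j b = strand j b * strand i a" if "i \<noteq> j" for i j a b
  proof (cases "fst i = fst j")
    case True
    with that have "snd i \<noteq> snd j" by (auto simp: prod_eq_iff)
    then show ?thesis
      unfolding strand_def by (intro S_commute_orthogonal) (auto simp: bracket_prod_def zero_prod_def)
  qed (simp add: strand_def comm_S)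
qed (fact invariant drinfeld)+

definition X :: "'k \<Rightarrow> ('k \<times> bool) set" where "X k = {(k, True)}"

definition Y :: "'k \<Rightarrow> ('k \<times> bool) set" where "Y k = {(k, False)}"

definition hpart :: "'k \<Rightarrow> 'h \<Rightarrow> 'a" where "hpart k b = S k (0, 0, b)"

lemma finite_XY [simp]: "finite (X k)" "finite (Y k)"
  by (simp_all add: X_def Y_def)

lemma disjoint_XY [simp]: "X k \<inter> Y l = {}" "Y k \<inter> X l = {}"
  "k \<noteq> l \<Longrightarrow> X k \<inter> X l = {}" "k \<noteq> l \<Longrightarrow> Y k \<inter> Y l = {}"
  by (simp_all add: X_def Y_def)

lemma E_XY: "E (X k) a = S k (a, 0, 0)" "E (Y k) a = S k (0, a, 0)"
  by (simp_all add: E_def X_def Y_def strand_def)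

text \<open>This is how the functor produces blocks: after restriction along
  \<open>diag_hom\<close>, an element of \<gg> acts through both strands of the factor at
  once.\<close>

lemma E_diag: "S k (a, a, b) = E (X k \<union> Y k) a + hpart k b"
proof -
  have "(a, a, b) = (a, 0, 0) + ((0, a, 0) + (0, 0, b))" by simp
  then have "S k (a, a, b) = S k (a, 0, 0) + (S k (0, a, 0) + S k (0, 0, b))"
    by (metis clinear_add S_clinear)
  then show ?thesis by (simp add: E_Un E_XY hpart_def)
qed

section \<open>Splitting off the third Lie algebra\<close>

lemma hpart_strand: "hpart k b * strand i a = strand i a * hpart k b"
  unfolding hpart_def strand_def
  by (rule S_commute_orthogonal) (simp add: bracket_prod_def zero_prod_def)

lemma hpart_E: "hpart k b * E I a = E I a * hpart k b"
  unfolding E_def by (intro commute_sum hpart_strand)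

lemma hpart_T: "hpart k b * T I K = T I K * hpart k b"
  unfolding T_def by (intro pairing_commute hpart_E)

definition H :: "'k \<Rightarrow> 'k \<Rightarrow> 'k \<Rightarrow> 'a fps"
  where "H k l m = nc_eval \<Phi> (pairing (hpart k) (hpart l) t') (pairing (hpart l) (hpart m) t')"

lemma hpairing_T: "T I K * pairing (hpart k) (hpart l) t' = pairing (hpart k) (hpart l) t' * T I K"
  by (intro pairing_commute hpart_T[symmetric])

lemma hpairing_P: "commutes_const (pairing (hpart k) (hpart l) t') (P I K L)"
  unfolding P_def by (intro commutes_const_nc_eval hpairing_T[symmetric])

lemma hpairing_J: "commutes_const (pairing (hpart k) (hpart l) t') (J I K L M)"
  unfolding J_def B_def R_def
  by (intro commutes_const_mult commutes_const_inverse commutes_const_hexp hpairing_P P_nth_0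
      commute_scaleC hpairing_T[symmetric])

lemma J_H_commute: "J I K L M * H k l m = H k l m * J I K L M"
  unfolding H_def by (intro commute_nc_eval hpairing_J)

lemma clinear_hpart: "clinear (hpart k)"
  unfolding hpart_def
  by (rule clinear_compose[OF _ S_clinear]) (intro clinear_Pair clinear_zero clinear_ident)

lemma group_like_\<Phi>: "group_like \<Phi>"
  using drinfeld by (simp add: drinfeld_associator_def)

lemma T_T_commute:
  "finite M \<Longrightarrow> finite N \<Longrightarrow> I \<inter> K = {} \<Longrightarrow> (I \<union> K) \<inter> (M \<union> N) = {} \<Longrightarrow> T I K * T M N = T M N * T I K"
  unfolding T_def[of M] by (intro pairing_commute E_T_commute[symmetric]) auto

text \<open>The chosen tensor of \<gg> \<oplus> \<gg> \<oplus> \<hh> gives a sum of three mutually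
  commuting pairings, and group-likeness is applied twice.\<close>

lemma associator_split:
  assumes "k \<noteq> l" "l \<noteq> m" "k \<noteq> m"
  shows "nc_eval \<Phi> (pairing (S k) (S l) (sum_tensor t (sum_tensor t t')))
      (pairing (S l) (S m) (sum_tensor t (sum_tensor t t'))) =
    P (X k) (X l) (X m) * P (Y k) (Y l) (Y m) * H k l m"
proof -
  have pair: "pairing (S k) (S l) (sum_tensor t (sum_tensor t t')) =
      (T (X k) (X l) + T (Y k) (Y l)) + pairing (hpart k) (hpart l) t'" for k l
  proof -
    have "clinear (\<lambda>x. S k (0, x))" for k
      by (intro clinear_compose[OF _ S_clinear] clinear_Pair clinear_zero clinear_ident)
    then show ?thesis
      by (simp add: pairing_sum_tensor S_clinear T_def E_XY[abs_def] hpart_def[abs_def] zero_prod_def add.assoc)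
  qed
  have comm: "T (X k') (X l') * T (Y k'') (Y l'') = T (Y k'') (Y l'') * T (X k') (X l')"
    if "k' \<noteq> l'" for k' l' k'' l''
    using that by (intro T_T_commute) (auto simp: X_def Y_def)
  have "nc_eval \<Phi> ((T (X k) (X l) + T (Y k) (Y l)) + pairing (hpart k) (hpart l) t')
      ((T (X l) (X m) + T (Y l) (Y m)) + pairing (hpart l) (hpart m) t') =
    nc_eval \<Phi> (T (X k) (X l) + T (Y k) (Y l)) (T (X l) (X m) + T (Y l) (Y m)) * H k l m"
    unfolding H_def
    by (rule nc_eval_split[OF group_like_\<Phi>]; intro commute_add[symmetric] hpairing_T[symmetric])
  also have "nc_eval \<Phi> (T (X k) (X l) + T (Y k) (Y l)) (T (X l) (X m) + T (Y l) (Y m)) =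
      P (X k) (X l) (X m) * P (Y k) (Y l) (Y m)"
    unfolding P_def by (rule nc_eval_split[OF group_like_\<Phi>]; intro comm assms)
  finally show ?thesis unfolding pair .
qed

text \<open>In the target category the two copies of \<gg> are merged into blocks, so group-likeness
  is applied once, to separate \<hh> only.\<close>

lemma associator_diag:
  assumes "k \<noteq> l" "l \<noteq> m" "k \<noteq> m"
  shows "nc_eval \<Phi> (pairing (\<lambda>x. S k (diag_hom x)) (\<lambda>x. S l (diag_hom x)) (sum_tensor t t'))
      (pairing (\<lambda>x. S l (diag_hom x)) (\<lambda>x. S m (diag_hom x)) (sum_tensor t t')) =
    P (X k \<union> Y k) (X l \<union> Y l) (X m \<union> Y m) * H k l m"
proof -
  have diag: "clinear diag_hom"
    unfolding diag_hom_def case_prod_beta by (intro clinear_Pair clinear_fst clinear_snd)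
  have pair: "pairing (\<lambda>x. S k (diag_hom x)) (\<lambda>x. S l (diag_hom x)) (sum_tensor t t') =
      T (X k \<union> Y k) (X l \<union> Y l) + pairing (hpart k) (hpart l) t'" for k l
  proof -
    have "E I 0 = 0" if "finite I" for I
      using clinear_0[OF E_clinear[OF that]] .
    then show ?thesis
      unfolding pairing_sum_tensor[OF clinear_compose[OF diag S_clinear] clinear_compose[OF diag S_clinear]]
      by (simp add: diag_hom_def E_diag T_def clinear_0[OF clinear_hpart])
  qed
  show ?thesis
    unfolding pair H_def P_def
    by (rule nc_eval_split[OF group_like_\<Phi>]; intro hpairing_T)
qed

lemma coherence:
  assumes "k \<noteq> l" "l \<noteq> m" "k \<noteq> m"
  shows "nc_eval \<Phi> (pairing (S k) (S l) (sum_tensor t (sum_tensor t t')))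
      (pairing (S l) (S m) (sum_tensor t (sum_tensor t t'))) *
      (J (X k \<union> X l) (Y k \<union> Y l) (X m) (Y m) * J (X k) (Y k) (X l) (Y l)) =
    J (X k) (Y k) (X l \<union> X m) (Y l \<union> Y m) * (J (X l) (Y l) (X m) (Y m) *
      nc_eval \<Phi> (pairing (\<lambda>x. S k (diag_hom x)) (\<lambda>x. S l (diag_hom x)) (sum_tensor t t'))
      (pairing (\<lambda>x. S l (diag_hom x)) (\<lambda>x. S m (diag_hom x)) (sum_tensor t t')))"
proof -
  let ?J1 = "J (X k \<union> X l) (Y k \<union> Y l) (X m) (Y m)" and ?J2 = "J (X k) (Y k) (X l) (Y l)"
  \<comment> \<open>The six strands are X k, Y k, X l, Y l, X m, Y m in this order; the factor
    \<open>H\<close> is then common to both sides and is moved past the interchanges.\<close>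
  have hex: "P (X k) (X l) (X m) * P (Y k) (Y l) (Y m) * (?J1 * ?J2) =
    J (X k) (Y k) (X l \<union> X m) (Y l \<union> Y m) * (J (X l) (Y l) (X m) (Y m) *
      P (X k \<union> Y k) (X l \<union> Y l) (X m \<union> Y m))"
    by (rule J_hexagon) (use assms in simp_all)
  have "P (X k) (X l) (X m) * P (Y k) (Y l) (Y m) * H k l m * (?J1 * ?J2) =
      P (X k) (X l) (X m) * P (Y k) (Y l) (Y m) * (?J1 * ?J2) * H k l m"
    by (simp add: mult.assoc J_H_commute commute_left[OF J_H_commute[symmetric]])
  also have "\<dots> = J (X k) (Y k) (X l \<union> X m) (Y l \<union> Y m) * (J (X l) (Y l) (X m) (Y m) *
      (P (X k \<union> Y k) (X l \<union> Y l) (X m \<union> Y m) * H k l m))"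
    by (simp only: hex; simp only: mult.assoc)
  finally show ?thesis
    by (simp only: associator_split[OF assms] associator_diag[OF assms])
qed

text \<open>The diagonal element is the sum over all four strands supporting \<open>J\<close>, for
  which locality gives commutation, plus parts from \<hh>, which commute with every strand. This is
  what makes the coherence map a module morphism.\<close>

lemma J_diag_commute:
  assumes "k \<noteq> l"
  shows "fps_nth (J (X k) (Y k) (X l) (Y l)) n * (S k (a, a, b) + S l (a, a, b)) =
    (S k (a, a, b) + S l (a, a, b)) * fps_nth (J (X k) (Y k) (X l) (Y l)) n"
proof -
  have "supported (X k \<union> Y k \<union> (X l \<union> Y l)) (J (X k) (Y k) (X l) (Y l))"
    by (rule supported_J) (use assms in auto)
  then have "E (X k \<union> Y k \<union> (X l \<union> Y l)) a * fps_nth (J (X k) (Y k) (X l) (Y l)) n =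
      fps_nth (J (X k) (Y k) (X l) (Y l)) n * E (X k \<union> Y k \<union> (X l \<union> Y l)) a"
    by (rule supportedD) auto
  moreover have "S k (a, a, b) + S l (a, a, b) = E (X k \<union> Y k \<union> (X l \<union> Y l)) a + (hpart k b + hpart l b)"
    using assms by (simp add: E_diag E_Un Int_Un_distrib Int_Un_distrib2)
  moreover have "commutes_const (hpart k' b) (J (X k) (Y k) (X l) (Y l))" for k'
    unfolding J_def B_def R_def P_def
    by (intro commutes_const_mult commutes_const_inverse commutes_const_hexp commutes_const_nc_eval
      commute_scaleC hpart_T) (simp_all add: nc_eval_nth_0 assoc_nil)
  ultimately show ?thesis
    by (simp add: commutes_const_def distrib_left distrib_right)
qed

end

subsection \<open>Actions on tensor products\<close>

text \<open>The notion of \<open>uea_module\<close> for an arbitrary algebra, since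
  \<open>tensor_action\<close> is an action of a tensor product of enveloping algebras.\<close>

definition alg_action :: "('u::complex_algebra_1 \<Rightarrow> 'x::complex_vector \<Rightarrow> 'x) \<Rightarrow> bool"
  where "alg_action \<rho> \<longleftrightarrow> cbilinear \<rho> \<and> \<rho> 1 = id \<and> (\<forall>u v. \<rho> (u * v) = \<rho> u \<circ> \<rho> v)"

lemma uea_module_iff: "uea_module \<rho> \<longleftrightarrow> alg_action \<rho>"
  by (simp add: uea_module_def alg_action_def)

lemma alg_action_cbilinear: "alg_action \<rho> \<Longrightarrow> cbilinear \<rho>"
  and alg_action_one: "alg_action \<rho> \<Longrightarrow> \<rho> 1 x = x"
  and alg_action_mult: "alg_action \<rho> \<Longrightarrow> \<rho> (u * v) x = \<rho> u (\<rho> v x)"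
  by (simp_all add: alg_action_def)

lemma alg_action_clinear: "alg_action \<rho> \<Longrightarrow> clinear (\<rho> u)"
  and alg_action_clinear_left: "alg_action \<rho> \<Longrightarrow> clinear (\<lambda>u. \<rho> u x)"
  by (auto simp: alg_action_def cbilinear_def)

lemma alg_action_0: "alg_action \<rho> \<Longrightarrow> \<rho> 0 x = 0" "alg_action \<rho> \<Longrightarrow> \<rho> u 0 = 0"
  using clinear_0[OF alg_action_clinear] clinear_0[OF alg_action_clinear_left] by auto

lemma alg_action_sum: "alg_action \<rho> \<Longrightarrow> \<rho> (sum f I) x = (\<Sum>i\<in>I. \<rho> (f i) x)"
  by (rule clinear_sum[OF alg_action_clinear_left])

lemma alg_action_compose: "alg_action \<rho> \<Longrightarrow> alg_hom f \<Longrightarrow> alg_action (\<lambda>u. \<rho> (f u))"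
  unfolding alg_action_def
  by (auto simp: alg_hom_one alg_hom_mult intro: cbilinear_compose[OF _ alg_hom_clinear clinear_ident])

lemma cbilinear_tensor_map_action:
  assumes "cbilinear \<rho>" "cbilinear \<sigma>"
  shows "cbilinear (\<lambda>u v. tensor_map (\<rho> u) (\<sigma> v) w)"
  unfolding tensor_map_def using assms
  by (intro cbilinearI)
    (simp_all add: cbilinear_add_left cbilinear_scale_left tens_add_left tens_add_right
      tens_scaleC_left tens_scaleC_right tensor_lift_plus_fun tensor_lift_scaleC_fun)

lemma tensor_action_tens:
  "cbilinear \<rho> \<Longrightarrow> cbilinear \<sigma> \<Longrightarrow> tensor_action \<rho> \<sigma> (u \<otimes> v) w = tensor_map (\<rho> u) (\<sigma> v) w"
  unfolding tensor_action_def by (intro tensor_lift_tens cbilinear_tensor_map_action)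

lemma tensor_action_tens_tens:
  "cbilinear \<rho> \<Longrightarrow> cbilinear \<sigma> \<Longrightarrow> tensor_action \<rho> \<sigma> (u \<otimes> v) (x \<otimes> y) = \<rho> u x \<otimes> \<sigma> v y"
  by (simp add: tensor_action_tens tensor_map_tens cbilinear_right)

lemma cbilinear_tensor_action:
  assumes "cbilinear \<rho>" "cbilinear \<sigma>"
  shows "cbilinear (tensor_action \<rho> \<sigma>)"
proof -
  have left: "clinear (\<lambda>z. tensor_action \<rho> \<sigma> z w)" for w
    unfolding tensor_action_def by (intro clinear_tensor_lift cbilinear_tensor_map_action assms)
  have tm: "clinear (tensor_map (\<rho> u) (\<sigma> v))" for u v
    by (intro clinear_tensor_map cbilinear_right assms)
  have "clinear (tensor_action \<rho> \<sigma> z)" for z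
  proof (rule clinearI)
    show "tensor_action \<rho> \<sigma> z (x + y) = tensor_action \<rho> \<sigma> z x + tensor_action \<rho> \<sigma> z y" for x y
      by (induction z rule: tensor_induct)
        (simp_all add: tensor_action_tens assms clinear_add[OF tm] clinear_add[OF left])
    show "tensor_action \<rho> \<sigma> z (c *\<^sub>C x) = c *\<^sub>C tensor_action \<rho> \<sigma> z x" for c x
      by (induction z rule: tensor_induct)
        (simp_all add: tensor_action_tens assms clinear_scale[OF tm] clinear_add[OF left] scaleC_add_right)
  qed
  with left show ?thesis by (simp add: cbilinear_def)
qed

lemma cbilinear_tens_eqI:
  assumes "cbilinear f" "cbilinear g" "\<And>u v x y. f (u \<otimes> v) (x \<otimes> y) = g (u \<otimes> v) (x \<otimes> y)"
  shows "f z w = g z w"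
proof (rule clinear_eq_tensorI[OF cbilinear_left[OF assms(1)] cbilinear_left[OF assms(2)]])
  show "f (u \<otimes> v) w = g (u \<otimes> v) w" for u v
    by (rule clinear_eq_tensorI[OF cbilinear_right[OF assms(1)] cbilinear_right[OF assms(2)] assms(3)])
qed

lemma alg_action_tensor:
  assumes "alg_action \<rho>" "alg_action \<sigma>"
  shows "alg_action (tensor_action \<rho> \<sigma>)"
proof -
  have bil: "cbilinear \<rho>" "cbilinear \<sigma>"
    using assms by (simp_all add: alg_action_cbilinear)
  note B = cbilinear_tensor_action[OF bil]
  have one: "tensor_action \<rho> \<sigma> 1 w = w" for w
    by (rule clinear_eq_tensorI[OF cbilinear_right[OF B] clinear_ident])
      (simp add: one_tensor_def tensor_action_tens_tens bil alg_action_one assms)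
  have "tensor_action \<rho> \<sigma> ((u \<otimes> v) * z) w = tensor_action \<rho> \<sigma> (u \<otimes> v) (tensor_action \<rho> \<sigma> z w)" for u v z w
    by (rule cbilinear_tens_eqI)
      (simp_all add: times_tens_tens tensor_action_tens_tens bil alg_action_mult assms
        cbilinear_compose[OF B clinear_mult_left clinear_ident] clinear_cbilinear[OF B cbilinear_right[OF B]])
  then have mult: "tensor_action \<rho> \<sigma> (z' * z) w = tensor_action \<rho> \<sigma> z' (tensor_action \<rho> \<sigma> z w)" for z' z w
    by (induction z' rule: tensor_induct) (simp_all add: distrib_right cbilinear_add_left[OF B])
  show ?thesis
    by (simp add: alg_action_def B fun_eq_iff one mult)
qed

lemma tensor_action_tensor_map:
  assumes "cbilinear \<rho>" "cbilinear \<sigma>" "clinear f" "clinear g"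
  shows "tensor_action \<rho> \<sigma> (tensor_map f g z) = tensor_action (\<lambda>u. \<rho> (f u)) (\<lambda>v. \<sigma> (g v)) z"
  unfolding tensor_action_def
  by (simp add: fun_eq_iff tensor_lift_tensor_map cbilinear_tensor_map_action assms)

text \<open>Rebracketing the module and rebracketing the algebra element go together; this allows
  \<open>tensor_assoc\<close> to be moved to the end of every composite.\<close>

lemma tensor_assoc_action:
  assumes "cbilinear \<rho>" "cbilinear \<sigma>" "cbilinear \<tau>"
  shows "tensor_assoc (tensor_action (tensor_action \<rho> \<sigma>) \<tau> z w) =
    tensor_action \<rho> (tensor_action \<sigma> \<tau>) (tensor_assoc z) (tensor_assoc w)"
proof -
  note B2 = cbilinear_tensor_action[OF assms(1,2)] cbilinear_tensor_action[OF assms(2,3)]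
  note B3 = cbilinear_tensor_action[OF B2(1) assms(3)] cbilinear_tensor_action[OF assms(1) B2(2)]
  note lhs = clinear_cbilinear[OF B3(1) clinear_tensor_assoc]
  note rhs = cbilinear_compose[OF B3(2) clinear_tensor_assoc clinear_tensor_assoc]
  have 1: "tensor_assoc (tensor_action (tensor_action \<rho> \<sigma>) \<tau> (p \<otimes> u) (q \<otimes> x)) =
    tensor_action \<rho> (tensor_action \<sigma> \<tau>) (tensor_assoc (p \<otimes> u)) (tensor_assoc (q \<otimes> x))" for p u q x
    by (rule cbilinear_tens_eqI[OF
          cbilinear_compose[OF lhs cbilinear_left[OF cbilinear_tens] cbilinear_left[OF cbilinear_tens]]
          cbilinear_compose[OF rhs cbilinear_left[OF cbilinear_tens] cbilinear_left[OF cbilinear_tens]]])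
      (simp add: tensor_action_tens_tens assms B2 tensor_assoc_tens)
  show ?thesis
    by (rule cbilinear_tens_eqI[OF lhs rhs 1])
qed

subsection \<open>Morphisms of the Drinfeld category\<close>

lemma hconst_nth: "fps_nth (hconst f) n x = (if n = 0 then f x else 0)"
  by (simp add: hconst_def)

lemma hcomp_nth: "fps_nth (g \<circ>\<^sub>h f) n x = (\<Sum>i\<le>n. fps_nth g i (fps_nth f (n - i) x))"
  by (simp add: hcomp_def)

lemma hmor_eqI: "(\<And>n x. fps_nth f n x = fps_nth g n x) \<Longrightarrow> f = g"
  by (rule fps_ext) (rule ext)

lemma hconst_hcomp_nth: "fps_nth (hconst g \<circ>\<^sub>h f) n x = g (fps_nth f n x)"
proof -
  have "fps_nth (hconst g \<circ>\<^sub>h f) n x = (\<Sum>i\<in>{0}. fps_nth (hconst g) i (fps_nth f (n - i) x))"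
    unfolding hcomp_nth by (rule sum.mono_neutral_right) (auto simp: hconst_nth)
  then show ?thesis by (simp add: hconst_nth)
qed

text \<open>The higher coefficients of \<open>hconst g\<close> are zero maps, contributing terms
  \<open>fps_nth f i 0\<close>; linearity is not part of the type of morphisms, so their vanishing
  is assumed.\<close>

lemma hcomp_hconst_nth:
  assumes "\<And>n. fps_nth f n 0 = 0"
  shows "fps_nth (f \<circ>\<^sub>h hconst g) n x = fps_nth f n (g x)"
proof -
  have "fps_nth (f \<circ>\<^sub>h hconst g) n x = (\<Sum>i\<in>{n}. fps_nth f i (fps_nth (hconst g) (n - i) x))"
    unfolding hcomp_nth by (rule sum.mono_neutral_right) (auto simp: hconst_nth assms)
  then show ?thesis by (simp add: hconst_nth)
qed

text \<open>Linearity of the outermost factor carries it through the inner Cauchy sum; the rest is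
  the reindexing familiar from products of power series.\<close>

lemma hcomp_assoc:
  assumes "\<And>n. clinear (fps_nth h n)"
  shows "(h \<circ>\<^sub>h g) \<circ>\<^sub>h f = h \<circ>\<^sub>h g \<circ>\<^sub>h f"
proof (rule hmor_eqI)
  fix n x
  have "fps_nth ((h \<circ>\<^sub>h g) \<circ>\<^sub>h f) n x =
      (\<Sum>j=0..n. \<Sum>i=0..j. fps_nth h i (fps_nth g (j - i) (fps_nth f (n - j) x)))"
    by (simp add: hcomp_nth atLeast0AtMost)
  also have "\<dots> = (\<Sum>j=0..n. \<Sum>i=0..n - j. fps_nth h j (fps_nth g i (fps_nth f (n - j - i) x)))"
    by (rule fps_mult_assoc_lemma)
  also have "\<dots> = fps_nth (h \<circ>\<^sub>h g \<circ>\<^sub>h f) n x"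
    by (simp add: hcomp_nth atLeast0AtMost clinear_sum[OF assms])
  finally show "fps_nth ((h \<circ>\<^sub>h g) \<circ>\<^sub>h f) n x = fps_nth (h \<circ>\<^sub>h g \<circ>\<^sub>h f) n x" .
qed

lemma hcomp_fps_image:
  assumes "alg_action \<rho>"
  shows "fps_image \<rho> p \<circ>\<^sub>h fps_image \<rho> q = fps_image \<rho> (p * q)"
  by (rule hmor_eqI)
    (simp add: hcomp_nth fps_mult_nth alg_action_sum[OF assms] alg_action_mult[OF assms] atLeast0AtMost)

lemma hconst_hcomp_fps_image:
  assumes "\<And>z w. g (\<rho> z w) = \<sigma> (h z) (g w)" and "\<And>z. \<sigma> z 0 = 0"
  shows "hconst g \<circ>\<^sub>h fps_image \<rho> q = fps_image \<sigma> (fps_image h q) \<circ>\<^sub>h hconst g"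
  by (rule hmor_eqI) (simp add: hconst_hcomp_nth hcomp_hconst_nth assms)

lemma hcomp_fps_image_natural:
  assumes "\<And>n z w. fps_nth f n (\<rho> z w) = \<sigma> z (fps_nth f n w)"
  shows "f \<circ>\<^sub>h fps_image \<rho> q = fps_image \<sigma> q \<circ>\<^sub>h f"
proof (rule hmor_eqI)
  fix n x
  have "(\<Sum>i\<le>n. fps_nth f i (\<rho> (fps_nth q (n - i)) x)) = (\<Sum>i\<le>n. \<sigma> (fps_nth q (n - i)) (fps_nth f i x))"
    by (simp add: assms)
  also have "\<dots> = (\<Sum>i\<le>n. \<sigma> (fps_nth q i) (fps_nth f (n - i) x))"
    unfolding atLeast0AtMost[symmetric] by (subst sum.atLeastAtMost_rev) (auto intro!: sum.cong)
  finally show "fps_nth (f \<circ>\<^sub>h fps_image \<rho> q) n x = fps_nth (fps_image \<sigma> q \<circ>\<^sub>h f) n x"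
    by (simp add: hcomp_nth)
qed

lemma tensor_map_zero: "tensor_map f (\<lambda>x. 0) w = 0" "tensor_map (\<lambda>x. 0) g w = 0"
  by (simp_all add: tensor_map_def tensor_lift_def lin_extend_def case_prod_beta)

lemma tensor_map_ident: "tensor_map (\<lambda>x. x) (\<lambda>x. x) w = w"
  by (rule clinear_eq_tensorI)
    (simp_all add: clinear_tensor_map clinear_ident tensor_map_tens)

lemma hconst_nth': "fps_nth (hconst f) n = (if n = 0 then f else (\<lambda>x. 0))"
  by (simp add: hconst_def)

lemma htensor_hconst_right_nth: "fps_nth (htensor f (hconst g)) n w = tensor_map (fps_nth f n) g w"
proof -
  have "fps_nth (htensor f (hconst g)) n w =
      (\<Sum>i\<in>{n}. tensor_map (fps_nth f i) (fps_nth (hconst g) (n - i)) w)"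
    unfolding htensor_def fps_nth_Abs_fps
    by (rule sum.mono_neutral_right) (auto simp: hconst_nth' tensor_map_zero)
  then show ?thesis by (simp add: hconst_nth')
qed

lemma htensor_hconst_left_nth: "fps_nth (htensor (hconst f) g) n w = tensor_map f (fps_nth g n) w"
proof -
  have "fps_nth (htensor (hconst f) g) n w =
      (\<Sum>i\<in>{0}. tensor_map (fps_nth (hconst f) i) (fps_nth g (n - i)) w)"
    unfolding htensor_def fps_nth_Abs_fps
    by (rule sum.mono_neutral_right) (auto simp: hconst_nth' tensor_map_zero)
  then show ?thesis by (simp add: hconst_nth')
qed

lemma htensor_hid: "htensor hid hid = hid"
  by (rule hmor_eqI)
    (simp add: htensor_hconst_left_nth hconst_nth' tensor_map_zero tensor_map_ident)

lemma htensor_fps_image: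
  assumes "alg_action \<rho>" "alg_action \<sigma>"
  shows "htensor (fps_image \<rho> p) hid = fps_image (tensor_action \<rho> \<sigma>) (fps_image (\<lambda>u. u \<otimes> 1) p)"
    and "htensor hid (fps_image \<sigma> q) = fps_image (tensor_action \<rho> \<sigma>) (fps_image (\<lambda>v. 1 \<otimes> v) q)"
proof -
  have "\<rho> 1 = (\<lambda>x. x)" "\<sigma> 1 = (\<lambda>x. x)"
    using assms by (auto simp: alg_action_def)
  then show "htensor (fps_image \<rho> p) hid = fps_image (tensor_action \<rho> \<sigma>) (fps_image (\<lambda>u. u \<otimes> 1) p)"
    "htensor hid (fps_image \<sigma> q) = fps_image (tensor_action \<rho> \<sigma>) (fps_image (\<lambda>v. 1 \<otimes> v) q)"
    by (auto intro!: hmor_eqI simp: htensor_hconst_left_nth htensor_hconst_right_nth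
        tensor_action_tens alg_action_cbilinear assms)
qed

subsection \<open>The coherence maps\<close>

text \<open>Absorbs the passage to \<gg> \<oplus> \<gg> \<oplus> \<hh> into the algebra element, so
  that \<open>J_mor\<close> is the \<open>tensor_action\<close> of a series and composition of
  morphisms becomes multiplication.\<close>

definition J_slots ::
    "'g::lie_algebra uea \<otimes> 'g uea \<otimes> 'g uea \<otimes> 'g uea \<Rightarrow>
      ('g \<times> 'g \<times> 'h::lie_algebra) uea \<otimes> ('g \<times> 'g \<times> 'h) uea"
  where "J_slots z = (let res = uea_map (\<lambda>(a, b). (a, b, 0)) in tensor_map res res (group_slots z))"

lemma uea_commute:
  assumes "alg_hom f" "alg_hom g" "\<And>a b. f (\<iota> a) * g (\<iota> b) = g (\<iota> b) * f (\<iota> a)"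
  shows "f u * g v = g v * f u"
proof -
  have "g (\<iota> b) * f u = f u * g (\<iota> b)" for b
    by (induction u rule: uea_induct)
      (simp_all add: assms(3) alg_hom_simps[OF assms(1)] commute_add commute_mult)
  then show ?thesis
    by (induction v rule: uea_induct)
      (simp_all add: alg_hom_simps[OF assms(2)] commute_add commute_mult)
qed

lemma iota_commute: "bracket a b = 0 \<Longrightarrow> \<iota> a * \<iota> b = \<iota> b * \<iota> a"
  using iota_bracket[of a b] by (simp add: iota_0)

lemma
  fixes u1 u2 u3 u4 :: "'a::lie_algebra uea"
  shows alg_hom_group_slots: "alg_hom (group_slots :: 'a uea \<otimes> 'a uea \<otimes> 'a uea \<otimes> 'a uea \<Rightarrow> _)"
    and group_slots_tens: "group_slots (u1 \<otimes> u2 \<otimes> u3 \<otimes> u4) =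
      (uea_map (\<lambda>a. (a, 0)) u1 * uea_map (\<lambda>a. (0, a)) u2) \<otimes>
      (uea_map (\<lambda>a. (a, 0)) u3 * uea_map (\<lambda>a. (0, a)) u4)"
proof -
  let ?i = "uea_map (\<lambda>a :: 'a. (a, 0 :: 'a))" and ?j = "uea_map (\<lambda>a :: 'a. (0 :: 'a, a))"
  note hom = lie_hom_inclusions[THEN alg_hom_uea_map]
  have c: "?i u * ?j v = ?j v * ?i u" for u v
    by (rule uea_commute[OF hom])
      (simp add: lie_hom_inclusions uea_map_iota iota_commute bracket_prod_def zero_prod_def)
  have comm: "(?i u \<otimes> 1) * (?j v \<otimes> 1) = (?j v \<otimes> 1) * (?i u \<otimes> (1 :: ('a \<times> 'a) uea))"
    "((1 :: ('a \<times> 'a) uea) \<otimes> ?i u) * (1 \<otimes> ?j v) = (1 \<otimes> ?j v) * (1 \<otimes> ?i u)"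
    "(x \<otimes> 1) * (1 \<otimes> y) = (1 \<otimes> y) * (x \<otimes> 1)" for u v and x y :: "('a \<times> 'a) uea"
    by (simp_all only: times_tens_tens c mult_1_left mult_1_right)
  note q = quadruple_hom[OF alg_hom_compose[OF hom(1) alg_hom_tens_left] alg_hom_compose[OF hom(2) alg_hom_tens_left]
      alg_hom_compose[OF hom(1) alg_hom_tens_right] alg_hom_compose[OF hom(2) alg_hom_tens_right]
      comm(1) comm(3) comm(3) comm(3) comm(3) comm(2)]
  show "alg_hom (group_slots :: 'a uea \<otimes> 'a uea \<otimes> 'a uea \<otimes> 'a uea \<Rightarrow> _)"
    using q(1) by (simp add: group_slots_def Let_def times_tens_tens)
  show "group_slots (u1 \<otimes> u2 \<otimes> u3 \<otimes> u4) = (?i u1 * ?j u2) \<otimes> (?i u3 * ?j u4)"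
    using q(2) by (simp add: group_slots_def Let_def times_tens_tens)
qed

lemma lie_hom_res: "lie_hom (\<lambda>(a, b). (a, b, 0))"
  by (auto simp: lie_hom_def bracket_prod_def scaleC_prod_def intro!: clinearI)

lemma lie_hom_diag: "lie_hom diag_hom"
  by (auto simp: lie_hom_def diag_hom_def bracket_prod_def scaleC_prod_def intro!: clinearI)

lemma alg_hom_J_slots: "alg_hom J_slots"
  unfolding J_slots_def Let_def
  by (rule alg_hom_compose[OF alg_hom_group_slots alg_hom_tensor_map]) (rule alg_hom_uea_map[OF lie_hom_res])+

lemma J_slots_iota:
  "J_slots (\<iota> a \<otimes> 1 \<otimes> 1 \<otimes> 1) = \<iota> (a, 0, 0) \<otimes> 1" "J_slots (1 \<otimes> \<iota> a \<otimes> 1 \<otimes> 1) = \<iota> (0, a, 0) \<otimes> 1"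
  "J_slots (1 \<otimes> 1 \<otimes> \<iota> a \<otimes> 1) = 1 \<otimes> \<iota> (a, 0, 0)" "J_slots (1 \<otimes> 1 \<otimes> 1 \<otimes> \<iota> a) = 1 \<otimes> \<iota> (0, a, 0)"
  unfolding J_slots_def Let_def group_slots_tens
  by (simp_all add: tensor_map_tens alg_hom_clinear alg_hom_uea_map lie_hom_res lie_hom_inclusions
      alg_hom_one uea_map_iota)

lemma J_mor_fps_image:
  assumes "alg_action \<rho>" "alg_action \<sigma>"
  shows "J_mor \<Phi> t \<rho> \<sigma> = fps_image (tensor_action \<rho> \<sigma>) (fps_image J_slots (J_element \<Phi> t))"
  by (simp add: J_mor_def Let_def fps_image_fps_image J_slots_def tensor_action_tensor_map
      alg_action_cbilinear assms alg_hom_clinear alg_hom_uea_map lie_hom_res)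

section \<open>Placements of J in tensor powers\<close>

text \<open>Covers all placements at once: a coproduct in one factor corresponds to a two-element
  \<open>A\<close> or \<open>B\<close>, a counit to an empty one.\<close>

lemma J_element_places:
  fixes S :: "'k \<Rightarrow> 'g::lie_algebra \<times> 'g \<times> 'h::lie_algebra \<Rightarrow> 'a::complex_algebra_1"
  assumes S: "copies S t \<Phi>"
    and h: "alg_hom h" "\<And>x. h (\<iota> x \<otimes> 1) = (\<Sum>k\<in>A. S k x)" "\<And>x. h (1 \<otimes> \<iota> x) = (\<Sum>k\<in>B. S k x)"
    and fin: "finite A" "finite B" "A \<inter> B = {}"
  shows "fps_image h (fps_image J_slots (J_element \<Phi> t)) =
    slots.J (copies.strand S) t \<Phi> (A \<times> {True}) (A \<times> {False}) (B \<times> {True}) (B \<times> {False})"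
proof -
  \<comment> \<open>The 0 is a placeholder for the tensor on \<hh>; \<open>J\<close> is built from
    \<open>t\<close> alone.\<close>
  interpret copies S t 0 \<Phi> by (rule S)
  have E: "E (A \<times> {True}) a = (\<Sum>k\<in>A. S k (a, 0, 0))" "E (A \<times> {False}) a = (\<Sum>k\<in>A. S k (0, a, 0))"
    if "finite A" for A a
    using sum.cartesian_product[of "\<lambda>k p. strand (k, p) a" "{True}" A]
      sum.cartesian_product[of "\<lambda>k p. strand (k, p) a" "{False}" A]
    by (simp_all add: E_def strand_def case_prod_beta)
  show ?thesis
    unfolding fps_image_fps_image
    by (rule fps_image_J_element)
      (use fin in \<open>auto simp: J_slots_iota h(2,3) E alg_hom_compose[OF alg_hom_J_slots h(1)]\<close>)
qed

text \<open>Extended by 0 beyond the actual factors: the zero map is a Lie homomorphism commuting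
  with everything, so the assumptions of \<open>copies\<close> hold for every natural
  number.\<close>

definition factor2 :: "nat \<Rightarrow> 'a::lie_algebra \<Rightarrow> 'a uea \<otimes> 'a uea"
  where "factor2 k x = (if k = 0 then \<iota> x \<otimes> 1 else if k = 1 then 1 \<otimes> \<iota> x else 0)"

definition factor3 :: "nat \<Rightarrow> 'a::lie_algebra \<Rightarrow> 'a uea \<otimes> 'a uea \<otimes> 'a uea"
  where "factor3 k x = (if k = 0 then \<iota> x \<otimes> 1 \<otimes> 1 else if k = 1 then 1 \<otimes> \<iota> x \<otimes> 1
    else if k = 2 then 1 \<otimes> 1 \<otimes> \<iota> x else 0)"

lemma lie_hom_into_alg_hom: "lie_hom_into f \<Longrightarrow> alg_hom g \<Longrightarrow> lie_hom_into (\<lambda>x. g (f x))"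
  unfolding lie_hom_into_def by (auto simp: alg_hom_diff alg_hom_mult intro: clinear_compose alg_hom_clinear)

lemma lie_hom_into_0: "lie_hom_into (\<lambda>x. 0)"
  by (simp add: lie_hom_into_def clinear_zero)

lemma copies_uea:
  assumes "invariant_symmetric t" "drinfeld_associator \<Phi>"
  shows "copies (\<lambda>_ :: unit. \<iota>) t \<Phi>"
  by standard (simp_all add: assms lie_hom_into_uea_gen)

lemma copies_factor2:
  assumes "invariant_symmetric t" "drinfeld_associator \<Phi>"
  shows "copies factor2 t \<Phi>"
proof
  show "lie_hom_into (factor2 k)" for k
    unfolding factor2_def
    by (cases "k = 0"; cases "k = 1")
      (simp_all add: lie_hom_into_0 lie_hom_into_alg_hom[OF lie_hom_into_uea_gen alg_hom_tens_left]
        lie_hom_into_alg_hom[OF lie_hom_into_uea_gen alg_hom_tens_right])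
qed (auto simp: factor2_def times_tens_tens assms)

lemma copies_factor3:
  assumes "invariant_symmetric t" "drinfeld_associator \<Phi>"
  shows "copies factor3 t \<Phi>"
proof
  show "lie_hom_into (factor3 k)" for k
    unfolding factor3_def
    by (cases "k = 0"; cases "k = 1"; cases "k = 2")
      (simp_all add: lie_hom_into_0 lie_hom_into_alg_hom[OF lie_hom_into_uea_gen alg_hom_places3(1)]
        lie_hom_into_alg_hom[OF lie_hom_into_uea_gen alg_hom_places3(2)]
        lie_hom_into_alg_hom[OF lie_hom_into_uea_gen alg_hom_places3(3)])
qed (auto simp: factor3_def times_tens_tens assms)

lemma coproduct_diag:
  "\<Delta> (uea_map diag_hom u) = tensor_map (uea_map diag_hom) (uea_map diag_hom) (\<Delta> u)"
proof (rule alg_hom_eq_ueaI[OF alg_hom_compose[OF alg_hom_uea_map[OF lie_hom_diag] alg_hom_coproduct]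
      alg_hom_compose[OF alg_hom_coproduct alg_hom_tensor_map]])
  note D = alg_hom_uea_map[OF lie_hom_diag]
  show "\<Delta> (uea_map diag_hom (\<iota> a)) = tensor_map (uea_map diag_hom) (uea_map diag_hom) (\<Delta> (\<iota> a))"
    for a :: "'a \<times> 'b"
    by (simp add: uea_map_iota lie_hom_diag coproduct_iota alg_hom_add[OF alg_hom_tensor_map[OF D D]]
        tensor_map_tens alg_hom_clinear[OF D] alg_hom_one[OF D])
qed (rule alg_hom_uea_map[OF lie_hom_diag])+

text \<open>Commuting with a fixed element is preserved by the algebra operations, so generators
  suffice, and for these \<open>J_diag_commute\<close> applies to factors 0 and 1.\<close>

lemma J_diag_coproduct_commute:
  fixes t :: "'g::lie_algebra \<otimes> 'g" and u :: "('g \<times> 'h::lie_algebra) uea"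
  assumes "invariant_symmetric t" "drinfeld_associator \<Phi>"
  shows "J_slots (fps_nth (J_element \<Phi> t) n) * \<Delta> (uea_map diag_hom u) =
    \<Delta> (uea_map diag_hom u) * J_slots (fps_nth (J_element \<Phi> t) n)"
proof -
  interpret copies "factor2 :: nat \<Rightarrow> 'g \<times> 'g \<times> 'h \<Rightarrow> _" t 0 \<Phi>
    by (rule copies_factor2[OF assms])
  have "fps_image (\<lambda>z. z) (fps_image J_slots (J_element \<Phi> t)) =
      J ({0} \<times> {True}) ({0} \<times> {False}) ({1} \<times> {True}) ({1} \<times> {False})"
    by (rule J_element_places[OF copies_axioms alg_hom_id]) (simp_all add: factor2_def)
  then have J: "J_slots (fps_nth (J_element \<Phi> t) n) = fps_nth (J (X 0) (Y 0) (X 1) (Y 1)) n"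
    by (simp add: X_def Y_def fps_eq_iff)
  note D = alg_hom_compose[OF alg_hom_uea_map[OF lie_hom_diag] alg_hom_coproduct]
  show ?thesis
  proof (induction u rule: uea_induct)
    case (gen x)
    obtain a b where x: "x = (a, b)" by (cases x)
    have "\<Delta> (uea_map diag_hom (\<iota> x)) = factor2 0 (a, a, b) + factor2 1 (a, a, b)"
      unfolding uea_map_iota[OF lie_hom_diag] by (simp add: coproduct_iota factor2_def diag_hom_def x)
    then show ?case
      using J_diag_commute[of 0 1 n a b] by (simp add: J)
  qed (simp_all add: alg_hom_simps[OF D] commute_add commute_mult)
qed

text \<open>A counit in one factor empties both of its strand sets. Then the braiding exponent is 0
  and each associator in \<open>J\<close> has at least one argument 0, hence equals 1.\<close>

lemma J_element_unit:
  fixes t :: "'g::lie_algebra \<otimes> 'g"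
  assumes t: "invariant_symmetric t" "drinfeld_associator \<Phi>"
    and h: "alg_hom h"
  shows "(\<And>x. h (\<iota> x \<otimes> 1) = 0) \<Longrightarrow> (\<And>x. h (1 \<otimes> \<iota> x) = \<iota> x) \<Longrightarrow>
      fps_image h (fps_image J_slots (J_element \<Phi> t)) = (1 :: ('g \<times> 'g \<times> 'h::lie_algebra) uea fps)"
    and "(\<And>x. h (\<iota> x \<otimes> 1) = \<iota> x) \<Longrightarrow> (\<And>x. h (1 \<otimes> \<iota> x) = 0) \<Longrightarrow>
      fps_image h (fps_image J_slots (J_element \<Phi> t)) = 1"
proof -
  interpret copies "\<lambda>_ :: unit. \<iota> :: 'g \<times> 'g \<times> 'h \<Rightarrow> _" t 0 \<Phi>
    by (rule copies_uea[OF t])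
  have T: "T {} K = 0" "T K {} = 0" for K
    by (simp_all add: T_def E_def[abs_def] pairing_def tensor_lift_def lin_extend_def case_prod_beta)
  have inv1: "two_sided_inverse (1 :: ('g \<times> 'g \<times> 'h) uea fps) = 1"
    by (rule two_sided_inverse_eqI) simp_all
  note simps = J_def B_def P_def R_def T nc_eval_zero[OF t(2)] hexp_0 inv1
  show "fps_image h (fps_image J_slots (J_element \<Phi> t)) = 1"
    if "\<And>x. h (\<iota> x \<otimes> 1) = 0" "\<And>x. h (1 \<otimes> \<iota> x) = \<iota> x"
    by (subst J_element_places[OF copies_axioms h, of "{}" "UNIV"]) (use that in \<open>simp_all add: simps\<close>)
  show "fps_image h (fps_image J_slots (J_element \<Phi> t)) = 1"
    if "\<And>x. h (\<iota> x \<otimes> 1) = \<iota> x" "\<And>x. h (1 \<otimes> \<iota> x) = 0"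
    by (subst J_element_places[OF copies_axioms h, of "UNIV" "{}"]) (use that in \<open>simp_all add: simps\<close>)
qed

text \<open>The twist equation of Drinfeld, relating the associators of source and target through J.
  In the usual indices its factors J^{12,3}, J^{1,2}, J^{1,23}, J^{2,3} are four placements on the
  factors 0, 1, 2.\<close>

lemma coherence_uea:
  fixes t :: "'g::lie_algebra \<otimes> 'g" and t' :: "'h::lie_algebra \<otimes> 'h"
  assumes "invariant_symmetric t" "drinfeld_associator \<Phi>"
  defines "JU \<equiv> fps_image J_slots (J_element \<Phi> t) :: (('g \<times> 'g \<times> 'h) uea \<otimes> ('g \<times> 'g \<times> 'h) uea) fps"
  shows "associator_element \<Phi> (sum_tensor t (sum_tensor t t')) *
      (fps_image tensor_assoc (fps_image (tensor_map \<Delta> (\<lambda>x. x)) JU * fps_image (\<lambda>z. z \<otimes> 1) JU)) =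
    fps_image (tensor_map (\<lambda>x. x) \<Delta>) JU * (fps_image (\<lambda>z. 1 \<otimes> z) JU *
      fps_image (tensor_map (uea_map diag_hom) (tensor_map (uea_map diag_hom) (uea_map diag_hom)))
        (associator_element \<Phi> (sum_tensor t t')))"
proof -
  interpret copies "factor3 :: nat \<Rightarrow> 'g \<times> 'g \<times> 'h \<Rightarrow> _" t t' \<Phi>
    by (rule copies_factor3[OF assms(1,2)])
  note D = alg_hom_uea_map[OF lie_hom_diag]
  note DDD = alg_hom_tensor_map[OF D alg_hom_tensor_map[OF D D]]
  note places = J_element_places[OF copies_axioms, folded JU_def]
  have prods: "{0, 1} \<times> {True} = X 0 \<union> X 1" "{0, 1} \<times> {False} = Y 0 \<union> Y 1"
    "{1, 2} \<times> {True} = X 1 \<union> X 2" "{1, 2} \<times> {False} = Y 1 \<union> Y 2"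
    "{k} \<times> {True} = X k" "{k} \<times> {False} = Y k" for k :: nat
    by (auto simp: X_def Y_def)
  note lin = alg_hom_clinear[OF alg_hom_coproduct] clinear_ident alg_hom_clinear[OF alg_hom_tensor_assoc]
  have "fps_image (\<lambda>z. tensor_assoc (tensor_map \<Delta> (\<lambda>x. x) z)) JU =
      J ({0, 1} \<times> {True}) ({0, 1} \<times> {False}) ({2} \<times> {True}) ({2} \<times> {False})"
    by (rule places)
      (simp_all add: alg_hom_compose[OF alg_hom_tensor_map alg_hom_tensor_assoc] alg_hom_coproduct alg_hom_id
        tensor_map_tens lin coproduct_iota tens_add_left clinear_add tensor_assoc_tens factor3_def
        alg_hom_one[OF alg_hom_coproduct], simp_all add: one_tensor_def tensor_assoc_tens)
  then have J1: "fps_image tensor_assoc (fps_image (tensor_map \<Delta> (\<lambda>x. x)) JU) =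
      J (X 0 \<union> X 1) (Y 0 \<union> Y 1) (X 2) (Y 2)"
    by (simp only: fps_image_fps_image prods)
  have "fps_image (\<lambda>z. tensor_assoc (z \<otimes> 1)) JU =
      J ({0} \<times> {True}) ({0} \<times> {False}) ({1} \<times> {True}) ({1} \<times> {False})"
    by (rule places)
      (simp_all add: alg_hom_compose[OF alg_hom_tens_left alg_hom_tensor_assoc] tensor_assoc_tens factor3_def)
  then have J2: "fps_image tensor_assoc (fps_image (\<lambda>z. z \<otimes> 1) JU) = J (X 0) (Y 0) (X 1) (Y 1)"
    by (simp only: fps_image_fps_image prods)
  have "fps_image (tensor_map (\<lambda>x. x) \<Delta>) JU =
      J ({0} \<times> {True}) ({0} \<times> {False}) ({1, 2} \<times> {True}) ({1, 2} \<times> {False})"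
    by (rule places)
      (simp_all add: alg_hom_tensor_map alg_hom_coproduct alg_hom_id tensor_map_tens lin coproduct_iota
        tens_add_right factor3_def alg_hom_one[OF alg_hom_coproduct], simp_all add: one_tensor_def)
  then have J3: "fps_image (tensor_map (\<lambda>x. x) \<Delta>) JU = J (X 0) (Y 0) (X 1 \<union> X 2) (Y 1 \<union> Y 2)"
    by (simp only: prods)
  have "fps_image (\<lambda>z. 1 \<otimes> z) JU =
      J ({1} \<times> {True}) ({1} \<times> {False}) ({2} \<times> {True}) ({2} \<times> {False})"
    by (rule places) (simp_all add: alg_hom_tens_right factor3_def)
  then have J4: "fps_image (\<lambda>z. 1 \<otimes> z) JU = J (X 1) (Y 1) (X 2) (Y 2)"
    by (simp only: prods)
  have f: "factor3 0 = (\<lambda>x :: 'g \<times> 'g \<times> 'h. \<iota> x \<otimes> 1 \<otimes> 1)"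
    "factor3 1 = (\<lambda>x :: 'g \<times> 'g \<times> 'h. 1 \<otimes> \<iota> x \<otimes> 1)"
    "factor3 2 = (\<lambda>x :: 'g \<times> 'g \<times> 'h. 1 \<otimes> 1 \<otimes> \<iota> x)"
    by (simp_all add: factor3_def fun_eq_iff)
  have \<Phi>1: "associator_element \<Phi> (sum_tensor t (sum_tensor t t')) =
      nc_eval \<Phi> (pairing (factor3 0) (factor3 1) (sum_tensor t (sum_tensor t t')))
        (pairing (factor3 1) (factor3 2) (sum_tensor t (sum_tensor t t')))"
    unfolding f fps_image_associator_element[OF alg_hom_id, symmetric]
    by (simp add: fps_image_def fps_nth_inverse)
  have \<Phi>2: "fps_image (tensor_map (uea_map diag_hom) (tensor_map (uea_map diag_hom) (uea_map diag_hom)))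
        (associator_element \<Phi> (sum_tensor t t')) =
      nc_eval \<Phi> (pairing (\<lambda>x. factor3 0 (diag_hom x)) (\<lambda>x. factor3 1 (diag_hom x)) (sum_tensor t t'))
        (pairing (\<lambda>x. factor3 1 (diag_hom x)) (\<lambda>x. factor3 2 (diag_hom x)) (sum_tensor t t'))"
    unfolding f
    by (simp add: fps_image_associator_element[OF DDD] tensor_map_tens alg_hom_clinear[OF D]
        alg_hom_clinear[OF alg_hom_tensor_map[OF D D]] alg_hom_one[OF D] uea_map_iota lie_hom_diag)
  show ?thesis
    unfolding fps_image_mult[OF alg_hom_tensor_assoc] J1 J2 J3 J4 \<Phi>1 \<Phi>2
    by (rule coherence) simp_all
qed

subsection \<open>The functor\<close>

lemma F_obj_action: "alg_action \<rho> \<Longrightarrow> alg_action (F_obj \<rho>)"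
  unfolding F_obj_def by (rule alg_action_compose[OF _ alg_hom_uea_map[OF lie_hom_diag]])

lemma tensor_module_action: "alg_action \<rho> \<Longrightarrow> alg_action \<sigma> \<Longrightarrow> alg_action (tensor_module \<rho> \<sigma>)"
  unfolding tensor_module_def
  by (rule alg_action_compose[OF alg_action_tensor alg_hom_coproduct])

lemma unit_module_action: "alg_action unit_module"
  by (auto simp: alg_action_def unit_module_def fun_eq_iff alg_hom_simps[OF alg_hom_counit]
      scaleC_complex_def algebra_simps intro!: cbilinearI)

lemma F_obj_unit: "F_obj unit_module = unit_module"
proof -
  have "counit (uea_map diag_hom u) = counit u" for u :: "('a \<times> 'b) uea"
    by (rule alg_hom_eq_ueaI[OF alg_hom_compose[OF alg_hom_uea_map[OF lie_hom_diag] alg_hom_counit] alg_hom_counit])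
      (simp add: uea_map_iota lie_hom_diag counit_iota)
  then show ?thesis by (simp add: fun_eq_iff F_obj_def unit_module_def)
qed

lemma F_obj_hom: "drinfeld_hom \<rho> \<sigma> f \<Longrightarrow> drinfeld_hom (F_obj \<rho>) (F_obj \<sigma>) (F_mor f)"
  by (simp add: drinfeld_hom_def uea_module_hom_def F_obj_def F_mor_def)

text \<open>On both sides \<open>u\<close> acts through the coproduct of its diagonal image, because
  the coproduct is natural for Lie homomorphisms; what remains is a commutation in the
  algebra.\<close>

lemma J_mor_hom:
  assumes "invariant_symmetric t" "drinfeld_associator \<Phi>" and \<rho>: "alg_action \<rho>" and \<sigma>: "alg_action \<sigma>"
  shows "drinfeld_hom (tensor_module (F_obj \<rho>) (F_obj \<sigma>)) (F_obj (tensor_module \<rho> \<sigma>)) (J_mor \<Phi> t \<rho> \<sigma>)"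
proof -
  note A = alg_action_tensor[OF \<rho> \<sigma>]
  have "tensor_module (F_obj \<rho>) (F_obj \<sigma>) u = tensor_action \<rho> \<sigma> (\<Delta> (uea_map diag_hom u))" for u
    unfolding coproduct_diag tensor_module_def F_obj_def
    by (rule tensor_action_tensor_map[symmetric])
      (simp_all add: alg_action_cbilinear \<rho> \<sigma> alg_hom_clinear alg_hom_uea_map lie_hom_diag)
  then show ?thesis
    by (simp add: J_diag_coproduct_commute[OF assms(1,2)] drinfeld_hom_def uea_module_hom_def J_mor_fps_image[OF \<rho> \<sigma>] alg_action_clinear[OF A]
        F_obj_def tensor_module_def flip: alg_action_mult[OF A])
qed

lemma tensor_action_natural:
  assumes "cbilinear \<rho>" "cbilinear \<sigma>" "cbilinear \<rho>'" "cbilinear \<sigma>'"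
    and f: "uea_module_hom \<rho> \<rho>' f" and g: "uea_module_hom \<sigma> \<sigma>' g"
  shows "tensor_map f g (tensor_action \<rho> \<sigma> z w) = tensor_action \<rho>' \<sigma>' z (tensor_map f g w)"
proof -
  have lin: "clinear f" "clinear g" and com: "\<And>u x. f (\<rho> u x) = \<rho>' u (f x)" "\<And>u x. g (\<sigma> u x) = \<sigma>' u (g x)"
    using f g by (auto simp: uea_module_hom_def)
  show ?thesis
    by (rule cbilinear_tens_eqI[OF clinear_cbilinear[OF cbilinear_tensor_action clinear_tensor_map]
          cbilinear_compose[OF cbilinear_tensor_action clinear_ident clinear_tensor_map]])
      (simp_all add: assms lin tensor_action_tens_tens tensor_map_tens com)
qed

lemma J_mor_natural:
  assumes act: "alg_action \<rho>" "alg_action \<rho>'" "alg_action \<sigma>" "alg_action \<sigma>'"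
    and f: "drinfeld_hom \<rho> \<rho>' f" and g: "drinfeld_hom \<sigma> \<sigma>' g"
  shows "htensor f g \<circ>\<^sub>h J_mor \<Phi> t \<rho> \<sigma> = J_mor \<Phi> t \<rho>' \<sigma>' \<circ>\<^sub>h htensor f g"
  unfolding J_mor_fps_image[OF act(1,3)] J_mor_fps_image[OF act(2,4)]
proof (rule hcomp_fps_image_natural)
  fix n z w
  show "fps_nth (htensor f g) n (tensor_action \<rho> \<sigma> z w) = tensor_action \<rho>' \<sigma>' z (fps_nth (htensor f g) n w)"
    using f g unfolding drinfeld_hom_def htensor_def fps_nth_Abs_fps
      clinear_sum[OF alg_action_clinear[OF alg_action_tensor[OF act(2,4)]]]
    by (intro sum.cong refl tensor_action_natural alg_action_cbilinear act) auto
qed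

text \<open>Each constituent is the action \<open>?L\<close> or \<open>?R\<close> of a series.
  Moving \<open>tensor_assoc\<close> to the right turns every \<open>?L\<close> into
  \<open>?R\<close>, and the two composites become the two sides of
  \<open>coherence_uea\<close>.\<close>

lemma J_mor_associativity:
  fixes \<rho> :: "('g::lie_algebra \<times> 'g \<times> 'h::lie_algebra, 'x::complex_vector) action"
    and \<sigma> :: "('g \<times> 'g \<times> 'h, 'y::complex_vector) action"
    and \<tau> :: "('g \<times> 'g \<times> 'h, 'z::complex_vector) action"
  assumes t: "invariant_symmetric t" "drinfeld_associator \<Phi>"
    and act: "alg_action \<rho>" "alg_action \<sigma>" "alg_action \<tau>"
  shows "associativity \<Phi> (sum_tensor t (sum_tensor t t')) \<rho> \<sigma> \<tau> \<circ>\<^sub>h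
      J_mor \<Phi> t (tensor_module \<rho> \<sigma>) \<tau> \<circ>\<^sub>h htensor (J_mor \<Phi> t \<rho> \<sigma>) hid =
    J_mor \<Phi> t \<rho> (tensor_module \<sigma> \<tau>) \<circ>\<^sub>h htensor hid (J_mor \<Phi> t \<sigma> \<tau>) \<circ>\<^sub>h
      associativity \<Phi> (sum_tensor t t') (F_obj \<rho>) (F_obj \<sigma>) (F_obj \<tau>)"
proof -
  define JU :: "(('g \<times> 'g \<times> 'h) uea \<otimes> ('g \<times> 'g \<times> 'h) uea) fps"
    where "JU = fps_image J_slots (J_element \<Phi> t)"
  let ?L = "tensor_action (tensor_action \<rho> \<sigma>) \<tau>" and ?R = "tensor_action \<rho> (tensor_action \<sigma> \<tau>)"
  let ?D = "uea_map diag_hom"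
  note act2 = alg_action_tensor[OF act(1,2)] alg_action_tensor[OF act(2,3)]
  note L = alg_action_tensor[OF act2(1) act(3)] and R = alg_action_tensor[OF act(1) act2(2)]
  note bil = act[THEN alg_action_cbilinear] act2[THEN alg_action_cbilinear]
  note lin = alg_hom_clinear[OF alg_hom_coproduct] clinear_ident alg_hom_clinear[OF alg_hom_uea_map[OF lie_hom_diag]]
  have J: "J_mor \<Phi> t \<rho> \<sigma> = fps_image (tensor_action \<rho> \<sigma>) JU" "J_mor \<Phi> t \<sigma> \<tau> = fps_image (tensor_action \<sigma> \<tau>) JU"
    by (simp_all add: J_mor_fps_image act JU_def)
  have 1: "J_mor \<Phi> t (tensor_module \<rho> \<sigma>) \<tau> = fps_image ?L (fps_image (tensor_map \<Delta> (\<lambda>x. x)) JU)"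
    unfolding J_mor_fps_image[OF tensor_module_action[OF act(1,2)] act(3)]
    using tensor_action_tensor_map[OF bil(4,3) lin(1,2)]
    by (simp add: JU_def fps_image_fps_image tensor_module_def[abs_def])
  have 2: "htensor (J_mor \<Phi> t \<rho> \<sigma>) hid = fps_image ?L (fps_image (\<lambda>z. z \<otimes> 1) JU)"
    unfolding J by (rule htensor_fps_image(1)[OF act2(1) act(3)])
  have 3: "J_mor \<Phi> t \<rho> (tensor_module \<sigma> \<tau>) = fps_image ?R (fps_image (tensor_map (\<lambda>x. x) \<Delta>) JU)"
    unfolding J_mor_fps_image[OF act(1) tensor_module_action[OF act(2,3)]]
    using tensor_action_tensor_map[OF bil(1,5) lin(2,1)]
    by (simp add: JU_def fps_image_fps_image tensor_module_def[abs_def])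
  have 4: "htensor hid (J_mor \<Phi> t \<sigma> \<tau>) = fps_image ?R (fps_image (\<lambda>z. 1 \<otimes> z) JU)"
    unfolding J by (rule htensor_fps_image(2)[OF act(1) act2(2)])
  have "tensor_action (F_obj \<rho>) (tensor_action (F_obj \<sigma>) (F_obj \<tau>)) = (\<lambda>z. ?R (tensor_map ?D (tensor_map ?D ?D) z))"
    using tensor_action_tensor_map[OF bil(1,5) lin(3) clinear_tensor_map[OF lin(3,3)]]
      tensor_action_tensor_map[OF bil(2,3) lin(3,3)]
    by (simp add: F_obj_def[abs_def])
  then have 5: "associativity \<Phi> (sum_tensor t t') (F_obj \<rho>) (F_obj \<sigma>) (F_obj \<tau>) =
      fps_image ?R (fps_image (tensor_map ?D (tensor_map ?D ?D)) (associator_element \<Phi> (sum_tensor t t'))) \<circ>\<^sub>h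
        hconst tensor_assoc"
    by (simp add: associativity_def fps_image_fps_image)
  have assoc: "hconst tensor_assoc \<circ>\<^sub>h fps_image ?L q = fps_image ?R (fps_image tensor_assoc q) \<circ>\<^sub>h hconst tensor_assoc" for q
    by (rule hconst_hcomp_fps_image) (simp_all add: tensor_assoc_action bil alg_action_0[OF R])
  have linR: "clinear (fps_nth (fps_image ?R q) n)" for q n
    by (simp add: alg_action_clinear[OF R])
  let ?a = "associator_element \<Phi> (sum_tensor t (sum_tensor t t'))"
  let ?q = "fps_image (tensor_map \<Delta> (\<lambda>x. x)) JU * fps_image (\<lambda>z. z \<otimes> 1) JU"
  have "associativity \<Phi> (sum_tensor t (sum_tensor t t')) \<rho> \<sigma> \<tau> \<circ>\<^sub>h
      J_mor \<Phi> t (tensor_module \<rho> \<sigma>) \<tau> \<circ>\<^sub>h htensor (J_mor \<Phi> t \<rho> \<sigma>) hid =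
    (fps_image ?R ?a \<circ>\<^sub>h hconst tensor_assoc) \<circ>\<^sub>h fps_image ?L ?q"
    by (simp only: 1 2 hcomp_fps_image[OF L] associativity_def)
  also have "\<dots> = fps_image ?R ?a \<circ>\<^sub>h fps_image ?R (fps_image tensor_assoc ?q) \<circ>\<^sub>h hconst tensor_assoc"
    by (simp only: hcomp_assoc[OF linR] assoc)
  also have "\<dots> = fps_image ?R (?a * fps_image tensor_assoc ?q) \<circ>\<^sub>h hconst tensor_assoc"
    by (simp only: hcomp_assoc[OF linR, symmetric] hcomp_fps_image[OF R])
  also have "\<dots> = fps_image ?R (fps_image (tensor_map (\<lambda>x. x) \<Delta>) JU * (fps_image (\<lambda>z. 1 \<otimes> z) JU *
      fps_image (tensor_map ?D (tensor_map ?D ?D)) (associator_element \<Phi> (sum_tensor t t')))) \<circ>\<^sub>h hconst tensor_assoc"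
    by (simp only: coherence_uea[OF t, of t', folded JU_def])
  finally show ?thesis
    by (simp only: 3 4 5 hcomp_fps_image[OF R, symmetric] hcomp_assoc[OF linR])
qed

lemma hcomp_hid:
  assumes "alg_action \<rho>"
  shows "fps_image \<rho> q \<circ>\<^sub>h hid = fps_image \<rho> q"
  by (rule hmor_eqI) (simp add: hcomp_hconst_nth alg_action_0[OF assms])

text \<open>The unitors intertwine the action of an element on the tensor product with the action of
  its image under the counit in one factor; for J this image is 1.\<close>

lemma J_mor_unit:
  fixes \<rho> :: "('g::lie_algebra \<times> 'g \<times> 'h::lie_algebra, 'x::complex_vector) action"
  assumes t: "invariant_symmetric t" "drinfeld_associator \<Phi>" and \<rho>: "alg_action \<rho>"
  shows "left_unitor \<circ>\<^sub>h J_mor \<Phi> t unit_module \<rho> \<circ>\<^sub>h htensor hid hid = left_unitor"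
    and "right_unitor \<circ>\<^sub>h J_mor \<Phi> t \<rho> unit_module \<circ>\<^sub>h htensor hid hid = right_unitor"
proof -
  have one: "fps_image \<rho> 1 \<circ>\<^sub>h hconst g = hconst g" for g :: "'z \<Rightarrow> _"
    by (rule hmor_eqI) (auto simp: hcomp_hconst_nth alg_action_0[OF \<rho>] hconst_nth alg_action_one[OF \<rho>])
  have eps: "alg_hom (\<lambda>u. counit u *\<^sub>C 1)"
    by (auto intro!: alg_homI clinearI simp: alg_hom_simps[OF alg_hom_counit] scaleC_add_left scaleC_complex_def)
  have comm: "(counit u *\<^sub>C 1) * v = v * (counit u *\<^sub>C 1)"
    for u and v :: "('g \<times> 'g \<times> 'h) uea" by simp
  note bil = alg_action_cbilinear[OF unit_module_action] alg_action_cbilinear[OF \<rho>]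

  \<comment> \<open>This is counit \<otimes> id, with values taken in the second factor; scalars
    commute with everything, so it is a homomorphism.\<close>
  let ?l = "tensor_lift (\<lambda>(u :: ('g \<times> 'g \<times> 'h) uea) (v :: ('g \<times> 'g \<times> 'h) uea). counit u *\<^sub>C 1 * v)" and ?L = "tensor_lift (\<lambda>c x. c *\<^sub>C x)"
  note l = alg_hom_tensor_lift_mult[OF eps alg_hom_id comm]
  have "?L (tensor_action unit_module \<rho> z w) = \<rho> (?l z) (?L w)" for z w
    by (rule cbilinear_tens_eqI[OF
          clinear_cbilinear[OF cbilinear_tensor_action[OF bil] clinear_tensor_lift[OF cbilinear_scaleC]]
          cbilinear_compose[OF bil(2) alg_hom_clinear[OF l(1)] clinear_tensor_lift[OF cbilinear_scaleC]]])
      (simp only: tensor_action_tens_tens bil l(2) tensor_lift_tens[OF cbilinear_scaleC], 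
        simp add: unit_module_def cbilinear_scale_left[OF bil(2)] cbilinear_scale_right[OF bil(2)])
  then have "left_unitor \<circ>\<^sub>h J_mor \<Phi> t unit_module \<rho> \<circ>\<^sub>h htensor hid hid =
      fps_image \<rho> (fps_image ?l (fps_image J_slots (J_element \<Phi> t))) \<circ>\<^sub>h left_unitor"
    unfolding left_unitor_def J_mor_fps_image[OF unit_module_action \<rho>] htensor_hid
      hcomp_hid[OF alg_action_tensor[OF unit_module_action \<rho>]]
    by (intro hconst_hcomp_fps_image alg_action_0[OF \<rho>])
  also have "fps_image ?l (fps_image J_slots (J_element \<Phi> t)) = 1"
  proof (rule J_element_unit(1)[OF t, where h = ?l])
    show "alg_hom ?l" by (rule l(1))
  qed (simp_all only: l(2) counit_iota alg_hom_one[OF alg_hom_counit], simp_all)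
  finally show "left_unitor \<circ>\<^sub>h J_mor \<Phi> t unit_module \<rho> \<circ>\<^sub>h htensor hid hid = left_unitor"
    by (simp add: left_unitor_def one)

  let ?r = "tensor_lift (\<lambda>(u :: ('g \<times> 'g \<times> 'h) uea) (v :: ('g \<times> 'g \<times> 'h) uea). u * counit v *\<^sub>C 1)" and ?R = "tensor_lift (\<lambda>x c. c *\<^sub>C x)"
  note r = alg_hom_tensor_lift_mult[OF alg_hom_id eps comm[symmetric]]
  have scale: "cbilinear (\<lambda>x c. c *\<^sub>C x :: 'x)"
    using cbilinear_scaleC by (simp add: cbilinear_def)
  have "?R (tensor_action \<rho> unit_module z w) = \<rho> (?r z) (?R w)" for z w
    by (rule cbilinear_tens_eqI[OF
          clinear_cbilinear[OF cbilinear_tensor_action[OF bil(2,1)] clinear_tensor_lift[OF scale]]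
          cbilinear_compose[OF bil(2) alg_hom_clinear[OF r(1)] clinear_tensor_lift[OF scale]]])
      (simp only: tensor_action_tens_tens bil r(2) tensor_lift_tens[OF scale],
        simp add: unit_module_def cbilinear_scale_left[OF bil(2)] cbilinear_scale_right[OF bil(2)])
  then have "right_unitor \<circ>\<^sub>h J_mor \<Phi> t \<rho> unit_module \<circ>\<^sub>h htensor hid hid =
      fps_image \<rho> (fps_image ?r (fps_image J_slots (J_element \<Phi> t))) \<circ>\<^sub>h right_unitor"
    unfolding right_unitor_def J_mor_fps_image[OF \<rho> unit_module_action] htensor_hid
      hcomp_hid[OF alg_action_tensor[OF \<rho> unit_module_action]]
    by (intro hconst_hcomp_fps_image alg_action_0[OF \<rho>])
  also have "fps_image ?r (fps_image J_slots (J_element \<Phi> t)) = 1"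
  proof (rule J_element_unit(2)[OF t, where h = ?r])
    show "alg_hom ?r" by (rule r(1))
  qed (simp_all only: r(2) counit_iota alg_hom_one[OF alg_hom_counit], simp_all)
  finally show "right_unitor \<circ>\<^sub>h J_mor \<Phi> t \<rho> unit_module \<circ>\<^sub>h htensor hid hid = right_unitor"
    by (simp add: right_unitor_def one)
qed

theorem theorem2:
  fixes \<Phi> :: nc_series
    and t\<^sub>g :: "'g::lie_algebra \<otimes> 'g"
    and t\<^sub>h :: "'h::lie_algebra \<otimes> 'h"
  assumes "drinfeld_associator \<Phi>"
    and "invariant_symmetric t\<^sub>g"
    and "invariant_symmetric t\<^sub>h"
  shows
    \<comment> \<open>functoriality\<close>
    "(\<forall>\<rho> :: ('g \<times> 'g \<times> 'h, 'x::complex_vector) action.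
        uea_module \<rho> \<longrightarrow> uea_module (F_obj \<rho>)) \<and>
     (\<forall>(\<rho> :: ('g \<times> 'g \<times> 'h, 'x) action) (\<sigma> :: ('g \<times> 'g \<times> 'h, 'y::complex_vector) action) f.
        uea_module \<rho> \<and> uea_module \<sigma> \<and> drinfeld_hom \<rho> \<sigma> f \<longrightarrow>
        drinfeld_hom (F_obj \<rho>) (F_obj \<sigma>) (F_mor f)) \<and>
     F_mor (hid :: ('x \<Rightarrow> 'x) fps) = hid \<and>
     (\<forall>(\<rho> :: ('g \<times> 'g \<times> 'h, 'x) action) (\<sigma> :: ('g \<times> 'g \<times> 'h, 'y) action)
        (\<tau> :: ('g \<times> 'g \<times> 'h, 'z::complex_vector) action) f g.
        uea_module \<rho> \<and> uea_module \<sigma> \<and> uea_module \<tau> \<and>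
        drinfeld_hom \<rho> \<sigma> f \<and> drinfeld_hom \<sigma> \<tau> g \<longrightarrow>
        F_mor (g \<circ>\<^sub>h f) = F_mor g \<circ>\<^sub>h F_mor f) \<and>
     \<comment> \<open>the coherence maps are natural morphisms\<close>
     (\<forall>(\<rho> :: ('g \<times> 'g \<times> 'h, 'x) action) (\<sigma> :: ('g \<times> 'g \<times> 'h, 'y) action).
        uea_module \<rho> \<and> uea_module \<sigma> \<longrightarrow>
        drinfeld_hom (tensor_module (F_obj \<rho>) (F_obj \<sigma>)) (F_obj (tensor_module \<rho> \<sigma>)) (J_mor \<Phi> t\<^sub>g \<rho> \<sigma>)) \<and>
     (\<forall>(\<rho> :: ('g \<times> 'g \<times> 'h, 'x) action) (\<rho>' :: ('g \<times> 'g \<times> 'h, 'x'::complex_vector) action)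
        (\<sigma> :: ('g \<times> 'g \<times> 'h, 'y) action) (\<sigma>' :: ('g \<times> 'g \<times> 'h, 'y'::complex_vector) action) f g.
        uea_module \<rho> \<and> uea_module \<rho>' \<and> uea_module \<sigma> \<and> uea_module \<sigma>' \<and>
        drinfeld_hom \<rho> \<rho>' f \<and> drinfeld_hom \<sigma> \<sigma>' g \<longrightarrow>
        F_mor (htensor f g) \<circ>\<^sub>h J_mor \<Phi> t\<^sub>g \<rho> \<sigma> =
          J_mor \<Phi> t\<^sub>g \<rho>' \<sigma>' \<circ>\<^sub>h htensor (F_mor f) (F_mor g)) \<and>
     \<comment> \<open>compatibility with the associativity constraints\<close>
     (\<forall>(\<rho> :: ('g \<times> 'g \<times> 'h, 'x) action) (\<sigma> :: ('g \<times> 'g \<times> 'h, 'y) action)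
        (\<tau> :: ('g \<times> 'g \<times> 'h, 'z) action).
        uea_module \<rho> \<and> uea_module \<sigma> \<and> uea_module \<tau> \<longrightarrow>
        F_mor (associativity \<Phi> (sum_tensor t\<^sub>g (sum_tensor t\<^sub>g t\<^sub>h)) \<rho> \<sigma> \<tau>) \<circ>\<^sub>h
          J_mor \<Phi> t\<^sub>g (tensor_module \<rho> \<sigma>) \<tau> \<circ>\<^sub>h htensor (J_mor \<Phi> t\<^sub>g \<rho> \<sigma>) hid =
        J_mor \<Phi> t\<^sub>g \<rho> (tensor_module \<sigma> \<tau>) \<circ>\<^sub>h htensor hid (J_mor \<Phi> t\<^sub>g \<sigma> \<tau>) \<circ>\<^sub>h
          associativity \<Phi> (sum_tensor t\<^sub>g t\<^sub>h) (F_obj \<rho>) (F_obj \<sigma>) (F_obj \<tau>)) \<and>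
     \<comment> \<open>the unit object, with the identity as unit coherence\<close>
     F_obj (unit_module :: ('g \<times> 'g \<times> 'h, complex) action) = unit_module \<and>
     (\<forall>\<rho> :: ('g \<times> 'g \<times> 'h, 'x) action. uea_module \<rho> \<longrightarrow>
        F_mor left_unitor \<circ>\<^sub>h J_mor \<Phi> t\<^sub>g unit_module \<rho> \<circ>\<^sub>h htensor hid hid = left_unitor \<and>
        F_mor right_unitor \<circ>\<^sub>h J_mor \<Phi> t\<^sub>g \<rho> unit_module \<circ>\<^sub>h htensor hid hid = right_unitor)"
  using assms
  unfolding uea_module_iff F_mor_def
  by (auto simp: F_obj_action F_obj_unit F_obj_hom[unfolded F_mor_def] J_mor_hom J_mor_natural
      J_mor_associativity J_mor_unit)

end
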